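(* Let $G=\mathbb{Z}/p\mathbb{Z}$ with $p$ an odd prime, let $\mathbf{k}$ be a field with $\operatorname{char}\mathbf{k}\neq p$, and let $V$ be a finite-dimensional, faithful representation of $G$ over $\mathbf{k}$ in which exactly $2$ distinct nontrivial characters of $G$ occur. Then $$\beta_{\mathrm{field}}(G,V)=\gamma_{\mathrm{field}}(G,V)\geq \lceil \sqrt{p}+1\rceil,$$ with equality in the inequality if and only if either - $p=3$, or - $p=d^2-3d+1$ for a natural number $d\geq 4$, and $[\operatorname{Supp}'V]=[\{1,\,d^2-4d+2\}]$.
   Context: $\mathbf{k}[V]$ is the ring of polynomial functions on $V$, $\mathbf{k}(V)$ its fraction field, with $G$ acting by $(gf)(v)=f(g^{-1}v)$; $\mathbf{k}[V]^G$, $\mathbf{k}(V)^G$ are the invariants, and $\mathbf{k}[V]^G_{\leq d}$ is the space of invariant polynomials of degree at most $d$. $\beta_{\mathrm{field}}(G,V)$ is the least natural number $d$ such that $\mathbf{k}[V]^G_{\leq d}$ generates $\mathbf{k}(V)^G$ as a field extension of $\mathbf{k}$. $\gamma_{\mathrm{field}}(G,V)$ is the least natural number $d$ such that $\mathbf{k}(V)^G$ is a finite field extension of its subfield $\mathbf{k}(\mathbf{k}[V]^G_{\leq d})$. Characters occurring in $V$ (or $V^*$) are those occurring after base change to an extension field $\mathbf{K}\supseteq\mathbf{k}$ containing the $p$th roots of unity. Fix a primitive $p$th root of unity $\zeta\in\mathbf{K}$; an integer $A$ (mod $p$) represents the character $a\mapsto\zeta^{Aa}$ of $G=\mathbb{Z}/p\mathbb{Z}$.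 $\operatorname{Supp}'V$ is the set of distinct nontrivial characters occurring in $V^*$. For a set $S$ of nontrivial characters, $[S]$ is the orbit of $S$ under the natural action of $\operatorname{Aut}G$ on subsets of the character group; i.e. $[S]=[S']$ iff $S'=kS$ mod $p$ for some integer $k$ prime to $p$. *)

theory Defs
  imports
    "HOL-Analysis.Cartesian_Space"
    "HOL-Library.Poly_Mapping"
    "HOL-Computational_Algebra.Fraction_Field"
    "HOL-Algebra.Elementary_Groups"
    "HOL-Algebra.Generated_Fields"
    "HOL-Algebra.Embedded_Algebras"
    "HOL-Algebra.Bij"
    "HOL-Algebra.Algebraic_Closure_Type"
begin

text \<open>
  The space \<open>V\<close> is \<open>k^'n\<close>.  Since \<open>k\<close> may be finite, the ring \<open>k[V]\<close> of polynomial functions is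
  the polynomial ring in the coordinate functions (that is, \<open>Sym(V*)\<close>), not a ring of set-theoretic
  functions, which would have no fraction field.  The order on \<open>'n\<close> plays no mathematical role: it
  is there because the library makes \<open>poly_mapping\<close> an integral domain only for ordered exponents.
\<close>

section \<open>The polynomial ring and the field of rational functions\<close>

type_synonym ('n, 'k) polys = "('n \<Rightarrow>\<^sub>0 nat) \<Rightarrow>\<^sub>0 'k"
type_synonym ('n, 'k) rats = "('n, 'k) polys fract"

definition poly_const :: "'k \<Rightarrow> ('n, 'k::zero) polys" where
  "poly_const c = Poly_Mapping.single 0 c"

definition poly_coord :: "'n \<Rightarrow> ('n, 'k::zero_neq_one) polys" where
  "poly_coord i = Poly_Mapping.single (Poly_Mapping.single i 1) 1"

definition poly_subst ::
    "('n \<Rightarrow> ('n, 'k) polys) \<Rightarrow> ('n::finite, 'k::comm_ring_1) polys \<Rightarrow> ('n, 'k) polys" where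
  "poly_subst s f =
     (\<Sum>m\<in>Poly_Mapping.keys f.
        poly_const (Poly_Mapping.lookup f m) * (\<Prod>i\<in>UNIV. s i ^ Poly_Mapping.lookup m i))"

text \<open>The polynomial function \<open>v \<mapsto> f (A v)\<close>.\<close>

definition poly_precomp ::
    "'k^'n^'n \<Rightarrow> ('n::finite, 'k::comm_ring_1) polys \<Rightarrow> ('n, 'k) polys" where
  "poly_precomp A = poly_subst (\<lambda>i. \<Sum>j\<in>UNIV. poly_const (A $ i $ j) * poly_coord j)"

text \<open>
  The rational function \<open>v \<mapsto> q (A v)\<close>.  For invertible \<open>A\<close> this does not depend on the chosen fraction;
  see \<open>rat_precomp_Fract\<close> below.
\<close>

definition rat_precomp ::
    "'k^'n::{finite,linorder}^'n::{finite,linorder} \<Rightarrow> ('n, 'k::field) rats \<Rightarrow> ('n, 'k) rats" where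
  "rat_precomp A q =
     (THE r. \<exists>f h. h \<noteq> 0 \<and> q = Fract f h \<and> r = Fract (poly_precomp A f) (poly_precomp A h))"

lemma poly_const_simps [simp]:
  "poly_const 0 = 0" "poly_const 1 = 1"
  by (simp_all add: poly_const_def)

lemma poly_const_add: "poly_const (a + b) = poly_const a + poly_const (b::'k::comm_ring_1)"
  by (simp add: poly_const_def single_add)

lemma poly_const_mult: "poly_const (a * b) = poly_const a * poly_const (b::'k::comm_ring_1)"
  by (simp add: poly_const_def mult_single)

lemma poly_const_sum: "poly_const (\<Sum>i\<in>I. h i) = (\<Sum>i\<in>I. poly_const (h i::'k::comm_ring_1))"
  by (induction I rule: infinite_finite_induct) (simp_all add: poly_const_add)

lemma poly_subst_superset:
  assumes "finite M" "Poly_Mapping.keys f \<subseteq> M"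
  shows "poly_subst s f =
    (\<Sum>m\<in>M. poly_const (Poly_Mapping.lookup f m) * (\<Prod>i\<in>UNIV. s i ^ Poly_Mapping.lookup m i))"
  unfolding poly_subst_def using assms
  by (intro sum.mono_neutral_left) (auto simp: in_keys_iff)

lemma poly_subst_0 [simp]: "poly_subst s 0 = 0"
  by (simp add: poly_subst_def)

lemma poly_subst_add: "poly_subst s (f + g) = poly_subst s f + poly_subst s g"
proof -
  let ?M = "Poly_Mapping.keys f \<union> Poly_Mapping.keys g"
  have "finite ?M" "Poly_Mapping.keys (f + g) \<subseteq> ?M"
    by (simp_all add: keys_add)
  then show ?thesis
    by (simp add: poly_subst_superset[of ?M] lookup_add poly_const_add distrib_right sum.distrib)
qed

lemma poly_subst_sum: "poly_subst s (\<Sum>i\<in>I. h i) = (\<Sum>i\<in>I. poly_subst s (h i))"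
  by (induction I rule: infinite_finite_induct) (simp_all add: poly_subst_add)

lemma poly_subst_single:
  "poly_subst s (Poly_Mapping.single m c) =
     poly_const c * (\<Prod>i\<in>UNIV. s i ^ Poly_Mapping.lookup m i)"
  by (cases "c = 0") (simp_all add: poly_subst_def)

lemma poly_subst_const [simp]: "poly_subst s (poly_const c) = poly_const c"
  unfolding poly_const_def poly_subst_single by (simp add: poly_const_def)

lemma poly_subst_1 [simp]: "poly_subst s 1 = 1"
  using poly_subst_const[of s 1] by simp

lemma poly_subst_coord [simp]: "poly_subst s (poly_coord i) = s i"
proof -
  have "(\<Prod>j\<in>UNIV. s j ^ Poly_Mapping.lookup (Poly_Mapping.single i 1) j) =
      (\<Prod>j\<in>UNIV. if j = i then s j else 1)"
    by (intro prod.cong) (auto simp: lookup_single)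
  then show ?thesis
    by (simp add: poly_coord_def poly_subst_single)
qed

lemma poly_mapping_sum_single:
  "f = (\<Sum>m\<in>Poly_Mapping.keys f. Poly_Mapping.single m (Poly_Mapping.lookup f m))"
  by (rule poly_mapping_eqI) (auto simp: lookup_sum lookup_single when_def in_keys_iff)

lemma poly_subst_mult: "poly_subst s (f * g) = poly_subst s f * poly_subst s g"
proof -
  have single: "poly_subst s (Poly_Mapping.single m a * Poly_Mapping.single l b) =
      poly_subst s (Poly_Mapping.single m a) * poly_subst s (Poly_Mapping.single l b)" for m l a b
    by (simp add: mult_single poly_subst_single poly_const_mult lookup_add power_add
        prod.distrib mult_ac)
  let ?F = "\<Sum>m\<in>Poly_Mapping.keys f. Poly_Mapping.single m (Poly_Mapping.lookup f m)"
  let ?G = "\<Sum>m\<in>Poly_Mapping.keys g. Poly_Mapping.single m (Poly_Mapping.lookup g m)"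
  have "poly_subst s (?F * ?G) = poly_subst s ?F * poly_subst s ?G"
    by (simp add: sum_product poly_subst_sum single)
  then show ?thesis
    using poly_mapping_sum_single[of f] poly_mapping_sum_single[of g] by simp
qed

lemma poly_subst_power: "poly_subst s (f ^ n) = poly_subst s f ^ n"
  by (induction n) (simp_all add: poly_subst_mult)

lemma poly_subst_prod: "poly_subst s (\<Prod>i\<in>I. h i) = (\<Prod>i\<in>I. poly_subst s (h i))"
  by (induction I rule: infinite_finite_induct) (simp_all add: poly_subst_mult)

lemma poly_subst_subst: "poly_subst s (poly_subst t f) = poly_subst (\<lambda>i. poly_subst s (t i)) f"
  unfolding poly_subst_def[of t f]
  by (simp add: poly_subst_sum poly_subst_mult poly_subst_prod poly_subst_power)
     (simp add: poly_subst_def)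

lemma poly_subst_id: "poly_subst poly_coord f = f"
proof -
  have 1: "poly_coord i ^ k = Poly_Mapping.single (Poly_Mapping.single i k) 1" for i :: 'a and k
    by (induction k) (simp_all add: poly_coord_def mult_single single_add[symmetric])
  have 2: "(\<Prod>i\<in>I. Poly_Mapping.single (h i) (1::'b)) = Poly_Mapping.single (\<Sum>i\<in>I. h i) 1"
    if "finite I" for I :: "'a set" and h :: "'a \<Rightarrow> 'a \<Rightarrow>\<^sub>0 nat"
    using that by (induction I) (simp_all add: mult_single)
  have 3: "(\<Sum>i\<in>UNIV. Poly_Mapping.single i (Poly_Mapping.lookup m i)) = m" for m :: "'a \<Rightarrow>\<^sub>0 nat"
    by (rule poly_mapping_eqI) (simp add: lookup_sum lookup_single when_def)
  show ?thesis
    unfolding poly_subst_def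
    by (subst (3) poly_mapping_sum_single) (simp add: 1 2 3 poly_const_def mult_single)
qed

lemma poly_precomp_mult: "poly_precomp A (f * g) = poly_precomp A f * poly_precomp A g"
  by (simp add: poly_precomp_def poly_subst_mult)

lemma poly_precomp_0 [simp]: "poly_precomp A 0 = 0"
  by (simp add: poly_precomp_def)

lemma poly_precomp_precomp: "poly_precomp B (poly_precomp A f) = poly_precomp (A ** B) f"
proof -
  have "(\<Sum>j\<in>UNIV. poly_const (A $ i $ j) * (\<Sum>l\<in>UNIV. poly_const (B $ j $ l) * poly_coord l)) =
      (\<Sum>l\<in>UNIV. poly_const ((A ** B) $ i $ l) * poly_coord l)" for i
    unfolding sum_distrib_left
    by (subst sum.swap)
       (simp add: matrix_matrix_mult_def poly_const_sum poly_const_mult sum_distrib_left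
        mult_ac)
  then show ?thesis
    by (simp add: poly_precomp_def poly_subst_subst poly_subst_sum poly_subst_mult)
qed

lemma poly_precomp_mat_1: "poly_precomp (mat 1) f = f"
proof -
  have "(\<Sum>j\<in>UNIV. poly_const ((mat 1 :: 'b^'a^'a) $ i $ j) * poly_coord j) = poly_coord i" for i
  proof -
    have "(\<Sum>j\<in>UNIV. poly_const ((mat 1 :: 'b^'a^'a) $ i $ j) * poly_coord j) =
        (\<Sum>j\<in>UNIV. if i = j then poly_coord j else 0)"
      by (intro sum.cong) (auto simp: mat_def)
    then show ?thesis by simp
  qed
  then show ?thesis by (simp add: poly_precomp_def poly_subst_id)
qed

lemma poly_precomp_nonzero:
  assumes "invertible A" "h \<noteq> 0"
  shows "poly_precomp A h \<noteq> 0"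
proof
  assume *: "poly_precomp A h = 0"
  obtain B where "A ** B = mat 1"
    using assms(1) by (auto simp: invertible_def)
  then have "h = poly_precomp B (poly_precomp A h)"
    by (simp add: poly_precomp_precomp poly_precomp_mat_1)
  with * assms(2) show False by simp
qed

lemma rat_precomp_Fract:
  assumes "invertible A" "h \<noteq> 0"
  shows "rat_precomp A (Fract f h) = Fract (poly_precomp A f) (poly_precomp A h)"
  unfolding rat_precomp_def
proof (rule the_equality)
  fix r
  assume "\<exists>f' h'. h' \<noteq> 0 \<and> Fract f h = Fract f' h' \<and>
    r = Fract (poly_precomp A f') (poly_precomp A h')"
  then obtain f' h' where h': "h' \<noteq> 0" "Fract f h = Fract f' h'"
    and r: "r = Fract (poly_precomp A f') (poly_precomp A h')" by auto
  then have "f * h' = f' * h"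
    using assms(2) by (simp add: eq_fract)
  then have "poly_precomp A f * poly_precomp A h' = poly_precomp A f' * poly_precomp A h"
    by (simp flip: poly_precomp_mult)
  then show "r = Fract (poly_precomp A f) (poly_precomp A h)"
    using r assms h' by (simp add: eq_fract poly_precomp_nonzero)
qed (use assms in auto)

definition total_degree_le :: "nat \<Rightarrow> ('n::finite, 'k::zero) polys \<Rightarrow> bool" where
  "total_degree_le d f \<longleftrightarrow>
     (\<forall>m\<in>Poly_Mapping.keys f. (\<Sum>i\<in>UNIV. Poly_Mapping.lookup m i) \<le> d)"


section \<open>Representations\<close>

definition GL :: "('k::field^'n^'n) monoid" where
  "GL = \<lparr>carrier = {A. invertible A}, monoid.mult = (**), monoid.one = mat 1\<rparr>"

definition is_rep :: "('g, 'x) monoid_scheme \<Rightarrow> ('g \<Rightarrow> 'k::field^'n^'n) \<Rightarrow> bool" where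
  "is_rep G \<rho> \<longleftrightarrow> \<rho> \<in> hom G GL"

definition faithful :: "('g, 'x) monoid_scheme \<Rightarrow> ('g \<Rightarrow> 'k::field^'n^'n) \<Rightarrow> bool" where
  "faithful G \<rho> \<longleftrightarrow> inj_on \<rho> (carrier G)"

definition dual_rep ::
    "('g, 'x) monoid_scheme \<Rightarrow> ('g \<Rightarrow> 'k::field^'n^'n) \<Rightarrow> 'g \<Rightarrow> 'k^'n^'n" where
  "dual_rep G \<rho> g = transpose (\<rho> (inv\<^bsub>G\<^esub> g))"

definition inv_polys ::
    "('g, 'x) monoid_scheme \<Rightarrow> ('g \<Rightarrow> 'k::field^'n::{finite,linorder}^'n::{finite,linorder}) \<Rightarrow> ('n, 'k) polys set" where
  "inv_polys G \<rho> = {f. \<forall>g\<in>carrier G. poly_precomp (\<rho> (inv\<^bsub>G\<^esub> g)) f = f}"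

definition inv_rats ::
    "('g, 'x) monoid_scheme \<Rightarrow> ('g \<Rightarrow> 'k::field^'n::{finite,linorder}^'n::{finite,linorder}) \<Rightarrow> ('n, 'k) rats set" where
  "inv_rats G \<rho> = {q. \<forall>g\<in>carrier G. rat_precomp (\<rho> (inv\<^bsub>G\<^esub> g)) q = q}"

definition inv_polys_le ::
    "('g, 'x) monoid_scheme \<Rightarrow> ('g \<Rightarrow> 'k::field^'n::{finite,linorder}^'n::{finite,linorder}) \<Rightarrow> nat \<Rightarrow>
      ('n, 'k) polys set" where
  "inv_polys_le G \<rho> d = {f \<in> inv_polys G \<rho>. total_degree_le d f}"


section \<open>Field generation degrees\<close>

text \<open>The subfield of \<open>k(V)\<close> generated over \<open>k\<close> by a set of polynomials.\<close>

definition field_adjoin ::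
    "('n::{finite,linorder}, 'k::field) polys set \<Rightarrow> ('n, 'k) rats set" where
  "field_adjoin S =
     generate_field ring_of_type_algebra
       (range (\<lambda>c. Fract (poly_const c) 1) \<union> (\<lambda>f. Fract f 1) ` S)"

definition beta_field ::
    "('g, 'x) monoid_scheme \<Rightarrow> ('g \<Rightarrow> 'k::field^'n::{finite,linorder}^'n::{finite,linorder}) \<Rightarrow> nat" where
  "beta_field G \<rho> = (LEAST d. field_adjoin (inv_polys_le G \<rho> d) = inv_rats G \<rho>)"

definition gamma_field ::
    "('g, 'x) monoid_scheme \<Rightarrow> ('g \<Rightarrow> 'k::field^'n::{finite,linorder}^'n::{finite,linorder}) \<Rightarrow> nat" where
  "gamma_field G \<rho> =
     (LEAST d. ring.finite_dimension ring_of_type_algebra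
                 (field_adjoin (inv_polys_le G \<rho> d)) (inv_rats G \<rho>))"


section \<open>Characters\<close>

definition field_embedding :: "('k::field \<Rightarrow> 'K::field) \<Rightarrow> bool" where
  "field_embedding \<iota> \<longleftrightarrow> \<iota> \<in> ring_hom ring_of_type_algebra ring_of_type_algebra"

definition is_primitive_root :: "nat \<Rightarrow> 'K::field \<Rightarrow> bool" where
  "is_primitive_root n \<zeta> \<longleftrightarrow> n > 0 \<and> \<zeta> ^ n = 1 \<and> (\<forall>m. 0 < m \<and> m < n \<longrightarrow> \<zeta> ^ m \<noteq> 1)"

text \<open>Homomorphisms \<open>G \<rightarrow> K\<^sup>\<times>\<close>, extensional on \<open>G\<close> so that equality of characters is equality of functions.\<close>

definition characters :: "('g, 'x) monoid_scheme \<Rightarrow> ('g \<Rightarrow> 'K::field) set" where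
  "characters G = hom G (units_of ring_of_type_algebra) \<inter> extensional (carrier G)"

definition base_change :: "('k::field \<Rightarrow> 'K::field) \<Rightarrow> ('g \<Rightarrow> 'k^'n^'n) \<Rightarrow> 'g \<Rightarrow> 'K^'n^'n" where
  "base_change \<iota> \<rho> g = map_matrix \<iota> (\<rho> g)"

definition char_occurs ::
    "('g, 'x) monoid_scheme \<Rightarrow> ('g \<Rightarrow> 'K::field^'n^'n) \<Rightarrow> ('g \<Rightarrow> 'K) \<Rightarrow> bool" where
  "char_occurs G \<rho> \<psi> \<longleftrightarrow>
     \<psi> \<in> characters G \<and> (\<exists>v. v \<noteq> 0 \<and> (\<forall>g\<in>carrier G. \<rho> g *v v = \<psi> g *s v))"

definition nontrivial_chars ::
    "('g, 'x) monoid_scheme \<Rightarrow> ('k::field \<Rightarrow> 'K::field) \<Rightarrow> ('g \<Rightarrow> 'k^'n^'n) \<Rightarrow> ('g \<Rightarrow> 'K) set" where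
  "nontrivial_chars G \<iota> \<rho> =
     {\<psi>. char_occurs G (base_change \<iota> \<rho>) \<psi> \<and> \<psi> \<noteq> (\<lambda>g\<in>carrier G. 1)}"

text \<open>\<open>Supp' V\<close>: the nontrivial characters of the dual representation \<open>V*\<close>.\<close>

definition Supp' ::
    "('g, 'x) monoid_scheme \<Rightarrow> ('k::field \<Rightarrow> 'K::field) \<Rightarrow> ('g \<Rightarrow> 'k^'n^'n) \<Rightarrow> ('g \<Rightarrow> 'K) set" where
  "Supp' G \<iota> \<rho> = nontrivial_chars G \<iota> (dual_rep G \<rho>)"

text \<open>The character of \<open>\<int>/p\<int>\<close> represented by the integer \<open>A\<close> with respect to \<open>\<zeta>\<close>.\<close>

definition int_char :: "nat \<Rightarrow> 'K::field \<Rightarrow> int \<Rightarrow> int \<Rightarrow> 'K" where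
  "int_char p \<zeta> A = (\<lambda>a\<in>carrier (integer_mod_group p). \<zeta> powi (A * a))"

text \<open>
  The \<open>Aut G\<close>-orbit of a set of characters.  Precomposition with \<open>\<alpha>\<close> is a right action; inverting
  \<open>\<alpha>\<close> makes it a left action with the same orbits.
\<close>

definition char_orbit ::
    "('g, 'x) monoid_scheme \<Rightarrow> ('g \<Rightarrow> 'K::field) set \<Rightarrow> ('g \<Rightarrow> 'K) set set" where
  "char_orbit G S = {(\<lambda>\<psi>. compose (carrier G) \<psi> \<alpha>) ` S | \<alpha>. \<alpha> \<in> auto G}"

end

theory Submission
  imports Defs
begin

text \<open>
  Over \<open>K\<close> the action becomes diagonal, so invariants are spanned by monomials whose exponents lie in
  a lattice \<open>L\<close>, and averaging together with a functional \<open>K \<rightarrow> k\<close> transports field generation between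
  \<open>K\<close> and \<open>k\<close>.  If the low-degree part of \<open>L\<close> has full rank it generates \<open>L\<close>: with two nontrivial
  characters everything reduces to the plane, where two vectors of minimal nonzero determinant form
  a basis.  If it does not have full rank, a one-parameter torus fixes all low invariants and moves
  some invariant through infinitely many values, so the extension is not finite.  Hence both degrees
  are the least \<open>d\<close> for which \<open>L\<close> contains two independent nonnegative vectors of degree at most
  \<open>d\<close>.  Their determinant is a multiple of \<open>p\<close>, all four entries are positive unless \<open>d = p\<close>, and their
  degrees differ; so \<open>p \<le> (d - 1) * (d - 2) - 1\<close>, and only the pair \<open>(d - 1, 1)\<close>, \<open>(1, d - 2)\<close>
  has a determinant above \<open>(d - 2)\<^sup>2\<close>.
\<close>

section \<open>Coefficientwise maps and substitutions\<close>

text \<open>The obstacle is that \<open>k\<close> need not contain the p-th roots of unity, so the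
  invariants over \<open>k\<close> have no basis of monomials. The function fields over
  \<open>k\<close> and \<open>K\<close> are never compared; what travels between the two are
  \<open>K\<close>-spans of polynomials over \<open>k\<close> and identities
  \<open>g * b = a\<close> with \<open>a\<close>, \<open>b\<close> in the algebra generated by the
  low invariants.

  The constants: for \<Gamma> >= 2 the bound is attained exactly when (\<Gamma> - 2)^2 < p <=
  (\<Gamma> - 1)^2. In that window the determinant of the extremal pair, (d - 1)(d - 2) - 1 = d^2 -
  3d + 1, is below 2p, so it equals p. The vector (d - 1, 1) then says B = -(d - 1) A mod p, and p -
  (d - 1) = d^2 - 4d + 2. The condition d >= 4 is where d^2 - 3d + 1 exceeds (d - 2)^2. The value d
  = p, where pure p-th powers are available, falls into the window for odd p only if p = 3.\<close>

lemma poly_mapping_additive_eqI: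
  fixes F G :: "('a \<Rightarrow>\<^sub>0 'b::comm_monoid_add) \<Rightarrow> 'c::comm_monoid_add"
  assumes "\<And>m c. F (Poly_Mapping.single m c) = G (Poly_Mapping.single m c)"
    and "F 0 = 0" "G 0 = 0" "\<And>f g. F (f + g) = F f + F g" "\<And>f g. G (f + g) = G f + G g"
  shows "F f = G f"
proof -
  have sum: "H (\<Sum>m\<in>I. h m) = (\<Sum>m\<in>I. H (h m))" if "H 0 = 0" "\<And>f g. H (f + g) = H f + H g"
    for H :: "('a \<Rightarrow>\<^sub>0 'b) \<Rightarrow> 'c" and h and I :: "'a set"
    using that by (induction I rule: infinite_finite_induct) auto
  show ?thesis
    by (subst (1 2) poly_mapping_sum_single) (simp add: sum assms)
qed

lemma map_single_0:
  "h 0 = 0 \<Longrightarrow> Poly_Mapping.map h (Poly_Mapping.single m c) = Poly_Mapping.single m (h c)"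
  by (rule poly_mapping_eqI) (simp add: Poly_Mapping.map.rep_eq lookup_single when_def)

lemma lookup_map_0: "h 0 = 0 \<Longrightarrow> Poly_Mapping.lookup (Poly_Mapping.map h f) m = h (Poly_Mapping.lookup f m)"
  by (simp add: Poly_Mapping.map.rep_eq when_def)

lemma keys_map_subset: "Poly_Mapping.keys (Poly_Mapping.map h f) \<subseteq> Poly_Mapping.keys f"
  by (auto simp: in_keys_iff Poly_Mapping.map.rep_eq when_def)

lemma map_poly_mapping_add:
  assumes "h 0 = 0" "\<And>a b. h (a + b) = h a + h b"
  shows "Poly_Mapping.map h (f + g) = Poly_Mapping.map h f + Poly_Mapping.map h g"
  using assms by (intro poly_mapping_eqI) (simp add: lookup_map_0 lookup_add)

lemma map_poly_mapping_zero [simp]: "Poly_Mapping.map h 0 = 0"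
  by (intro poly_mapping_eqI) (simp add: Poly_Mapping.map.rep_eq)

lemma map_poly_mapping_ident [simp]: "Poly_Mapping.map (\<lambda>x. x) f = f"
  by (intro poly_mapping_eqI) (simp add: lookup_map_0)

lemma map_poly_mapping_sum:
  assumes "h 0 = 0" "\<And>a b. h (a + b) = h a + h b"
  shows "Poly_Mapping.map h (\<Sum>i\<in>I. f i) = (\<Sum>i\<in>I. Poly_Mapping.map h (f i))"
  by (induction I rule: infinite_finite_induct) (auto simp: map_poly_mapping_add[OF assms])

text \<open>Three separate coefficient maps serve two uses: a ring embedding (\<open>u\<close> the
  identity, \<open>v = h\<close>) is multiplicative on polynomials, and a \<open>k\<close>-linear
  functional (\<open>u\<close> the embedding, \<open>v\<close> the identity) is linear over
  polynomials with coefficients in \<open>k\<close>.\<close>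

lemma map_poly_mapping_mult:
  fixes u :: "'a::semiring_0 \<Rightarrow> 'b::semiring_0" and h :: "'b \<Rightarrow> 'c::semiring_0"
    and f :: "'m::comm_monoid_add \<Rightarrow>\<^sub>0 'a"
  assumes h: "h 0 = 0" "\<And>a b. h (a + b) = h a + h b"
    and u: "u 0 = 0" "\<And>a b. u (a + b) = u a + u b"
    and v: "v 0 = 0" "\<And>a b. v (a + b) = v a + v b"
    and mult: "\<And>a b. h (u a * b) = v a * h b"
  shows "Poly_Mapping.map h (Poly_Mapping.map u f * g) = Poly_Mapping.map v f * Poly_Mapping.map h g"
proof -
  have 1: "Poly_Mapping.map h (Poly_Mapping.single m (u c) * g) =
      Poly_Mapping.single m (v c) * Poly_Mapping.map h g" for m c
    by (rule poly_mapping_additive_eqI[where f = g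
          and F = "\<lambda>g. Poly_Mapping.map h (Poly_Mapping.single m (u c) * g)"
          and G = "\<lambda>g. Poly_Mapping.single m (v c) * Poly_Mapping.map h g"])
       (simp_all add: map_single_0 mult_single map_poly_mapping_add assms distrib_left)
  show ?thesis
    by (rule poly_mapping_additive_eqI[where f = f
          and F = "\<lambda>f. Poly_Mapping.map h (Poly_Mapping.map u f * g)"
          and G = "\<lambda>f. Poly_Mapping.map v f * Poly_Mapping.map h g"])
       (simp_all add: 1 map_single_0 map_poly_mapping_add assms distrib_right)
qed

lemma poly_subst_map:
  fixes \<iota> :: "'a::comm_ring_1 \<Rightarrow> 'b::comm_ring_1"
  assumes "\<iota> 0 = 0" "\<iota> 1 = 1" "\<And>a b. \<iota> (a + b) = \<iota> a + \<iota> b" "\<And>a b. \<iota> (a * b) = \<iota> a * \<iota> b"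
  shows "Poly_Mapping.map \<iota> (poly_subst s f) =
    poly_subst (\<lambda>i. Poly_Mapping.map \<iota> (s i)) (Poly_Mapping.map \<iota> f)"
proof -
  have c: "Poly_Mapping.map \<iota> (poly_const c) = poly_const (\<iota> c)" for c
    by (simp add: poly_const_def map_single_0 assms)
  have m: "Poly_Mapping.map \<iota> (f * g) = Poly_Mapping.map \<iota> f * Poly_Mapping.map \<iota> g"
    for f g :: "('c \<Rightarrow>\<^sub>0 nat) \<Rightarrow>\<^sub>0 'a"
    using map_poly_mapping_mult[where h = \<iota> and u = "\<lambda>x. x" and v = \<iota> and f = f and g = g] assms
    by simp
  have 1: "Poly_Mapping.map \<iota> (1 :: ('c \<Rightarrow>\<^sub>0 nat) \<Rightarrow>\<^sub>0 'a) = 1"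
    using c[of 1] assms by simp
  have pw: "Poly_Mapping.map \<iota> (f ^ n) = Poly_Mapping.map \<iota> f ^ n" for f :: "('c \<Rightarrow>\<^sub>0 nat) \<Rightarrow>\<^sub>0 'a" and n
    by (induction n) (simp_all add: 1 m)
  have pr: "Poly_Mapping.map \<iota> (\<Prod>i\<in>I. g i) = (\<Prod>i\<in>I. Poly_Mapping.map \<iota> (g i))"
    for g :: "'c \<Rightarrow> ('c \<Rightarrow>\<^sub>0 nat) \<Rightarrow>\<^sub>0 'a" and I
    by (induction I rule: infinite_finite_induct) (simp_all add: 1 m)
  \<comment> \<open>\<open>\<iota>\<close> may kill coefficients, so the substitution on the right
    is summed over all keys of \<open>f\<close>, including those whose coefficient became
    zero.\<close>
  show ?thesis
    by (subst poly_subst_superset[OF _ keys_map_subset])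
       (simp_all add: poly_subst_def map_poly_mapping_sum assms m c pw pr lookup_map_0)
qed

text \<open>Rescaling coordinates turns each monomial into a multiple of itself. This covers both
  diagonal actions of the proof: the group in eigencoordinates and the torus \<open>\<sigma>\<close>
  of \<open>infinite_dimension_inv_rats\<close>.\<close>

lemma lookup_poly_subst_scale:
  fixes c :: "'a::finite \<Rightarrow> 'b::comm_ring_1"
  shows "Poly_Mapping.lookup (poly_subst (\<lambda>i. poly_const (c i) * poly_coord i) f) m =
     Poly_Mapping.lookup f m * (\<Prod>i\<in>UNIV. c i ^ Poly_Mapping.lookup m i)"
proof -
  have pp: "poly_const x ^ n = poly_const (x ^ n)" for x :: 'b and n
    by (induction n) (simp_all add: poly_const_mult)
  have pq: "(\<Prod>i\<in>I. poly_const (g i)) = poly_const (\<Prod>i\<in>I. g i)" for g :: "'a \<Rightarrow> 'b" and I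
    by (induction I rule: infinite_finite_induct) (simp_all add: poly_const_mult)
  have "poly_subst (\<lambda>i. poly_const (c i) * poly_coord i) (Poly_Mapping.single m' a) =
      Poly_Mapping.single m' (a * (\<Prod>i\<in>UNIV. c i ^ Poly_Mapping.lookup m' i))" for m' a
  proof -
    have "poly_subst (\<lambda>i. poly_const (c i) * poly_coord i) (Poly_Mapping.single m' a) =
        poly_const (\<Prod>i\<in>UNIV. c i ^ Poly_Mapping.lookup m' i) *
        poly_subst poly_coord (Poly_Mapping.single m' a)"
      by (simp add: poly_subst_single power_mult_distrib prod.distrib pp pq mult_ac)
    also have "\<dots> = Poly_Mapping.single m' (a * (\<Prod>i\<in>UNIV. c i ^ Poly_Mapping.lookup m' i))"
      by (simp add: poly_subst_id poly_const_def mult_single mult.commute)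
    finally show ?thesis .
  qed
  then show ?thesis
    by (intro poly_mapping_additive_eqI[where f = f
          and F = "\<lambda>f. Poly_Mapping.lookup (poly_subst (\<lambda>i. poly_const (c i) * poly_coord i) f) m"
          and G = "\<lambda>f. Poly_Mapping.lookup f m * (\<Prod>i\<in>UNIV. c i ^ Poly_Mapping.lookup m i)"])
       (simp_all add: lookup_single when_def poly_subst_add lookup_add distrib_right)
qed

lemma poly_precomp_add: "poly_precomp A (f + g) = poly_precomp A f + poly_precomp A g"
  by (simp add: poly_precomp_def poly_subst_add)

lemma poly_precomp_sum: "poly_precomp A (\<Sum>i\<in>I. f i) = (\<Sum>i\<in>I. poly_precomp A (f i))"
  by (simp add: poly_precomp_def poly_subst_sum)

lemma poly_precomp_const [simp]: "poly_precomp A (poly_const c) = poly_const c"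
  by (simp add: poly_precomp_def)

lemma poly_precomp_prod: "poly_precomp A (\<Prod>i\<in>I. f i) = (\<Prod>i\<in>I. poly_precomp A (f i))"
  by (simp add: poly_precomp_def poly_subst_prod)

lemma poly_precomp_map:
  fixes \<iota> :: "'a::comm_ring_1 \<Rightarrow> 'b::comm_ring_1"
    and A :: "'a^'n^'n" and f :: "('n::finite, 'a) polys"
  assumes "\<iota> 0 = 0" "\<iota> 1 = 1" "\<And>a b. \<iota> (a + b) = \<iota> a + \<iota> b" "\<And>a b. \<iota> (a * b) = \<iota> a * \<iota> b"
  shows "Poly_Mapping.map \<iota> (poly_precomp A f) = poly_precomp (map_matrix \<iota> A) (Poly_Mapping.map \<iota> f)"
proof -
  have "Poly_Mapping.map \<iota> (poly_const a * poly_coord j) = poly_const (\<iota> a) * poly_coord j" for a and j :: 'n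
    by (simp add: poly_const_def poly_coord_def mult_single map_single_0 assms)
  then show ?thesis
    by (simp add: poly_precomp_def poly_subst_map assms map_poly_mapping_sum map_matrix_def)
qed

section \<open>Total degree under ring operations and linear substitutions\<close>

lemma total_degree_le_const [simp]: "total_degree_le d (poly_const c)"
  by (simp add: total_degree_le_def poly_const_def)

lemma total_degree_le_0 [simp]: "total_degree_le d 0"
  by (simp add: total_degree_le_def)

lemma total_degree_le_1 [simp]: "total_degree_le d (1 :: ('n::finite, 'k::comm_ring_1) polys)"
  using total_degree_le_const[of d "1::'k"] by (simp del: total_degree_le_const)

lemma total_degree_le_add: "total_degree_le d f \<Longrightarrow> total_degree_le d g \<Longrightarrow> total_degree_le d (f + g)"
  using keys_add[of f g] by (auto simp: total_degree_le_def)

lemma total_degree_le_sum: "(\<And>i. i \<in> I \<Longrightarrow> total_degree_le d (f i)) \<Longrightarrow> total_degree_le d (\<Sum>i\<in>I. f i)"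
  by (induction I rule: infinite_finite_induct) (auto intro: total_degree_le_add)

lemma total_degree_le_mult:
  assumes "total_degree_le a f" "total_degree_le b g"
  shows "total_degree_le (a + b) (f * g)"
  using keys_mult[of f g] assms
  by (fastforce simp: total_degree_le_def lookup_add sum.distrib intro: add_mono)

lemma total_degree_le_power:
  fixes f :: "('n::finite, 'k::comm_ring_1) polys"
  shows "total_degree_le a f \<Longrightarrow> total_degree_le (n * a) (f ^ n)"
  by (induction n) (auto intro: total_degree_le_mult)

lemma total_degree_le_prod:
  fixes f :: "'i \<Rightarrow> ('n::finite, 'k::comm_ring_1) polys"
  shows "(\<And>i. i \<in> I \<Longrightarrow> total_degree_le (e i) (f i)) \<Longrightarrow> total_degree_le (\<Sum>i\<in>I. e i) (\<Prod>i\<in>I. f i)"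
  by (induction I rule: infinite_finite_induct)
     (auto intro: total_degree_le_mult)

text \<open>Each coordinate is replaced by a linear form, so a change to eigencoordinates respects
  the degree bound.\<close>

lemma total_degree_le_poly_precomp:
  assumes "total_degree_le d f"
  shows "total_degree_le d (poly_precomp A f)"
  unfolding poly_precomp_def poly_subst_def
proof (rule total_degree_le_sum)
  fix m assume m: "m \<in> Poly_Mapping.keys f"
  define s where "s = (\<lambda>i. \<Sum>j\<in>UNIV. poly_const (A $ i $ j) * poly_coord j)"
  have c: "total_degree_le 1 (poly_coord j :: ('a, 'b) polys)" for j
    by (auto simp: total_degree_le_def poly_coord_def lookup_single when_def)
  have "total_degree_le 1 (s i)" for i
    unfolding s_def using total_degree_le_mult[OF total_degree_le_const[of 0] c]
    by (intro total_degree_le_sum) auto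
  then have "total_degree_le (\<Sum>i\<in>UNIV. Poly_Mapping.lookup m i * 1) (\<Prod>i\<in>UNIV. s i ^ Poly_Mapping.lookup m i)"
    by (intro total_degree_le_prod total_degree_le_power)
  then have "total_degree_le d (\<Prod>i\<in>UNIV. s i ^ Poly_Mapping.lookup m i)"
    using m assms by (auto simp: total_degree_le_def intro: order_trans)
  then show "total_degree_le d (poly_const (Poly_Mapping.lookup f m) * (\<Prod>i\<in>UNIV. s i ^ Poly_Mapping.lookup m i))"
    using total_degree_le_mult[OF total_degree_le_const[of 0]] by fastforce
qed

section \<open>Lattices of exponents\<close>

text \<open>\<open>(a, b)\<close> and \<open>(c, e)\<close> are exponents of invariant monomials in two variables on which the group
  acts by the characters \<open>A\<close> and \<open>B\<close>.\<close>

definition spans_rank2 :: "nat \<Rightarrow> nat \<Rightarrow> nat \<Rightarrow> nat \<Rightarrow> bool" where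
  "spans_rank2 p A B d \<longleftrightarrow> (\<exists>a b c e. p dvd a * A + b * B \<and> p dvd c * A + e * B \<and>
     a + b \<le> d \<and> c + e \<le> d \<and> a * e \<noteq> b * c)"

text \<open>A pair of vectors of minimal nonzero determinant is a basis: otherwise the half-open
  parallelogram they span contains a nonzero lattice point \<open>w\<close>, and one of \<open>w\<close> and \<open>u + v - w\<close>
  has degree at most \<open>d\<close> and yields a smaller determinant.\<close>

lemma rank2_basis:
  fixes p A B d :: nat
  assumes "spans_rank2 p A B d"
  obtains a b c e :: nat where
    "p dvd a * A + b * B" "p dvd c * A + e * B" "a + b \<le> d" "c + e \<le> d" "a * e \<noteq> b * c"
    "\<And>(x::int) (y::int). int p dvd x * A + y * B \<Longrightarrow>
       \<exists>s t :: int. x = s * int a + t * int c \<and> y = s * int b + t * int e"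
proof -
  \<comment> \<open>Integers instead of naturals, and a positively oriented pair, so that minimal
    determinants are compared without absolute values.\<close>
  define good where "good = (\<lambda>(a::int, b::int, c::int, e::int). a \<ge> 0 \<and> b \<ge> 0 \<and> c \<ge> 0 \<and> e \<ge> 0 \<and>
      int p dvd a * A + b * B \<and> int p dvd c * A + e * B \<and>
      a + b \<le> int d \<and> c + e \<le> int d \<and> a * e - b * c > 0)"
  define det where "det = (\<lambda>(a::int, b::int, c::int, e::int). nat (a * e - b * c))"
  have "\<exists>x. good x"
  proof -
    obtain a b c e where *: "p dvd a * A + b * B" "p dvd c * A + e * B"
      "a + b \<le> d" "c + e \<le> d" "a * e \<noteq> b * c"
      using assms by (auto simp: spans_rank2_def)
    have d: "int p dvd int a * A + int b * B" "int p dvd int c * A + int e * B"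
      using *(1,2) by (metis of_nat_add of_nat_dvd_iff of_nat_mult)+
    consider "a * e > b * c" | "c * b > e * a"
      using *(5) by (metis linorder_neqE_nat mult.commute)
    then show ?thesis
    proof cases
      case 1
      then have "int b * int c < int a * int e" by (metis of_nat_less_iff of_nat_mult)
      then have "good (a, b, c, e)" using * d by (simp add: good_def)
      then show ?thesis by blast
    next
      case 2
      then have "int e * int a < int c * int b" by (metis of_nat_less_iff of_nat_mult)
      then have "good (c, e, a, b)" using * d by (simp add: good_def)
      then show ?thesis by blast
    qed
  qed
  then obtain z where z: "good z" and min: "\<And>y. good y \<Longrightarrow> det z \<le> det y"
    using ex_has_least_nat[of good _ det] by metis
  obtain a b c e where ze: "z = (a, b, c, e)" by (cases z) auto
  define \<Delta> where "\<Delta> = a * e - b * c"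
  have g: "a \<ge> 0" "b \<ge> 0" "c \<ge> 0" "e \<ge> 0" "int p dvd a * A + b * B" "int p dvd c * A + e * B"
    "a + b \<le> int d" "c + e \<le> int d" "\<Delta> > 0"
    using z by (auto simp: good_def ze \<Delta>_def)
  have minD: "\<Delta> \<le> a' * e' - b' * c'" if "good (a', b', c', e')" for a' b' c' e'
    using min[OF that] g(9) by (simp add: det_def ze \<Delta>_def nat_le_eq_zle)
  \<comment> \<open>Replacing one vector of the minimal pair by (x, y) gives these determinants;
    minimality leaves no value strictly between 0 and \<open>\<Delta>\<close>.\<close>
  have small: "x \<ge> 0 \<Longrightarrow> y \<ge> 0 \<Longrightarrow> int p dvd x * A + y * B \<Longrightarrow> x + y \<le> int d \<Longrightarrow>
      (x * e - y * c \<le> 0 \<or> x * e - y * c \<ge> \<Delta>) \<and> (a * y - b * x \<le> 0 \<or> a * y - b * x \<ge> \<Delta>)" for x y :: int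
  proof (intro conjI)
    assume h: "x \<ge> 0" "y \<ge> 0" "int p dvd x * A + y * B" "x + y \<le> int d"
    show "x * e - y * c \<le> 0 \<or> x * e - y * c \<ge> \<Delta>"
    proof (cases "x * e - y * c \<le> 0")
      case False
      then have "good (x, y, c, e)" using h g by (simp add: good_def)
      then show ?thesis using minD by blast
    qed simp
    show "a * y - b * x \<le> 0 \<or> a * y - b * x \<ge> \<Delta>"
    proof (cases "a * y - b * x \<le> 0")
      case False
      then have "good (a, b, x, y)" using h g by (simp add: good_def)
      then show ?thesis using minD by blast
    qed simp
  qed
  have basis: "\<exists>s t. x = s * a + t * c \<and> y = s * b + t * e" if xy: "int p dvd x * A + y * B" for x y :: int
  proof -
    \<comment> \<open>Cramer's rule: the coordinates of (x, y) with respect to the pair are these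
      quotients by \<open>\<Delta>\<close>. Their integer parts are subtracted, so (x', y') has
      coordinates s0 / \<Delta> and t0 / \<Delta> in [0, 1).\<close>
    define q r where "q = (x * e - y * c) div \<Delta>" and "r = (a * y - b * x) div \<Delta>"
    define s0 t0 where "s0 = (x * e - y * c) mod \<Delta>" and "t0 = (a * y - b * x) mod \<Delta>"
    define x' y' where "x' = x - q * a - r * c" and "y' = y - q * b - r * e"
    have st: "x * e - y * c = q * \<Delta> + s0" "a * y - b * x = r * \<Delta> + t0"
      by (simp_all add: q_def r_def s0_def t0_def)
    have s0: "x' * e - y' * c = s0"
      using st(1) by (simp add: x'_def y'_def \<Delta>_def algebra_simps)
    have t0: "a * y' - b * x' = t0"
      using st(2) by (simp add: x'_def y'_def \<Delta>_def algebra_simps)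
    have st0: "0 \<le> s0" "s0 < \<Delta>" "0 \<le> t0" "t0 < \<Delta>"
      using g by (simp_all add: s0_def t0_def)
    have X: "\<Delta> * x' = s0 * a + t0 * c" and Y: "\<Delta> * y' = s0 * b + t0 * e"
      by (simp_all add: s0[symmetric] t0[symmetric] \<Delta>_def algebra_simps)
    have "int p dvd (x * A + y * B) - q * (a * A + b * B) - r * (c * A + e * B)"
      using xy g by (intro dvd_diff dvd_mult)
    also have "(x * A + y * B) - q * (a * A + b * B) - r * (c * A + e * B) = x' * A + y' * B"
      by (simp add: x'_def y'_def algebra_simps)
    finally have p': "int p dvd x' * A + y' * B" .
    have pos: "x' \<ge> 0" "y' \<ge> 0"
      using X Y st0 g by (metis add_nonneg_nonneg mult_nonneg_nonneg zero_le_mult_iff leD)+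
    have "int p dvd (a * A + b * B) + (c * A + e * B) - (x' * A + y' * B)"
      by (rule dvd_diff[OF dvd_add[OF g(5,6)] p'])
    also have "\<dots> = (a + c - x') * A + (b + e - y') * B"
      by (simp add: algebra_simps)
    finally have p'': "int p dvd (a + c - x') * A + (b + e - y') * B" .
    have "\<Delta> * (a + c - x') = (\<Delta> - s0) * a + (\<Delta> - t0) * c"
         "\<Delta> * (b + e - y') = (\<Delta> - s0) * b + (\<Delta> - t0) * e"
      using X Y by (simp_all add: algebra_simps)
    moreover have "(\<Delta> - s0) * a + (\<Delta> - t0) * c \<ge> 0" "(\<Delta> - s0) * b + (\<Delta> - t0) * e \<ge> 0"
      using st0 g by (auto intro!: add_nonneg_nonneg mult_nonneg_nonneg)
    ultimately have pos': "a + c - x' \<ge> 0" "b + e - y' \<ge> 0"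
      using g by (metis zero_le_mult_iff leD)+
    have dets: "(a + c - x') * e - (b + e - y') * c = \<Delta> - s0"
        "a * (b + e - y') - b * (a + c - x') = \<Delta> - t0"
      using s0 t0 by (simp_all add: \<Delta>_def algebra_simps)
    \<comment> \<open>The degrees of (x', y') and of its reflection add up to at most 2d. For the
      first, the determinants \<open>s0\<close> and \<open>t0\<close> are below
      \<open>\<Delta>\<close>, hence 0; for the reflection they are \<open>\<Delta> - s0\<close> and
      \<open>\<Delta> - t0\<close>, positive, hence at least \<open>\<Delta>\<close>.\<close>
    have "x' + y' \<le> int d \<or> (a + c - x') + (b + e - y') \<le> int d"
      using g by linarith
    then have "s0 = 0 \<and> t0 = 0"
      using small[OF pos p'] small[OF pos' p''] s0 t0 dets st0 by auto
    then have "x' = 0" "y' = 0" using X Y g by auto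
    then show ?thesis by (intro exI[of _ q] exI[of _ r]) (simp add: x'_def y'_def)
  qed
  show thesis
  proof (rule that[of "nat a" "nat b" "nat c" "nat e"])
    have n: "int (nat a) = a" "int (nat b) = b" "int (nat c) = c" "int (nat e) = e"
      using g by auto
    show "p dvd nat a * A + nat b * B" "p dvd nat c * A + nat e * B"
      using g n by (metis of_nat_add of_nat_dvd_iff of_nat_mult)+
    show "nat a + nat b \<le> d" "nat c + nat e \<le> d" using g by auto
    show "nat a * nat e \<noteq> nat b * nat c"
      using g(9) n unfolding \<Delta>_def by (metis of_nat_mult right_minus_eq less_irrefl)
    show "\<exists>s t. x = s * int (nat a) + t * int (nat c) \<and> y = s * int (nat b) + t * int (nat e)"
      if "int p dvd x * A + y * B" for x y :: int
      using basis[OF that] n by simp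
  qed
qed

text \<open>The distinctness of the two degrees is what improves the bound from \<open>(d - 1)\<^sup>2 - 1\<close> to
  \<open>(d - 1) * (d - 2) - 1\<close>.\<close>

lemma rank2_extremal:
  fixes p A B d :: nat
  assumes p: "Factorial_Ring.prime p"
    and AB: "\<not> p dvd A" "\<not> p dvd B" "\<not> int p dvd int A - int B"
    and d: "spans_rank2 p A B d" "d < p"
  shows "int p \<le> int d ^ 2 - 3 * int d + 1"
    and "(int d - 2) ^ 2 < int p \<Longrightarrow> int p = int d ^ 2 - 3 * int d + 1 \<and>
      (p dvd (d - 1) * A + B \<or> p dvd (d - 1) * B + A)"
proof -
  obtain a b c e where *: "p dvd a * A + b * B" "p dvd c * A + e * B"
      "a + b \<le> d" "c + e \<le> d" "a * e \<noteq> b * c"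
    using d(1) by (auto simp: spans_rank2_def)
  \<comment> \<open>A nonzero vector on a coordinate axis has its entry divisible by p, so its
    degree is at least p > d.\<close>
  have pos: "x > 0 \<and> y > 0" if "p dvd x * A + y * B" "x + y \<le> d" "x + y > 0" for x y
  proof (rule ccontr)
    assume "\<not> ?thesis"
    then consider "x = 0" | "y = 0" by auto
    then show False
    proof cases
      case 1
      then have "p dvd y" using that AB p by (auto simp: prime_dvd_mult_iff)
      then show False using that d 1 by (auto dest: dvd_imp_le)
    next
      case 2
      then have "p dvd x" using that AB p by (auto simp: prime_dvd_mult_iff)
      then show False using that d 2 by (auto dest: dvd_imp_le)
    qed
  qed
  have pos4: "a > 0" "b > 0" "c > 0" "e > 0"
    using pos[OF *(1,3)] pos[OF *(2,4)] *(5) by (auto intro: ccontr)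
  have i: "int p dvd int a * A + int b * B" "int p dvd int c * A + int e * B"
    using *(1,2) by (metis of_nat_add of_nat_dvd_iff of_nat_mult)+
  \<comment> \<open>For equal degrees the difference of the vectors is (a - c)(1, -1). Since p does
    not divide A - B, it divides a - c, which is smaller than p in absolute value; then the vectors
    coincide.\<close>
  have ne: "a + b \<noteq> c + e"
  proof
    assume eq: "a + b = c + e"
    have "int p dvd (int a * A + int b * B) - (int c * A + int e * B)"
      using i by (rule dvd_diff)
    also have "\<dots> = (int a - int c) * (int A - int B)"
    proof -
      have b: "int b = int c + int e - int a" using eq by linarith
      show ?thesis unfolding b by (simp add: algebra_simps)
    qed
    finally have "int p dvd int a - int c"
      using AB(3) p by (simp add: prime_dvd_mult_iff)
    moreover have "\<bar>int a - int c\<bar> < int p" using *(3,4) d by linarith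
    ultimately have "a = c" using zdvd_imp_le[of "int p" "\<bar>int a - int c\<bar>"] by (cases "a = c") auto
    with eq *(5) show False by auto
  qed
  \<comment> \<open>Eliminating \<open>A\<close> between the two congruences leaves the determinant
    times \<open>B\<close>.\<close>
  have "int p dvd int c * (int a * A + int b * B) - int a * (int c * A + int e * B)"
    using i by (intro dvd_diff dvd_mult)
  also have "\<dots> = (int b * int c - int a * int e) * int B" by (simp add: algebra_simps)
  finally have "int p dvd int b * int c - int a * int e"
    using AB(2) p by (simp add: prime_dvd_mult_iff)
  then have det: "int p dvd \<bar>int a * int e - int b * int c\<bar>"
    by (simp add: dvd_diff_commute)
  have "int a * int e \<noteq> int b * int c" using *(5) by (metis of_nat_eq_iff of_nat_mult)
  then have ple: "int p \<le> \<bar>int a * int e - int b * int c\<bar>"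
    using det zdvd_imp_le[of "int p" "\<bar>int a * int e - int b * int c\<bar>"] by auto
  \<comment> \<open>The disjunction at the end makes \<open>main\<close> symmetric in
    \<open>A\<close> and \<open>B\<close>, as the exchange of coordinates below requires.\<close>
  define main where "main = (\<lambda>(A::nat) B. int p \<le> int d ^ 2 - 3 * int d + 1 \<and>
     ((int d - 2) ^ 2 < int p \<longrightarrow> int p = int d ^ 2 - 3 * int d + 1 \<and>
      (p dvd (d - 1) * A + B \<or> p dvd (d - 1) * B + A)))"
  have key: "main A B"
    if h: "p dvd a * A + b * B" "p dvd c * A + e * B" "a + b \<le> d" "c + e \<le> d"
      "a > 0" "b > 0" "c > 0" "e > 0" "a + b \<noteq> c + e"
      "int p dvd int a * int e - int b * int c" "int p \<le> int a * int e - int b * int c"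
    for a b c e A B :: nat
  proof -
    have main': "main A B" 
      if h: "p dvd a * A + b * B" "a + b \<le> d" "c + e \<le> d - 1"
      "a > 0" "b > 0" "c > 0" "e > 0" 
      "int p dvd int a * int e - int b * int c" "int p \<le> int a * int e - int b * int c"
      for a b c e A B :: nat
    proof -
      have d1: "d \<ge> 1" using h by auto
      have bc: "1 \<le> int b * int c" using h by (metis mult_pos_pos of_nat_0_less_iff int_one_le_iff_zero_less)
      \<comment> \<open>Here b >= 1 and c >= 1 use up one unit of each degree, and the second vector
        has degree at most d - 1.\<close>
      have ae: "int a \<le> int d - 1" "int e \<le> int d - 2" using h by linarith+
      have "int a * int e \<le> (int d - 1) * (int d - 2)"
        using ae by (intro mult_mono) auto
      then have le: "int a * int e - int b * int c \<le> int d ^ 2 - 3 * int d + 1"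
        using bc by (simp add: power2_eq_square algebra_simps)
      have 2: "int p = int d ^ 2 - 3 * int d + 1 \<and> p dvd (d - 1) * A + B" if big: "(int d - 2) ^ 2 < int p"
      proof -
        \<comment> \<open>Lowering a to d - 2 or e to d - 3 brings the product to at most (d - 2)^2,
          and subtracting bc >= 1 puts it below p.\<close>
        have "int a = int d - 1"
        proof (rule ccontr)
          assume "int a \<noteq> int d - 1"
          then have "int a * int e \<le> (int d - 2) * (int d - 2)"
            using ae by (intro mult_mono) auto
          then show False using bc big h by (simp add: power2_eq_square)
        qed
        have "int e = int d - 2"
        proof (rule ccontr)
          assume "int e \<noteq> int d - 2"
          then have "int a * int e \<le> (int d - 1) * (int d - 3)"
            using ae h by (intro mult_mono) auto
          then show False using bc big h by (simp add: power2_eq_square algebra_simps)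
        qed
        have b1: "b = 1" "c = 1" using \<open>int a = int d - 1\<close> \<open>int e = int d - 2\<close> h by linarith+
        have D: "int a * int e - int b * int c = int d ^ 2 - 3 * int d + 1"
          unfolding \<open>int a = int d - 1\<close> \<open>int e = int d - 2\<close> b1 by (simp add: power2_eq_square algebra_simps)
        then obtain k where k: "int d ^ 2 - 3 * int d + 1 = int p * k" using h(8) by (auto simp: dvd_def)
        \<comment> \<open>The difference 2(d - 2)^2 - (d^2 - 3d + 1) = d^2 - 5d + 7 is positive,
          since four times it is (2d - 5)^2 + 3. So the determinant is a positive multiple of p
          below 2p.\<close>
        have "0 \<le> (2 * int d - 5)\<^sup>2" by simp
        then have "int d ^ 2 - 3 * int d + 1 \<le> 2 * (int d - 2) ^ 2"
          by (simp add: power2_eq_square algebra_simps)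
        then have "int p * k < int p * 2" using big k by linarith
        moreover have "0 < int p * k" using k h(9) D prime_gt_0_nat[OF p] by linarith
        ultimately have "k = 1" using prime_gt_0_nat[OF p] by (auto simp: zero_less_mult_iff)
        moreover have "a = d - 1" using \<open>int a = int d - 1\<close> d1 by linarith
        ultimately show ?thesis using k h b1 by simp
      qed
      show ?thesis unfolding main_def using h le 2 by auto
    qed
    have sw: "main A B \<longleftrightarrow> main B A" for A B unfolding main_def by auto
    show ?thesis
    proof (cases "c + e < a + b")
      case True
      then show ?thesis using main'[of a A b B c e] h by auto
    next
      case False
      \<comment> \<open>Now the first vector has the smaller degree; exchanging vectors and
        coordinates together keeps the sign of the determinant.\<close>
      have "main B A" using main'[of e B c A b a] h False by (auto simp: algebra_simps)
      then show ?thesis using sw by blast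
    qed
  qed
  have M: "main A B"
  proof (cases "int a * int e \<ge> int b * int c")
    case True
    then show ?thesis using key[of a A b B c e] * pos4 ne det ple by auto
  next
    case False
    have 1: "int p dvd int c * int b - int e * int a"
      using det by (simp add: dvd_diff_commute mult.commute)
    have 2: "int p \<le> int c * int b - int e * int a"
      using ple False by (simp add: mult.commute)
    show ?thesis using key[of c A e B a b] * pos4 ne 1 2 by auto
  qed
  then show "int p \<le> int d ^ 2 - 3 * int d + 1" by (simp add: main_def)
  show "(int d - 2) ^ 2 < int p \<Longrightarrow> int p = int d ^ 2 - 3 * int d + 1 \<and>
      (p dvd (d - 1) * A + B \<or> p dvd (d - 1) * B + A)"
    using M by (simp add: main_def)
qed

section \<open>Degrees and weights of monomials, and the group generated by low exponents\<close>

definition mdeg :: "('n::finite \<Rightarrow>\<^sub>0 nat) \<Rightarrow> nat" where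
  "mdeg m = (\<Sum>i\<in>UNIV. Poly_Mapping.lookup m i)"

text \<open>The generator of the group will scale the i-th eigencoordinate by \<zeta>^(w i), so the
  monomial \<open>m\<close> is invariant iff p divides \<open>wdeg w m\<close>.\<close>

definition wdeg :: "('n::finite \<Rightarrow> nat) \<Rightarrow> ('n \<Rightarrow>\<^sub>0 nat) \<Rightarrow> nat" where
  "wdeg w m = (\<Sum>i\<in>UNIV. Poly_Mapping.lookup m i * w i)"

lemma mdeg_add [simp]: "mdeg (m + n) = mdeg m + mdeg n"
  by (simp add: mdeg_def lookup_add sum.distrib)

lemma wdeg_add [simp]: "wdeg w (m + n) = wdeg w m + wdeg w n"
  by (simp add: wdeg_def lookup_add sum.distrib distrib_right)

lemma mdeg_single [simp]: "mdeg (Poly_Mapping.single i k) = k"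
proof -
  have "mdeg (Poly_Mapping.single i k) = (\<Sum>j\<in>UNIV. if j = i then k else 0)"
    unfolding mdeg_def by (intro sum.cong) (auto simp: lookup_single when_def)
  then show ?thesis by simp
qed

lemma wdeg_single [simp]: "wdeg w (Poly_Mapping.single i k) = k * w i"
proof -
  have "wdeg w (Poly_Mapping.single i k) = (\<Sum>j\<in>UNIV. if j = i then k * w j else 0)"
    unfolding wdeg_def by (intro sum.cong) (auto simp: lookup_single when_def)
  then show ?thesis by simp
qed

lemma mdeg_0 [simp]: "mdeg 0 = 0" and wdeg_0 [simp]: "wdeg w 0 = 0"
  by (simp_all add: mdeg_def wdeg_def)

inductive_set low_monoid :: "nat \<Rightarrow> ('n::finite \<Rightarrow> nat) \<Rightarrow> nat \<Rightarrow> ('n \<Rightarrow>\<^sub>0 nat) set"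
  for p w d where
  zero: "0 \<in> low_monoid p w d"
| add: "p dvd wdeg w m \<Longrightarrow> mdeg m \<le> d \<Longrightarrow> n \<in> low_monoid p w d \<Longrightarrow> m + n \<in> low_monoid p w d"

lemma low_monoid_incl: "p dvd wdeg w m \<Longrightarrow> mdeg m \<le> d \<Longrightarrow> m \<in> low_monoid p w d"
  using low_monoid.add[OF _ _ low_monoid.zero, of p w m d] by simp

lemma low_monoid_add:
  "m \<in> low_monoid p w d \<Longrightarrow> n \<in> low_monoid p w d \<Longrightarrow> m + n \<in> low_monoid p w d"
  by (induction rule: low_monoid.induct) (auto simp: add.assoc intro: low_monoid.add)

text \<open>Differences of exponents stand for quotients of monomials: for an exponent m, membership
  means m + m1 = m2 with m1 and m2 sums of low invariant exponents.\<close>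

definition low_group :: "nat \<Rightarrow> ('n::finite \<Rightarrow> nat) \<Rightarrow> nat \<Rightarrow> ('n \<Rightarrow> int) set" where
  "low_group p w d = {\<lambda>i. int (Poly_Mapping.lookup m i) - int (Poly_Mapping.lookup n i) | m n.
     m \<in> low_monoid p w d \<and> n \<in> low_monoid p w d}"

lemma low_groupI:
  assumes "m \<in> low_monoid p w d" "n \<in> low_monoid p w d"
    "\<And>i. v i = int (Poly_Mapping.lookup m i) - int (Poly_Mapping.lookup n i)"
  shows "v \<in> low_group p w d"
  unfolding low_group_def using assms by blast

lemma low_group_zero: "(\<lambda>_. 0) \<in> low_group p w d"
  by (rule low_groupI[OF low_monoid.zero low_monoid.zero]) simp

lemma low_group_add:
  assumes "u \<in> low_group p w d" "v \<in> low_group p w d"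
  shows "(\<lambda>i. u i + v i) \<in> low_group p w d"
proof -
  obtain m n where mn: "m \<in> low_monoid p w d" "n \<in> low_monoid p w d"
    "u = (\<lambda>i. int (Poly_Mapping.lookup m i) - int (Poly_Mapping.lookup n i))"
    using assms(1) unfolding low_group_def by blast
  obtain m' n' where mn': "m' \<in> low_monoid p w d" "n' \<in> low_monoid p w d"
    "v = (\<lambda>i. int (Poly_Mapping.lookup m' i) - int (Poly_Mapping.lookup n' i))"
    using assms(2) unfolding low_group_def by blast
  show ?thesis
    by (rule low_groupI[OF low_monoid_add[OF mn(1) mn'(1)] low_monoid_add[OF mn(2) mn'(2)]])
       (simp add: mn mn' lookup_add)
qed

lemma low_group_uminus:
  assumes "u \<in> low_group p w d"
  shows "(\<lambda>i. - u i) \<in> low_group p w d"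
proof -
  obtain m n where mn: "m \<in> low_monoid p w d" "n \<in> low_monoid p w d"
    "u = (\<lambda>i. int (Poly_Mapping.lookup m i) - int (Poly_Mapping.lookup n i))"
    using assms unfolding low_group_def by blast
  show ?thesis by (rule low_groupI[OF mn(2,1)]) (simp add: mn)
qed

lemma low_group_scale:
  assumes "u \<in> low_group p w d"
  shows "(\<lambda>i. k * u i) \<in> low_group p w d"
proof -
  have nat: "(\<lambda>i. int n * u i) \<in> low_group p w d" for n
    by (induction n) (use low_group_zero low_group_add[OF assms] in \<open>auto simp: distrib_right\<close>)
  show ?thesis
    using nat[of "nat k"] low_group_uminus[OF nat[of "nat (- k)"]] by (cases "k \<ge> 0") auto
qed

lemma low_group_sum:
  assumes "\<And>j. j \<in> J \<Longrightarrow> f j \<in> low_group p w d"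
  shows "(\<lambda>i. \<Sum>j\<in>J. f j i) \<in> low_group p w d"
  using assms by (induction J rule: infinite_finite_induct) (auto intro: low_group_zero low_group_add)

text \<open>Strip one factor x_i from a low invariant monomial: multiplying the rest by x_i or by
  x_i' gives two invariant monomials of the same degree, with quotient x_i' / x_i.\<close>

lemma low_group_exchange:
  assumes "p dvd a * w i + b * w j" "a > 0" "a + b \<le> d" "w i' = w i"
  shows "(\<lambda>l. of_bool (l = i') - of_bool (l = i)) \<in> low_group p w d"
proof -
  obtain a' where a: "a = Suc a'" using assms(2) gr0_implies_Suc by blast
  define m where "m = Poly_Mapping.single i a' + Poly_Mapping.single j b"
  have "m + Poly_Mapping.single i' 1 \<in> low_monoid p w d" "m + Poly_Mapping.single i 1 \<in> low_monoid p w d"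
    using assms by (auto intro!: low_monoid_incl simp: m_def a algebra_simps)
  then show ?thesis
    by (rule low_groupI) (auto simp: lookup_add lookup_single when_def)
qed

text \<open>Modulo \<open>low_group\<close>, every coordinate of weight \<open>A\<close> may be
  moved to \<open>iA\<close>, every one of weight \<open>B\<close> to \<open>iB\<close>, and those
  of weight 0 dropped. What remains lies in the plane of \<open>iA\<close> and \<open>iB\<close>,
  where \<open>rank2_basis\<close> applies.\<close>

lemma low_group_two_weights:
  fixes w :: "'n::finite \<Rightarrow> nat"
  assumes rank: "spans_rank2 p A B d" and "A \<noteq> B" "A \<noteq> 0" "B \<noteq> 0"
    and w: "\<And>i. w i \<in> {0, A, B}" "w iA = A" "w iB = B"
    and v: "int p dvd (\<Sum>i\<in>UNIV. v i * int (w i))"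
  shows "v \<in> low_group p w d"
proof -
  obtain a b c e where *: "p dvd a * A + b * B" "p dvd c * A + e * B" "a + b \<le> d" "c + e \<le> d"
    "a * e \<noteq> b * c" and basis: "\<And>(x::int) (y::int). int p dvd x * A + y * B \<Longrightarrow>
       \<exists>s t :: int. x = s * int a + t * int c \<and> y = s * int b + t * int e"
    by (rule rank2_basis[OF rank], rule that)
  have ne: "iA \<noteq> iB" using w \<open>A \<noteq> B\<close> by auto
  \<comment> \<open>Coordinates of weight 0 are invariants of degree 1 and have to count as
    low.\<close>
  have d: "d \<ge> 1" using * by (cases d) auto
  define \<delta> where "\<delta> = (\<lambda>i l::'n. (of_bool (l = i) :: int))"
  have two: "(\<lambda>l. int x * \<delta> iA l + int y * \<delta> iB l) \<in> low_group p w d"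
    if "p dvd x * A + y * B" "x + y \<le> d" for x y
    using that w ne
    by (intro low_groupI[OF low_monoid_incl[of _ _ "Poly_Mapping.single iA x + Poly_Mapping.single iB y"] low_monoid.zero])
       (auto simp: \<delta>_def lookup_add lookup_single when_def)
  define r where "r = (\<lambda>i l. (if w i = A then \<delta> iA l else 0) + (if w i = B then \<delta> iB l else 0))"
  have r: "(\<lambda>l. \<delta> i l - r i l) \<in> low_group p w d" for i
  proof -
    consider "w i = 0" | "w i = A" | "w i = B" using w(1)[of i] by auto
    then show ?thesis
    proof cases
      case 1
      then have "(\<lambda>l. \<delta> i l) \<in> low_group p w d"
        using d by (intro low_groupI[OF low_monoid_incl[of _ _ "Poly_Mapping.single i 1"] low_monoid.zero])
          (auto simp: \<delta>_def lookup_single when_def)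
      then show ?thesis using 1 assms by (simp add: r_def)
    next
      case 2
      \<comment> \<open>Otherwise the determinant would be 0; so one of the two basis vectors
        involves weight \<open>A\<close> and allows the exchange.\<close>
      have "a > 0 \<or> c > 0" using * by auto
      then have "(\<lambda>l. \<delta> i l - \<delta> iA l) \<in> low_group p w d"
        using low_group_exchange[of p a w iA b iB d i] low_group_exchange[of p c w iA e iB d i] * w 2
        by (auto simp: \<delta>_def)
      then show ?thesis using 2 assms by (simp add: r_def)
    next
      case 3
      have "b > 0 \<or> e > 0" using * by auto
      then have "(\<lambda>l. \<delta> i l - \<delta> iB l) \<in> low_group p w d"
        using low_group_exchange[of p b w iB a iA d i] low_group_exchange[of p e w iB c iA d i] * w 3
        by (auto simp: \<delta>_def add.commute)
      then show ?thesis using 3 assms by (simp add: r_def)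
    qed
  qed
  define XA YB where "XA = (\<Sum>i\<in>UNIV. if w i = A then v i else 0)"
    and "YB = (\<Sum>i\<in>UNIV. if w i = B then v i else 0)"
  have "(\<Sum>i\<in>UNIV. v i * int (w i)) =
      (\<Sum>i\<in>UNIV. (if w i = A then v i else 0) * int A + (if w i = B then v i else 0) * int B)"
    using w(1) assms(2,3) by (intro sum.cong) force+
  then have "int p dvd XA * A + YB * B"
    using v by (simp add: XA_def YB_def sum_distrib_right sum.distrib)
  then obtain s t where st: "XA = s * int a + t * int c" "YB = s * int b + t * int e"
    using basis by blast
  define g where "g = (\<lambda>l. (\<Sum>i\<in>UNIV. v i * (\<delta> i l - r i l)) +
      (s * (int a * \<delta> iA l + int b * \<delta> iB l) + t * (int c * \<delta> iA l + int e * \<delta> iB l)))"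
  have "g \<in> low_group p w d"
    unfolding g_def
    by (intro low_group_add low_group_sum low_group_scale r two *)
  moreover have "g = v"
  proof
    fix l
    have "(\<Sum>i\<in>UNIV. v i * \<delta> i l) = v l" by (simp add: \<delta>_def of_bool_def if_distrib cong: if_cong)
    moreover have "(\<Sum>i\<in>UNIV. v i * r i l) = XA * \<delta> iA l + YB * \<delta> iB l"
      unfolding XA_def YB_def sum_distrib_right sum.distrib[symmetric]
      by (intro sum.cong) (auto simp: r_def algebra_simps)
    ultimately show "g l = v l"
      by (simp add: g_def st right_diff_distrib sum_subtractf algebra_simps)
  qed
  ultimately show ?thesis by simp
qed

lemma low_monoid_two_weights:
  fixes w :: "'n::finite \<Rightarrow> nat"
  assumes "spans_rank2 p A B d" "A \<noteq> B" "A \<noteq> 0" "B \<noteq> 0"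
    and "\<And>i. w i \<in> {0, A, B}" "w iA = A" "w iB = B" and "p dvd wdeg w m"
  shows "\<exists>m1 \<in> low_monoid p w d. \<exists>m2 \<in> low_monoid p w d. m + m1 = m2"
proof -
  have "int p dvd (\<Sum>i\<in>UNIV. int (Poly_Mapping.lookup m i) * int (w i))"
    using assms(8) by (simp add: wdeg_def flip: of_nat_mult of_nat_sum)
  then have "(\<lambda>i. int (Poly_Mapping.lookup m i)) \<in> low_group p w d"
    by (rule low_group_two_weights[OF assms(1-7)])
  then obtain m1 m2 where m12: "m1 \<in> low_monoid p w d" "m2 \<in> low_monoid p w d"
      "(\<lambda>i. int (Poly_Mapping.lookup m i)) =
        (\<lambda>i. int (Poly_Mapping.lookup m2 i) - int (Poly_Mapping.lookup m1 i))"
    unfolding low_group_def by blast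
  have "m + m1 = m2"
  proof (rule poly_mapping_eqI)
    fix i
    show "Poly_Mapping.lookup (m + m1) i = Poly_Mapping.lookup m2 i"
      using fun_cong[OF m12(3), of i] by (simp add: lookup_add)
  qed
  with m12 show ?thesis by blast
qed

text \<open>All low exponents project to one line in the plane of weight sums. A nonzero integer
  functional vanishing on that line, pulled back to the coordinates, is \<alpha>; if all projections
  vanish, any functional will do.\<close>

lemma weight_functional_two_weights:
  fixes w :: "'n::finite \<Rightarrow> nat"
  assumes "\<not> spans_rank2 p A B d" "A \<noteq> B" "A \<noteq> 0" "B \<noteq> 0"
    and w: "\<And>i. w i \<in> {0, A, B}" "w iA = A" "w iB = B"
  obtains \<alpha> :: "'n \<Rightarrow> int" and i where "\<alpha> i \<noteq> 0"
    "\<And>m. p dvd wdeg w m \<Longrightarrow> mdeg m \<le> d \<Longrightarrow> (\<Sum>i\<in>UNIV. \<alpha> i * int (Poly_Mapping.lookup m i)) = 0"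
proof -
  define XA YB where "XA = (\<lambda>m::'n \<Rightarrow>\<^sub>0 nat. \<Sum>i\<in>UNIV. if w i = A then Poly_Mapping.lookup m i else 0)"
    and "YB = (\<lambda>m::'n \<Rightarrow>\<^sub>0 nat. \<Sum>i\<in>UNIV. if w i = B then Poly_Mapping.lookup m i else 0)"
  have deg: "wdeg w m = XA m * A + YB m * B" for m
    unfolding wdeg_def XA_def YB_def sum_distrib_right sum.distrib[symmetric]
    using w(1) assms(2,3) by (intro sum.cong) force+
  have le: "XA m + YB m \<le> mdeg m" for m
    unfolding mdeg_def XA_def YB_def sum.distrib[symmetric]
    using assms(2) by (intro sum_mono) auto
  define good where "good = (\<lambda>m. p dvd wdeg w m \<and> mdeg m \<le> d)"
  have par: "XA m * YB n = YB m * XA n" if "good m" "good n" for m n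
  proof (rule ccontr)
    assume "XA m * YB n \<noteq> YB m * XA n"
    then have "spans_rank2 p A B d"
      unfolding spans_rank2_def using that deg[of m] deg[of n] le[of m] le[of n]
      by (intro exI[of _ "XA m"] exI[of _ "YB m"] exI[of _ "XA n"] exI[of _ "YB n"]) (auto simp: good_def)
    with assms(1) show False by simp
  qed
  have "\<exists>x y :: int. (x \<noteq> 0 \<or> y \<noteq> 0) \<and> (\<forall>m. good m \<longrightarrow> x * int (XA m) + y * int (YB m) = 0)"
  proof (cases "\<exists>n. good n \<and> (XA n \<noteq> 0 \<or> YB n \<noteq> 0)")
    case True
    then obtain n where n: "good n" "XA n \<noteq> 0 \<or> YB n \<noteq> 0" by blast
    have "int (YB n) * int (XA m) + (- int (XA n)) * int (YB m) = 0" if "good m" for m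
      using par[OF n(1) that] by (simp flip: of_nat_mult)
    with n(2) show ?thesis
      by (intro exI[of _ "int (YB n)"] exI[of _ "- int (XA n)"]) auto
  next
    case False
    then show ?thesis by (intro exI[of _ 1] exI[of _ 0]) auto
  qed
  then obtain x y :: int where xy: "x \<noteq> 0 \<or> y \<noteq> 0"
      "\<And>m. good m \<Longrightarrow> x * int (XA m) + y * int (YB m) = 0" by blast
  define \<alpha> where "\<alpha> = (\<lambda>i. (if w i = A then x else 0) + (if w i = B then y else 0))"
  have "(\<Sum>i\<in>UNIV. \<alpha> i * int (Poly_Mapping.lookup m i)) = x * int (XA m) + y * int (YB m)" for m
    unfolding XA_def YB_def of_nat_sum sum_distrib_left sum.distrib[symmetric]
    by (intro sum.cong) (auto simp: \<alpha>_def algebra_simps)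
  then have "(\<Sum>i\<in>UNIV. \<alpha> i * int (Poly_Mapping.lookup m i)) = 0" if "p dvd wdeg w m" "mdeg m \<le> d" for m
    using xy(2)[of m] that by (simp add: good_def)
  moreover have "\<alpha> iA \<noteq> 0 \<or> \<alpha> iB \<noteq> 0" using w xy(1) assms(2) by (auto simp: \<alpha>_def)
  ultimately show thesis using that by blast
qed

section \<open>Adjoining polynomials to the ground field\<close>

lemma ring_of_type_algebra_simps [simp]:
  "carrier ring_of_type_algebra = UNIV" "monoid.mult ring_of_type_algebra = (*)"
  "monoid.one ring_of_type_algebra = 1" "ring.zero ring_of_type_algebra = 0"
  "ring.add ring_of_type_algebra = (+)"
  by (simp_all add: ring_of_type_algebra_def fun_eq_iff)

lemma ring_of_type_algebra_a_inv [simp]: "\<ominus>\<^bsub>ring_of_type_algebra\<^esub> (x::'a::field) = - x"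
proof -
  interpret field "ring_of_type_algebra :: 'a ring" by (rule field_from_type_algebra)
  show ?thesis by (rule minus_equality) auto
qed

lemma ring_of_type_algebra_m_inv:
  assumes "x \<noteq> 0"
  shows "inv\<^bsub>ring_of_type_algebra\<^esub> (x::'a::field) = inverse x"
proof -
  interpret field "ring_of_type_algebra :: 'a ring" by (rule field_from_type_algebra)
  show ?thesis using assms by (intro comm_inv_char) auto
qed

text \<open>The fractions of this \<open>k\<close>-algebra are exactly
  \<open>field_adjoin S\<close>, by \<open>field_adjoin_Fract\<close> and
  \<open>field_adjoin_cases\<close>; later arguments can therefore handle numerators and
  denominators as polynomials.\<close>

inductive_set alg_adjoin :: "('n::finite, 'k::comm_ring_1) polys set \<Rightarrow> ('n, 'k) polys set" for S where
  const: "poly_const c \<in> alg_adjoin S"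
| incl: "f \<in> S \<Longrightarrow> f \<in> alg_adjoin S"
| add: "f \<in> alg_adjoin S \<Longrightarrow> g \<in> alg_adjoin S \<Longrightarrow> f + g \<in> alg_adjoin S"
| mult: "f \<in> alg_adjoin S \<Longrightarrow> g \<in> alg_adjoin S \<Longrightarrow> f * g \<in> alg_adjoin S"

lemma alg_adjoin_0: "0 \<in> alg_adjoin S" and alg_adjoin_1: "1 \<in> alg_adjoin S"
  using alg_adjoin.const[of 0 S] alg_adjoin.const[of 1 S] by simp_all

lemma alg_adjoin_uminus: "f \<in> alg_adjoin S \<Longrightarrow> - f \<in> alg_adjoin S"
proof -
  assume "f \<in> alg_adjoin S"
  then have "poly_const (- 1) * f \<in> alg_adjoin S"
    by (intro alg_adjoin.mult alg_adjoin.const)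
  moreover have "poly_const (- 1) + 1 = (0 :: ('a, 'b) polys)"
    by (metis add.left_inverse poly_const_add poly_const_simps)
  ultimately show ?thesis
    by (simp add: add_eq_0_iff2)
qed

lemma field_adjoin_Fract:
  assumes "a \<in> alg_adjoin S" "b \<in> alg_adjoin S" "b \<noteq> 0"
  shows "Fract a b \<in> field_adjoin S"
proof -
  let ?H = "range (\<lambda>c. Fract (poly_const c) 1) \<union> (\<lambda>f. Fract f 1) ` S"
  have 1: "Fract f 1 \<in> field_adjoin S" if "f \<in> alg_adjoin S" for f
    using that
  proof induction
    case (const c)
    show ?case unfolding field_adjoin_def by (rule generate_field.incl) auto
  next
    case (incl f)
    then show ?case unfolding field_adjoin_def by (intro generate_field.incl) auto
  next
    case (add f g)
    then show ?case
      using generate_field.eng_add[of "Fract f 1" ring_of_type_algebra ?H "Fract g 1"]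
      by (simp add: field_adjoin_def)
  next
    case (mult f g)
    then show ?case
      using generate_field.eng_mult[of "Fract f 1" ring_of_type_algebra ?H "Fract g 1"]
      by (simp add: field_adjoin_def)
  qed
  have nz: "Fract b 1 \<noteq> 0" using assms(3) by (simp add: Zero_fract_def eq_fract)
  have "inverse (Fract b 1) \<in> field_adjoin S"
    using generate_field.m_inv[of "Fract b 1" ring_of_type_algebra ?H] 1[OF assms(2)] nz
    by (simp add: field_adjoin_def ring_of_type_algebra_m_inv)
  then show ?thesis
    using generate_field.eng_mult[of "Fract a 1" ring_of_type_algebra ?H "Fract 1 b"] 1[OF assms(1)]
    by (simp add: field_adjoin_def)
qed

lemma field_adjoin_cases:
  assumes "q \<in> field_adjoin S"
  shows "\<exists>a \<in> alg_adjoin S. \<exists>b \<in> alg_adjoin S. b \<noteq> 0 \<and> q = Fract a b"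
  using assms unfolding field_adjoin_def
proof (induction rule: generate_field.induct)
  case one
  have "(1 :: ('a, 'b) rats) = Fract 1 1" by (simp add: One_fract_def)
  then show ?case using alg_adjoin_1[of S] by (metis one_neq_zero ring_of_type_algebra_simps(3))
next
  case (incl h)
  then obtain f where f: "f \<in> alg_adjoin S" "h = Fract f 1"
    by (auto intro: alg_adjoin.intros)
  show ?case
    using f by (intro bexI[of _ f] bexI[of _ 1]) (auto intro: alg_adjoin_1)
next
  case (a_inv h)
  then obtain a b where ab: "a \<in> alg_adjoin S" "b \<in> alg_adjoin S" "b \<noteq> 0" "h = Fract a b" by blast
  then show ?case
    by (intro bexI[of _ "- a"] bexI[of _ b]) (auto intro: alg_adjoin_uminus)
next
  case (m_inv h)
  then obtain a b where ab: "a \<in> alg_adjoin S" "b \<in> alg_adjoin S" "b \<noteq> 0" "h = Fract a b" by blast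
  with m_inv have "a \<noteq> 0" by (auto simp: fract_collapse)
  with ab m_inv show ?case
    by (intro bexI[of _ b] bexI[of _ a]) (auto simp: ring_of_type_algebra_m_inv)
next
  case (eng_add h1 h2)
  then obtain a b a' b' where ab: "a \<in> alg_adjoin S" "b \<in> alg_adjoin S" "b \<noteq> 0" "h1 = Fract a b"
    "a' \<in> alg_adjoin S" "b' \<in> alg_adjoin S" "b' \<noteq> 0" "h2 = Fract a' b'" by blast
  then show ?case
    by (intro bexI[of _ "a * b' + a' * b"] bexI[of _ "b * b'"]) (auto intro: alg_adjoin.intros)
next
  case (eng_mult h1 h2)
  then obtain a b a' b' where ab: "a \<in> alg_adjoin S" "b \<in> alg_adjoin S" "b \<noteq> 0" "h1 = Fract a b"
    "a' \<in> alg_adjoin S" "b' \<in> alg_adjoin S" "b' \<noteq> 0" "h2 = Fract a' b'" by blast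
  then show ?case
    by (intro bexI[of _ "a * a'"] bexI[of _ "b * b'"]) (auto intro: alg_adjoin.intros)
qed

lemma field_adjoin_common_denominator:
  assumes "finite I" "\<And>i. i \<in> I \<Longrightarrow> c i \<in> field_adjoin S"
  shows "\<exists>b \<in> alg_adjoin S. b \<noteq> 0 \<and> (\<exists>a. \<forall>i\<in>I. a i \<in> alg_adjoin S \<and> c i = Fract (a i) b)"
  using assms
proof (induction I)
  case empty
  then show ?case using alg_adjoin_1 by (intro bexI[of _ 1]) auto
next
  case (insert j I)
  obtain b a where b: "b \<in> alg_adjoin S" "b \<noteq> 0" and a: "\<forall>i\<in>I. a i \<in> alg_adjoin S \<and> c i = Fract (a i) b"
    using insert by auto
  obtain a' b' where c: "a' \<in> alg_adjoin S" "b' \<in> alg_adjoin S" "b' \<noteq> 0" "c j = Fract a' b'"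
    using field_adjoin_cases[of "c j" S] insert.prems by auto
  show ?case
  proof (intro bexI[of _ "b * b'"] conjI exI[of _ "(\<lambda>i. a i * b')(j := a' * b)"] ballI)
    fix i assume "i \<in> insert j I"
    then show "((\<lambda>i. a i * b')(j := a' * b)) i \<in> alg_adjoin S"
      using a b c by (auto intro: alg_adjoin.intros)
    show "c i = Fract (((\<lambda>i. a i * b')(j := a' * b)) i) (b * b')"
      using \<open>i \<in> insert j I\<close> a b c by (auto simp: eq_fract mult_ac)
  qed (use b c in \<open>auto intro: alg_adjoin.intros\<close>)
qed

lemma field_adjoin_subfield:
  "subfield (field_adjoin S) (ring_of_type_algebra :: ('n::{finite,linorder}, 'k::field) rats ring)"
proof -
  interpret field "ring_of_type_algebra :: ('n, 'k) rats ring" by (rule field_from_type_algebra)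
  show ?thesis unfolding field_adjoin_def by (rule generate_field_is_subfield) simp
qed

text \<open>Dimension n makes the n + 1 powers g^0, ..., g^n dependent over the subfield; a common
  denominator turns the relation into one with polynomial coefficients.\<close>

lemma finite_dimension_imp_algebraic:
  fixes g :: "('n::{finite,linorder}, 'k::field) polys"
  assumes fin: "ring.finite_dimension ring_of_type_algebra (field_adjoin S) E"
    and g: "\<And>i. Fract (g ^ i) 1 \<in> E"
  obtains N a where "\<And>i. i < N \<Longrightarrow> a i \<in> alg_adjoin S" "\<exists>i<N. a i \<noteq> 0" "(\<Sum>i<N. a i * g ^ i) = 0"
proof -
  let ?R = "ring_of_type_algebra :: ('n, 'k) rats ring"
  interpret R: field ?R by (rule field_from_type_algebra)
  note sub = field_adjoin_subfield[of S]
  obtain n where n: "R.dimension n (field_adjoin S) E"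
    using fin unfolding R.finite_dimension_def by blast
  define Us where "Us = map (\<lambda>i. Fract (g ^ i) 1) [0..<Suc n]"
  have "\<not> R.independent (field_adjoin S) Us"
  proof
    assume "R.independent (field_adjoin S) Us"
    then have "length Us \<le> n"
      by (rule R.independent_length_le_dimension[OF sub n]) (use g in \<open>auto simp: Us_def\<close>)
    then show False by (simp add: Us_def)
  qed
  then obtain Ks where Ks: "set Ks \<subseteq> field_adjoin S" "R.combine Ks Us = 0"
      "\<not> set (take (length Us) Ks) \<subseteq> {0}"
    using R.trivial_combine_imp_independent[OF sub, of Us] by auto
  have comb: "R.combine Ks Vs = (\<Sum>i<min (length Ks) (length Vs). Ks ! i * Vs ! i)" for Ks Vs
  proof (induction Ks Vs rule: R.combine.induct)
    case (1 k Ks u Us)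
    have "(\<Sum>i<min (length (k # Ks)) (length (u # Us)). (k # Ks) ! i * (u # Us) ! i) =
        k * u + (\<Sum>i<min (length Ks) (length Us). Ks ! i * Us ! i)"
      by (simp add: sum.lessThan_Suc_shift del: sum.lessThan_Suc)
    with 1 show ?case by simp
  qed auto
  \<comment> \<open>The coefficient list may be shorter or longer than \<open>Us\<close>; only the
    common prefix contributes, and it contains a nonzero entry.\<close>
  define N where "N = min (length Ks) (Suc n)"
  have lU: "length Us = Suc n" by (simp add: Us_def)
  have nth: "Us ! i = Fract (g ^ i) 1" if "i < N" for i
    using that by (simp add: Us_def N_def del: upt_Suc)
  obtain b a where b: "b \<in> alg_adjoin S" "b \<noteq> 0"
    and a: "\<forall>i\<in>{..<N}. a i \<in> alg_adjoin S \<and> Ks ! i = Fract (a i) b"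
    using field_adjoin_common_denominator[of "{..<N}" "\<lambda>i. Ks ! i" S] Ks(1)
    by (auto simp: N_def subset_iff)
  have "0 = (\<Sum>i<N. Ks ! i * Us ! i)"
    using Ks(2) by (simp add: comb N_def lU)
  also have "\<dots> = (\<Sum>i<N. Fract (a i * g ^ i) b)"
    using a nth by (intro sum.cong) auto
  also have "\<dots> = Fract (\<Sum>i<N. a i * g ^ i) b"
  proof -
    have "(\<Sum>i\<in>I. Fract (h i) b) = Fract (\<Sum>i\<in>I. h i) b" for h and I :: "nat set"
      by (induction I rule: infinite_finite_induct)
         (use b in \<open>auto simp: Zero_fract_def eq_fract algebra_simps\<close>)
    then show ?thesis .
  qed
  finally have sum0: "(\<Sum>i<N. a i * g ^ i) = 0"
    using b(2) by (simp add: Zero_fract_def eq_fract)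
  obtain x where x: "x \<in> set (take (Suc n) Ks)" "x \<noteq> 0"
    using Ks(3) lU by auto
  then obtain i where i: "i < N" "Ks ! i = x"
    by (auto simp: in_set_conv_nth N_def)
  then have "a i \<noteq> 0" using a x(2) b by (auto simp: fract_collapse)
  then show thesis using that[of N a] a i(1) sum0 by auto
qed

text \<open>View \<open>K\<close> as a vector space over \<open>k\<close> through
  \<open>\<iota>\<close>; since \<open>{c}\<close> is independent, the map sending \<open>c\<close>
  to 1 extends linearly.\<close>

lemma functional_exists:
  fixes \<iota> :: "'k::field \<Rightarrow> 'K::field"
  assumes "\<iota> 1 = 1" "\<And>a b. \<iota> (a + b) = \<iota> a + \<iota> b" "\<And>a b. \<iota> (a * b) = \<iota> a * \<iota> b" and c: "c \<noteq> 0"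
  shows "\<exists>l :: 'K \<Rightarrow> 'k. (\<forall>x y. l (x + y) = l x + l y) \<and> (\<forall>a x. l (\<iota> a * x) = a * l x) \<and> l c \<noteq> 0"
proof -
  interpret V: vector_space "\<lambda>a x. \<iota> a * x"
    by unfold_locales (simp_all add: assms algebra_simps)
  interpret W: vector_space "(*) :: 'k \<Rightarrow> 'k \<Rightarrow> 'k"
    by unfold_locales (simp_all add: algebra_simps)
  interpret vector_space_pair "\<lambda>a x. \<iota> a * x" "(*) :: 'k \<Rightarrow> 'k \<Rightarrow> 'k" ..
  have "V.independent {c}" using c by simp
  from linear_independent_extend[OF this, of "\<lambda>_. 1"]
  obtain l where l: "Vector_Spaces.linear (\<lambda>a x. \<iota> a * x) (*) l" "l c = 1" by auto
  interpret l: Vector_Spaces.linear "\<lambda>a x. \<iota> a * x" "(*)" l by (rule l)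
  show ?thesis
    by (rule exI[of _ l]) (use l in \<open>auto simp: l.add l.scale\<close>)
qed

section \<open>Invariants of a diagonalizable action\<close>

lemma total_degree_le_iff_mdeg: "total_degree_le d f \<longleftrightarrow> (\<forall>m\<in>Poly_Mapping.keys f. mdeg m \<le> d)"
  by (simp add: total_degree_le_def mdeg_def)

lemma total_degree_le_map: "total_degree_le d f \<Longrightarrow> total_degree_le d (Poly_Mapping.map h f)"
  using keys_map_subset[of h f] by (auto simp: total_degree_le_def)

lemma primitive_root_power_eq_1_iff:
  assumes "is_primitive_root p (\<zeta>::'K::field)"
  shows "\<zeta> ^ n = 1 \<longleftrightarrow> p dvd n"
proof
  assume "\<zeta> ^ n = 1"
  moreover have "\<zeta> ^ n = (\<zeta> ^ p) ^ (n div p) * \<zeta> ^ (n mod p)"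
    by (simp flip: power_mult power_add)
  ultimately have "\<zeta> ^ (n mod p) = 1"
    using assms by (simp add: is_primitive_root_def)
  moreover have "n mod p < p" using assms by (simp add: is_primitive_root_def)
  ultimately show "p dvd n"
    using assms unfolding is_primitive_root_def by (metis dvd_eq_mod_eq_0 gr_zeroI)
next
  assume "p dvd n"
  then show "\<zeta> ^ n = 1" using assms by (auto simp: is_primitive_root_def power_mult)
qed

definition diag_mat :: "('n \<Rightarrow> 'a::zero) \<Rightarrow> 'a^'n^'n" where
  "diag_mat c = (\<chi> i j. if i = j then c i else 0)"

lemma lookup_poly_precomp_diag_mat:
  "Poly_Mapping.lookup (poly_precomp (diag_mat c) f) m =
     Poly_Mapping.lookup f m * (\<Prod>i\<in>UNIV. c i ^ Poly_Mapping.lookup m i)"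
proof -
  have "(\<Sum>j\<in>UNIV. poly_const (diag_mat c $ i $ j) * poly_coord j) = poly_const (c i) * poly_coord i" for i
  proof -
    have "(\<Sum>j\<in>UNIV. poly_const (diag_mat c $ i $ j) * poly_coord j) =
        (\<Sum>j\<in>UNIV. if i = j then poly_const (c i) * poly_coord i else 0)"
      by (intro sum.cong) (auto simp: diag_mat_def)
    then show ?thesis by simp
  qed
  then show ?thesis by (simp add: poly_precomp_def lookup_poly_subst_scale)
qed

lemma is_rep_mult:
  assumes "is_rep (integer_mod_group p) \<rho>" "p > 0" "a \<in> {0..<int p}" "b \<in> {0..<int p}"
  shows "\<rho> a ** \<rho> b = \<rho> ((a + b) mod int p)"
  using hom_mult[of \<rho> "integer_mod_group p" GL a b] assms
  by (simp add: is_rep_def carrier_integer_mod_group GL_def)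

lemma is_rep_0:
  assumes rep: "is_rep (integer_mod_group p) \<rho>" and p: "p > 0"
  shows "\<rho> 0 = mat 1"
proof -
  have "invertible (\<rho> 0)"
    using rep p by (auto simp: is_rep_def hom_def carrier_integer_mod_group GL_def)
  then obtain B where B: "\<rho> 0 ** B = mat 1" by (auto simp: invertible_def)
  have "\<rho> 0 = (\<rho> 0 ** \<rho> 0) ** B" by (simp add: matrix_mul_assoc[symmetric] B matrix_mul_rid)
  also have "\<dots> = mat 1" using is_rep_mult[OF rep p, of 0 0] p B by simp
  finally show ?thesis .
qed

text \<open>This permits dividing by p in \<open>K\<close> when averaging over the group. An
  embedding is injective, so p would already vanish in \<open>k\<close>, forcing the characteristic
  of \<open>k\<close> to be p.\<close>

lemma of_nat_prime_nonzero_extension: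
  fixes \<iota> :: "'k::field \<Rightarrow> 'K::field"
  assumes "\<iota> 0 = 0" "\<iota> 1 = 1" "\<And>a b. \<iota> (a + b) = \<iota> a + \<iota> b" "\<And>a b. \<iota> (a * b) = \<iota> a * \<iota> b"
    and p: "Factorial_Ring.prime p" "CHAR('k) \<noteq> p"
  shows "of_nat p \<noteq> (0::'K)"
proof
  have *: "\<iota> (of_nat n) = of_nat n" for n
    by (induction n) (simp_all add: assms)
  have inj: "c = 0" if "\<iota> c = 0" for c
    using assms(4)[of c "inverse c"] that assms(2) by (cases "c = 0") simp_all
  assume "of_nat p = (0::'K)"
  then have "of_nat p = (0::'k)" using *[of p] inj[of "of_nat p"] by simp
  then have "CHAR('k) dvd p" by (simp add: of_nat_eq_0_iff_char_dvd)
  then show False using p by (metis CHAR_not_1 One_nat_def prime_nat_iff)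
qed

text \<open>The columns of \<open>P\<close> are a basis of eigenvectors over \<open>K\<close>, the
  i-th with eigenvalue \<zeta>^(w i * a) at a. \<open>K\<close> and \<open>\<zeta>\<close> are
  parameters because the same data are reused over \<open>K(T)\<close>.\<close>

locale diagonalized_rep =
  fixes p :: nat and \<rho> :: "int \<Rightarrow> 'k::field^'n::{finite,linorder}^'n::{finite,linorder}"
    and \<iota> :: "'k \<Rightarrow> 'K::field" and \<zeta> :: 'K and P Q :: "'K^'n::{finite,linorder}^'n::{finite,linorder}" and w :: "'n \<Rightarrow> nat"
  assumes prime: "Factorial_Ring.prime p" and char: "CHAR('k) \<noteq> p"
    and rep: "is_rep (integer_mod_group p) \<rho>"
    and \<iota>_simps [simp]: "\<iota> 0 = 0" "\<iota> 1 = 1" "\<And>a b. \<iota> (a + b) = \<iota> a + \<iota> b" "\<And>a b. \<iota> (a * b) = \<iota> a * \<iota> b"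
    and prim: "is_primitive_root p \<zeta>"
    and PQ: "P ** Q = mat 1" "Q ** P = mat 1"
    and diag: "\<And>a. a \<in> {0..<int p} \<Longrightarrow>
      map_matrix \<iota> (\<rho> a) ** P = P ** diag_mat (\<lambda>i. \<zeta> ^ (w i * nat a))"
begin

abbreviation "G \<equiv> integer_mod_group p"

lemma p_gt_1: "p > 1"
  using prime by (rule prime_gt_1_nat)

lemma carrier_G: "carrier G = {0..<int p}"
  using p_gt_1 by (simp add: carrier_integer_mod_group)

lemma rep_mult: "a \<in> {0..<int p} \<Longrightarrow> b \<in> {0..<int p} \<Longrightarrow> \<rho> a ** \<rho> b = \<rho> ((a + b) mod int p)"
  using is_rep_mult[OF rep] p_gt_1 by simp

lemma rep_invertible: "a \<in> {0..<int p} \<Longrightarrow> invertible (\<rho> a)"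
  using rep by (auto simp: is_rep_def hom_def carrier_G GL_def)

lemma image_inv_carrier: "(\<lambda>a. inv\<^bsub>G\<^esub> a) ` carrier G = carrier G"
proof
  interpret group G by simp
  show "(\<lambda>a. inv\<^bsub>G\<^esub> a) ` carrier G \<subseteq> carrier G"
    using inv_closed by blast
  show "carrier G \<subseteq> (\<lambda>a. inv\<^bsub>G\<^esub> a) ` carrier G"
    by (metis inv_closed inv_inv image_eqI subsetI)
qed

lemma ball_inv_carrier: "(\<forall>g\<in>carrier G. R (inv\<^bsub>G\<^esub> g)) \<longleftrightarrow> (\<forall>a\<in>carrier G. R a)"
proof -
  have "(\<forall>g\<in>carrier G. R (inv\<^bsub>G\<^esub> g)) \<longleftrightarrow> (\<forall>a\<in>(\<lambda>a. inv\<^bsub>G\<^esub> a) ` carrier G. R a)"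
    by blast
  then show ?thesis by (simp only: image_inv_carrier)
qed

lemma inv_polys_iff:
  "f \<in> inv_polys G \<rho> \<longleftrightarrow> (\<forall>a\<in>{0..<int p}. poly_precomp (\<rho> a) f = f)"
  unfolding inv_polys_def carrier_G[symmetric] 
  by (simp only: mem_Collect_eq ball_inv_carrier[where R = "\<lambda>a. poly_precomp (\<rho> a) f = f"])

lemma inv_rats_iff:
  "q \<in> inv_rats G \<rho> \<longleftrightarrow> (\<forall>a\<in>{0..<int p}. rat_precomp (\<rho> a) q = q)"
  unfolding inv_rats_def carrier_G[symmetric]
  by (simp only: mem_Collect_eq ball_inv_carrier[where R = "\<lambda>a. rat_precomp (\<rho> a) q = q"])

text \<open>This is \<open>f\<close> over \<open>K\<close> in eigencoordinates. Translating
  \<open>f\<close> by \<open>\<rho> a\<close> amounts to a diagonal substitution in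
  \<open>\<Phi> f\<close>, while products and degree bounds are kept.\<close>

definition \<Phi> :: "('n, 'k) polys \<Rightarrow> ('n, 'K) polys" where
  "\<Phi> f = poly_precomp P (Poly_Mapping.map \<iota> f)"

lemma map_\<iota>_mult: "Poly_Mapping.map \<iota> (f * g) = Poly_Mapping.map \<iota> f * Poly_Mapping.map \<iota> (g :: ('n, 'k) polys)"
  using map_poly_mapping_mult[where h = \<iota> and u = "\<lambda>x. x" and v = \<iota> and f = f and g = g] by simp

lemma map_\<iota>_const: "Poly_Mapping.map \<iota> (poly_const c) = poly_const (\<iota> c)"
  by (simp add: poly_const_def map_single_0)

lemma \<iota>_eq_0: "\<iota> c = 0 \<Longrightarrow> c = 0"
  by (metis \<iota>_simps(2,4) mult_zero_right mult.commute right_inverse zero_neq_one)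

lemma precomp_QP [simp]: "poly_precomp Q (poly_precomp P F) = F" "poly_precomp P (poly_precomp Q F) = F"
  by (simp_all add: poly_precomp_precomp PQ poly_precomp_mat_1)

lemma \<Phi>_0 [simp]: "\<Phi> 0 = 0"
  by (simp add: \<Phi>_def)

lemma \<Phi>_mult: "\<Phi> (f * g) = \<Phi> f * \<Phi> g"
  by (simp add: \<Phi>_def map_\<iota>_mult poly_precomp_mult)

lemma \<Phi>_add: "\<Phi> (f + g) = \<Phi> f + \<Phi> g"
  by (simp add: \<Phi>_def map_poly_mapping_add poly_precomp_add)

lemma \<Phi>_const: "\<Phi> (poly_const c) = poly_const (\<iota> c)"
  by (simp add: \<Phi>_def map_\<iota>_const)

lemma \<Phi>_1 [simp]: "\<Phi> 1 = 1"
  using \<Phi>_const[of 1] by simp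

lemma \<Phi>_power: "\<Phi> (f ^ n) = \<Phi> f ^ n"
  by (induction n) (simp_all add: \<Phi>_mult)

lemma \<Phi>_sum: "\<Phi> (\<Sum>i\<in>I. f i) = (\<Sum>i\<in>I. \<Phi> (f i))"
  by (induction I rule: infinite_finite_induct) (simp_all add: \<Phi>_add)

lemma \<Phi>_eq_0: "\<Phi> f = 0 \<Longrightarrow> f = 0"
proof (rule poly_mapping_eqI)
  fix m assume "\<Phi> f = 0"
  then have "Poly_Mapping.map \<iota> f = 0" using precomp_QP(1)[of "Poly_Mapping.map \<iota> f"] by (simp add: \<Phi>_def)
  then have "\<iota> (Poly_Mapping.lookup f m) = 0" by (metis lookup_map_0 \<iota>_simps(1) lookup_zero)
  then show "Poly_Mapping.lookup f m = Poly_Mapping.lookup 0 m" using \<iota>_eq_0 by simp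
qed

lemma wdeg_prod: "(\<Prod>i\<in>UNIV. (\<zeta> ^ (w i * a)) ^ Poly_Mapping.lookup m i) = (\<zeta> ^ wdeg w m) ^ a"
  by (simp add: wdeg_def sum_distrib_left mult_ac flip: power_mult power_sum)

text \<open>The generator 1 scales the coefficient of \<open>\<Phi> f\<close> at \<open>m\<close> by
  \<zeta>^(wdeg w m); invariance of a nonzero coefficient forces this factor to be 1.\<close>

lemma keys_\<Phi>_inv_polys:
  assumes "f \<in> inv_polys G \<rho>" "m \<in> Poly_Mapping.keys (\<Phi> f)"
  shows "p dvd wdeg w m"
proof -
  have 1: "(1::int) \<in> {0..<int p}" using p_gt_1 by simp
  have "poly_precomp (diag_mat (\<lambda>i. \<zeta> ^ (w i * 1))) (\<Phi> f) = poly_precomp (map_matrix \<iota> (\<rho> 1) ** P) (Poly_Mapping.map \<iota> f)"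
    using diag[OF 1] by (simp add: \<Phi>_def poly_precomp_precomp)
  also have "\<dots> = \<Phi> (poly_precomp (\<rho> 1) f)"
    by (simp add: \<Phi>_def poly_precomp_map flip: poly_precomp_precomp)
  also have "poly_precomp (\<rho> 1) f = f" using assms(1) 1 by (simp only: inv_polys_iff)
  finally have "Poly_Mapping.lookup (poly_precomp (diag_mat (\<lambda>i. \<zeta> ^ (w i * 1))) (\<Phi> f)) m =
      Poly_Mapping.lookup (\<Phi> f) m"
    by (rule arg_cong)
  then have "Poly_Mapping.lookup (\<Phi> f) m * (\<zeta> ^ wdeg w m) ^ 1 = Poly_Mapping.lookup (\<Phi> f) m"
    unfolding lookup_poly_precomp_diag_mat wdeg_prod .
  then have "\<zeta> ^ wdeg w m = 1" using assms(2) by (simp add: in_keys_iff)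
  then show ?thesis using primitive_root_power_eq_1_iff[OF prim] by blast
qed

lemma total_degree_\<Phi>: "total_degree_le d f \<Longrightarrow> total_degree_le d (\<Phi> f)"
  unfolding \<Phi>_def by (intro total_degree_le_poly_precomp total_degree_le_map)

lemma of_nat_p_nonzero: "of_nat p \<noteq> (0::'K)"
  using of_nat_prime_nonzero_extension[OF \<iota>_simps prime char] .

text \<open>The \<open>K\<close>-span of the \<open>\<Phi>\<close>-images of \<open>S\<close> plays
  the part of the scalar extension of \<open>S\<close>: over \<open>K\<close> invariance is read off
  monomials, and this span carries the result back to \<open>S\<close>.\<close>

inductive_set kspan :: "('n, 'k) polys set \<Rightarrow> ('n, 'K) polys set" for S where
  zero: "0 \<in> kspan S"
| step: "f \<in> S \<Longrightarrow> F \<in> kspan S \<Longrightarrow> poly_const c * \<Phi> f + F \<in> kspan S"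

lemma kspan_incl: "f \<in> S \<Longrightarrow> poly_const c * \<Phi> f \<in> kspan S"
  using kspan.step[OF _ kspan.zero] by fastforce

lemma kspan_add: "F \<in> kspan S \<Longrightarrow> H \<in> kspan S \<Longrightarrow> F + H \<in> kspan S"
  by (induction rule: kspan.induct) (auto simp: add.assoc intro: kspan.step)

lemma kspan_sum: "(\<And>i. i \<in> I \<Longrightarrow> F i \<in> kspan S) \<Longrightarrow> (\<Sum>i\<in>I. F i) \<in> kspan S"
  by (induction I rule: infinite_finite_induct) (auto intro: kspan_add kspan.zero)

lemma kspan_scale: "F \<in> kspan S \<Longrightarrow> poly_const c * F \<in> kspan S"
proof (induction rule: kspan.induct)
  case (step f F c')
  have "poly_const c * (poly_const c' * \<Phi> f + F) = poly_const (c * c') * \<Phi> f + poly_const c * F"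
    by (simp add: poly_const_mult algebra_simps)
  with step show ?case by (metis kspan.step)
qed (auto intro: kspan.zero)

lemma kspan_mono: "S \<subseteq> T \<Longrightarrow> F \<in> kspan S \<Longrightarrow> F \<in> kspan T"
  using kspan.induct[of F S "\<lambda>F. F \<in> kspan T"] by (auto intro: kspan.intros)

lemma kspan_mult:
  assumes S: "\<And>f g. f \<in> S \<Longrightarrow> g \<in> S \<Longrightarrow> f * g \<in> S" and "F \<in> kspan S" "H \<in> kspan S"
  shows "F * H \<in> kspan S"
proof -
  have 1: "\<Phi> f * H \<in> kspan S" if "f \<in> S" for f
    using assms(3)
  proof (induction rule: kspan.induct)
    case (step g F c)
    have "\<Phi> f * (poly_const c * \<Phi> g + F) = poly_const c * \<Phi> (f * g) + \<Phi> f * F"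
      by (simp add: \<Phi>_mult algebra_simps)
    then show ?case using step that S by (auto intro: kspan.step)
  qed (auto intro: kspan.zero)
  show ?thesis
    using assms(2)
  proof (induction rule: kspan.induct)
    case (step g F c)
    have "(poly_const c * \<Phi> g + F) * H = poly_const c * (\<Phi> g * H) + F * H"
      by (simp add: algebra_simps)
    then show ?case using step 1 by (auto intro: kspan_add kspan_scale)
  qed (auto intro: kspan.zero)
qed

text \<open>Averaging over the group shows that invariants over the large field are spanned by
  invariants over the small one.\<close>

lemma kspan_inv_polys_le:
  assumes keys: "\<And>m. m \<in> Poly_Mapping.keys F \<Longrightarrow> p dvd wdeg w m" and deg: "total_degree_le d F"
  shows "F \<in> kspan (inv_polys_le G \<rho> d)"
proof -
  \<comment> \<open>\<open>F\<close> back in the original coordinates: its coefficients lie in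
    \<open>K\<close>, but the group acts through matrices over \<open>k\<close>.\<close>
  define F' where "F' = poly_precomp Q F"
  have inv: "poly_precomp (map_matrix \<iota> (\<rho> a)) F' = F'" if a: "a \<in> {0..<int p}" for a
  proof -
    let ?D = "diag_mat (\<lambda>i. \<zeta> ^ (w i * nat a))"
    have "Q ** map_matrix \<iota> (\<rho> a) = Q ** (map_matrix \<iota> (\<rho> a) ** P) ** Q"
      by (simp add: matrix_mul_assoc[symmetric] PQ matrix_mul_rid)
    also have "\<dots> = ?D ** Q"
      by (simp add: diag[OF a] matrix_mul_assoc PQ matrix_mul_lid)
    finally have "poly_precomp (map_matrix \<iota> (\<rho> a)) F' = poly_precomp Q (poly_precomp ?D F)"
      by (simp add: F'_def poly_precomp_precomp)
    also have "poly_precomp ?D F = F"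
    proof (rule poly_mapping_eqI)
      fix m
      show "Poly_Mapping.lookup (poly_precomp ?D F) m = Poly_Mapping.lookup F m"
        using keys[of m] primitive_root_power_eq_1_iff[OF prim, of "wdeg w m"]
        by (cases "m \<in> Poly_Mapping.keys F")
           (auto simp: lookup_poly_precomp_diag_mat wdeg_prod in_keys_iff)
    qed
    finally show ?thesis by (simp add: F'_def)
  qed
  define mon where "mon = (\<lambda>m. Poly_Mapping.single m 1 :: ('n, 'k) polys)"
  \<comment> \<open>The trace of a monomial has coefficients in \<open>k\<close>; this is where
    invariants over \<open>k\<close> are produced.\<close>
  define R where "R = (\<lambda>m. \<Sum>a\<in>{0..<int p}. poly_precomp (\<rho> a) (mon m))"
  let ?c = "\<lambda>m. Poly_Mapping.lookup F' m"
  have deg': "total_degree_le d F'" unfolding F'_def using deg by (rule total_degree_le_poly_precomp)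
  have R: "R m \<in> inv_polys_le G \<rho> d" if "m \<in> Poly_Mapping.keys F'" for m
  proof -
    have "poly_precomp (\<rho> b) (R m) = R m" if b: "b \<in> {0..<int p}" for b
    proof -
      have "poly_precomp (\<rho> b) (R m) = (\<Sum>a\<in>{0..<int p}. poly_precomp (\<rho> ((a + b) mod int p)) (mon m))"
        unfolding R_def poly_precomp_sum poly_precomp_precomp
        using b by (intro sum.cong) (auto simp: rep_mult)
      also have "\<dots> = R m"
        unfolding R_def
      proof (rule sum.reindex_bij_witness[of _ "\<lambda>a. (a - b) mod int p" "\<lambda>a. (a + b) mod int p"])
        fix a assume a: "a \<in> {0..<int p}"
        show "((a + b) mod int p - b) mod int p = a" "((a - b) mod int p + b) mod int p = a"
          using a by (simp_all add: mod_diff_left_eq mod_add_left_eq)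
      qed (use p_gt_1 in auto)
      finally show ?thesis .
    qed
    moreover have "total_degree_le d (R m)"
      unfolding R_def using deg' that
      by (intro total_degree_le_sum total_degree_le_poly_precomp)
         (auto simp: mon_def total_degree_le_iff_mdeg)
    ultimately show ?thesis by (simp add: inv_polys_le_def inv_polys_iff)
  qed
  have F'_sum: "F' = (\<Sum>m\<in>Poly_Mapping.keys F'. poly_const (?c m) * Poly_Mapping.map \<iota> (mon m))"
    by (subst poly_mapping_sum_single) (simp add: mon_def map_single_0 poly_const_def mult_single)
  \<comment> \<open>\<open>F'\<close> equals all its translates, so p times \<open>F'\<close> is the
    sum of the traces of its monomials with coefficients from \<open>K\<close>.\<close>
  have "of_nat p * F' = (\<Sum>a\<in>{0..<int p}. poly_precomp (map_matrix \<iota> (\<rho> a)) F')"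
    by (simp add: inv)
  also have "\<dots> = (\<Sum>a\<in>{0..<int p}. \<Sum>m\<in>Poly_Mapping.keys F'.
      poly_const (?c m) * Poly_Mapping.map \<iota> (poly_precomp (\<rho> a) (mon m)))"
    by (subst F'_sum) (simp add: poly_precomp_sum poly_precomp_mult poly_precomp_map)
  also have "\<dots> = (\<Sum>m\<in>Poly_Mapping.keys F'. poly_const (?c m) * Poly_Mapping.map \<iota> (R m))"
    by (subst sum.swap) (simp add: R_def map_poly_mapping_sum sum_distrib_left)
  finally have "poly_precomp P (of_nat p * F') =
      (\<Sum>m\<in>Poly_Mapping.keys F'. poly_const (?c m) * \<Phi> (R m))"
    by (simp add: poly_precomp_sum poly_precomp_mult \<Phi>_def)
  moreover have "of_nat p = (poly_const (of_nat p) :: ('n, 'K) polys)"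
    by (induction p) (simp_all add: poly_const_add)
  ultimately have "poly_const (of_nat p) * F = (\<Sum>m\<in>Poly_Mapping.keys F'. poly_const (?c m) * \<Phi> (R m))"
    by (simp add: poly_precomp_mult F'_def)
  also have "\<dots> \<in> kspan (inv_polys_le G \<rho> d)"
    by (intro kspan_sum kspan_incl R)
  finally have "poly_const (inverse (of_nat p)) * (poly_const (of_nat p) * F) \<in> kspan (inv_polys_le G \<rho> d)"
    by (rule kspan_scale)
  then show ?thesis
    by (simp add: of_nat_p_nonzero flip: mult.assoc poly_const_mult)
qed

text \<open>A functional \<open>K \<rightarrow> k\<close> applied to the coefficients turns a relation over the large field into
  one over the small field.\<close>

lemma kspan_descent:
  assumes S: "\<And>f c. f \<in> S \<Longrightarrow> poly_const c * f \<in> S" "\<And>f g. f \<in> S \<Longrightarrow> g \<in> S \<Longrightarrow> f + g \<in> S" "0 \<in> S"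
    and F: "F \<in> kspan S" "F \<noteq> 0" "\<Phi> g * F \<in> kspan S"
  obtains a b where "a \<in> S" "b \<in> S" "b \<noteq> 0" "g * b = a"
proof -
  have "poly_precomp Q F \<noteq> 0" using F(2) precomp_QP(2)[of F] by force
  then obtain m where m: "Poly_Mapping.lookup (poly_precomp Q F) m \<noteq> 0"
    by (metis poly_mapping_eqI lookup_zero)
  \<comment> \<open>The functional is chosen not to kill one nonzero coefficient of \<open>F\<close>
    in the original coordinates, which keeps the new denominator \<open>\<Lambda> F\<close>
    nonzero.\<close>
  obtain l where l: "\<And>x y. l (x + y) = l x + l y" "\<And>a x. l (\<iota> a * x) = a * l x"
      "l (Poly_Mapping.lookup (poly_precomp Q F) m) \<noteq> 0"
    using functional_exists[OF \<iota>_simps(2-4) m] by blast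
  have l0: "l 0 = 0" using l(2)[of 0 0] by simp
  define \<Lambda> where "\<Lambda> = (\<lambda>H. Poly_Mapping.map l (poly_precomp Q H) :: ('n, 'k) polys)"
  \<comment> \<open>Linearity over \<open>k[V]\<close> lets the factor \<open>g\<close> be pulled
    out of \<open>\<Lambda> (\<Phi> g * F)\<close>.\<close>
  have \<Lambda>_mult: "\<Lambda> (\<Phi> f * H) = f * \<Lambda> H" for f H
    using map_poly_mapping_mult[where h = l and u = \<iota> and v = "\<lambda>x. x" and f = f and g = "poly_precomp Q H"] l l0
    by (simp add: \<Lambda>_def \<Phi>_def poly_precomp_mult)
  have \<Lambda>_S: "\<Lambda> H \<in> S" if "H \<in> kspan S" for H
    using that
  proof (induction rule: kspan.induct)
    case zero
    then show ?case using S by (simp add: \<Lambda>_def)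
  next
    case (step f H c)
    have "\<Lambda> (poly_const c) = poly_const (l c)"
      unfolding \<Lambda>_def poly_precomp_const using l0 by (simp add: poly_const_def map_single_0)
    moreover have "\<Lambda> (poly_const c * \<Phi> f + H) = f * \<Lambda> (poly_const c) + \<Lambda> H"
      unfolding \<Lambda>_mult[symmetric]
      by (simp add: \<Lambda>_def poly_precomp_add map_poly_mapping_add l l0 mult.commute)
    ultimately show ?case using step S by (simp add: mult.commute)
  qed
  have "Poly_Mapping.lookup (\<Lambda> F) m \<noteq> 0" using l(3) l0 by (simp add: \<Lambda>_def lookup_map_0)
  then have "\<Lambda> F \<noteq> 0" by auto
  then show thesis
    by (rule that[OF \<Lambda>_S[OF F(3)] \<Lambda>_S[OF F(1)] _ \<Lambda>_mult[symmetric]])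
qed

end

section \<open>Field generation in terms of exponent lattices\<close>

context diagonalized_rep
begin

abbreviation low_alg :: "nat \<Rightarrow> ('n, 'k) polys set" where
  "low_alg d \<equiv> alg_adjoin (inv_polys_le G \<rho> d)"

lemma rep_0: "\<rho> 0 = mat 1"
  using is_rep_0[OF rep] p_gt_1 by simp

lemma low_alg_invariant: "f \<in> low_alg d \<Longrightarrow> f \<in> inv_polys G \<rho>"
proof (induction rule: alg_adjoin.induct)
  case (incl f)
  then show ?case by (simp add: inv_polys_le_def)
qed (simp_all add: inv_polys_iff poly_precomp_add poly_precomp_mult)

lemma field_adjoin_le_inv_rats: "field_adjoin (inv_polys_le G \<rho> d) \<subseteq> inv_rats G \<rho>"
proof
  fix q assume "q \<in> field_adjoin (inv_polys_le G \<rho> d)"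
  then obtain a b where ab: "a \<in> low_alg d" "b \<in> low_alg d" "b \<noteq> 0" "q = Fract a b"
    using field_adjoin_cases by blast
  from ab(1,2)[THEN low_alg_invariant] ab(3,4) show "q \<in> inv_rats G \<rho>"
    by (simp add: inv_polys_iff inv_rats_iff rat_precomp_Fract rep_invertible)
qed

text \<open>Multiply numerator and denominator by the remaining translates of the denominator: the
  new denominator is a norm, hence invariant, and so the numerator is invariant as well.\<close>

lemma inv_rat_quotient:
  assumes "q \<in> inv_rats G \<rho>"
  obtains f h where "f \<in> inv_polys G \<rho>" "h \<in> inv_polys G \<rho>" "h \<noteq> 0" "q = Fract f h"
proof -
  obtain f h where q: "q = Fract f h" "h \<noteq> 0" by (cases q) auto
  define H where "H = (\<Prod>a\<in>{0..<int p}. poly_precomp (\<rho> a) h)"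
  define N where "N = (\<Prod>a\<in>{0..<int p} - {0}. poly_precomp (\<rho> a) h)"
  have "H = poly_precomp (\<rho> 0) h * N"
    unfolding H_def N_def using p_gt_1 by (intro prod.remove) auto
  then have HN: "H = h * N" by (simp add: rep_0 poly_precomp_mat_1)
  have H0: "H \<noteq> 0" using q(2) by (simp add: H_def poly_precomp_nonzero rep_invertible)
  have H: "poly_precomp (\<rho> b) H = H" if b: "b \<in> {0..<int p}" for b
  proof -
    have "poly_precomp (\<rho> b) H = (\<Prod>a\<in>{0..<int p}. poly_precomp (\<rho> ((a + b) mod int p)) h)"
      unfolding H_def poly_precomp_prod poly_precomp_precomp
      using b by (intro prod.cong) (auto simp: rep_mult)
    also have "\<dots> = H"
      unfolding H_def
    proof (rule prod.reindex_bij_witness[of _ "\<lambda>a. (a - b) mod int p" "\<lambda>a. (a + b) mod int p"])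
      fix a assume a: "a \<in> {0..<int p}"
      show "((a + b) mod int p - b) mod int p = a" "((a - b) mod int p + b) mod int p = a"
        using a by (simp_all add: mod_diff_left_eq mod_add_left_eq)
    qed (use p_gt_1 in auto)
    finally show ?thesis .
  qed
  have qF: "q = Fract (f * N) H" using q H0 by (simp add: HN eq_fract)
  have "poly_precomp (\<rho> b) (f * N) = f * N" if b: "b \<in> {0..<int p}" for b
  proof -
    have "Fract (poly_precomp (\<rho> b) (f * N)) H = Fract (f * N) H"
      using assms b qF rat_precomp_Fract[OF rep_invertible[OF b] H0, of "f * N"] H[OF b]
      by (simp add: inv_rats_iff)
    then show ?thesis using H0 by (simp add: eq_fract)
  qed
  then show thesis using that[of "f * N" H] H H0 qF by (simp add: inv_polys_iff)
qed

text \<open>A low invariant monomial in eigencoordinates need not come from \<open>k\<close>, but it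
  lies in the \<open>K\<close>-span of low invariants over \<open>k\<close>; products stay in the
  span of the algebra they generate.\<close>

lemma low_monoid_kspan:
  assumes "m \<in> low_monoid p w d"
  shows "Poly_Mapping.single m 1 \<in> kspan (low_alg d)"
  using assms
proof induction
  case zero
  have "poly_const 1 * \<Phi> 1 \<in> kspan (low_alg d)" by (intro kspan_incl alg_adjoin_1)
  then show ?case by simp
next
  case (add m n)
  have "Poly_Mapping.single m 1 \<in> kspan (inv_polys_le G \<rho> d)"
    using add.hyps by (intro kspan_inv_polys_le) (auto simp: total_degree_le_iff_mdeg)
  then have "Poly_Mapping.single m 1 \<in> kspan (low_alg d)"
    by (rule kspan_mono[rotated]) (auto intro: alg_adjoin.incl)
  then have "Poly_Mapping.single m 1 * Poly_Mapping.single n 1 \<in> kspan (low_alg d)"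
    using add.IH by (intro kspan_mult alg_adjoin.mult)
  then show ?case by (simp add: mult_single)
qed

text \<open>The product of the individual denominators x^m1 clears all monomials of \<open>M\<close>
  at once.\<close>

lemma common_monomial_denominator:
  assumes gen: "\<And>m. p dvd wdeg w m \<Longrightarrow> \<exists>m1\<in>low_monoid p w d. \<exists>m2\<in>low_monoid p w d. m + m1 = m2"
    and "finite M" "\<And>m. m \<in> M \<Longrightarrow> p dvd wdeg w m"
  shows "\<exists>H\<in>kspan (low_alg d). H \<noteq> 0 \<and> (\<forall>m\<in>M. Poly_Mapping.single m 1 * H \<in> kspan (low_alg d))"
  using assms(2,3)
proof (induction M)
  case empty
  have "poly_const 1 * \<Phi> 1 \<in> kspan (low_alg d)" by (intro kspan_incl alg_adjoin_1)
  then show ?case by (intro bexI[of _ 1]) auto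
next
  case (insert m M)
  then obtain H where H: "H \<in> kspan (low_alg d)" "H \<noteq> 0"
    "\<forall>m\<in>M. Poly_Mapping.single m 1 * H \<in> kspan (low_alg d)" by auto
  obtain m1 m2 where m12: "m1 \<in> low_monoid p w d" "m2 \<in> low_monoid p w d" "m + m1 = m2"
    using gen[of m] insert.prems by blast
  let ?S1 = "Poly_Mapping.single m1 1 :: ('n, 'K) polys"
  have S1: "?S1 \<in> kspan (low_alg d)" "Poly_Mapping.single m2 1 \<in> kspan (low_alg d)"
    using m12 low_monoid_kspan by auto
  have 0: "?S1 \<noteq> 0" by (metis lookup_single_eq lookup_zero one_neq_zero)
  have mult: "F * F' \<in> kspan (low_alg d)" if "F \<in> kspan (low_alg d)" "F' \<in> kspan (low_alg d)" for F F'
    by (rule kspan_mult[OF alg_adjoin.mult that])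
  show ?case
  proof (intro bexI[of _ "?S1 * H"] conjI ballI)
    show "?S1 * H \<noteq> 0" using 0 H(2) by simp
    show "?S1 * H \<in> kspan (low_alg d)" using S1 H by (intro mult)
    fix l assume l: "l \<in> insert m M"
    show "Poly_Mapping.single l 1 * (?S1 * H) \<in> kspan (low_alg d)"
    proof (cases "l = m")
      case True
      have eq: "Poly_Mapping.single l 1 * (?S1 * H) = Poly_Mapping.single m2 1 * H"
        using m12(3) True by (simp add: mult_single flip: mult.assoc)
      show ?thesis unfolding eq by (rule mult[OF S1(2) H(1)])
    next
      case False
      then have "?S1 * (Poly_Mapping.single l 1 * H) \<in> kspan (low_alg d)"
        using l H(3) by (intro mult[OF S1(1)]) auto
      then show ?thesis by (simp add: mult_ac)
    qed
  qed
qed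

text \<open>Over \<open>K\<close> both \<open>H\<close> and \<open>\<Phi> g * H\<close> lie in the
  span of the low algebra; \<open>kspan_descent\<close> replaces \<open>H\<close> by a denominator
  over \<open>k\<close>.\<close>

lemma inv_poly_fraction:
  assumes gen: "\<And>m. p dvd wdeg w m \<Longrightarrow> \<exists>m1\<in>low_monoid p w d. \<exists>m2\<in>low_monoid p w d. m + m1 = m2"
    and g: "g \<in> inv_polys G \<rho>"
  shows "\<exists>a\<in>low_alg d. \<exists>b\<in>low_alg d. b \<noteq> 0 \<and> g * b = a"
proof -
  obtain H where H: "H \<in> kspan (low_alg d)" "H \<noteq> 0"
    "\<forall>m\<in>Poly_Mapping.keys (\<Phi> g). Poly_Mapping.single m 1 * H \<in> kspan (low_alg d)"
    using common_monomial_denominator[OF gen, of "Poly_Mapping.keys (\<Phi> g)"] keys_\<Phi>_inv_polys[OF g] by auto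
  have "\<Phi> g = (\<Sum>m\<in>Poly_Mapping.keys (\<Phi> g). Poly_Mapping.single m (Poly_Mapping.lookup (\<Phi> g) m))"
    by (rule poly_mapping_sum_single)
  also have "\<dots> = (\<Sum>m\<in>Poly_Mapping.keys (\<Phi> g). poly_const (Poly_Mapping.lookup (\<Phi> g) m) * Poly_Mapping.single m 1)"
    by (simp add: poly_const_def mult_single)
  finally have "\<Phi> g * H = (\<Sum>m\<in>Poly_Mapping.keys (\<Phi> g).
      poly_const (Poly_Mapping.lookup (\<Phi> g) m) * (Poly_Mapping.single m 1 * H))"
    by (metis (no_types, lifting) mult.assoc sum.cong sum_distrib_right)
  also have "\<dots> \<in> kspan (low_alg d)"
    using H(3) by (intro kspan_sum kspan_scale) auto
  finally have gH: "\<Phi> g * H \<in> kspan (low_alg d)" .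
  show ?thesis
  proof (rule kspan_descent[OF _ _ alg_adjoin_0 H(1,2) gH])
    show "poly_const c * f \<in> low_alg d" if "f \<in> low_alg d" for f c
      by (intro alg_adjoin.mult alg_adjoin.const that)
    show "f + h \<in> low_alg d" if "f \<in> low_alg d" "h \<in> low_alg d" for f h
      by (intro alg_adjoin.add that)
    show ?thesis if "a \<in> low_alg d" "b \<in> low_alg d" "b \<noteq> 0" "g * b = a" for a b
      using that by blast
  qed
qed

theorem field_adjoin_eq_inv_rats:
  assumes gen: "\<And>m. p dvd wdeg w m \<Longrightarrow> \<exists>m1\<in>low_monoid p w d. \<exists>m2\<in>low_monoid p w d. m + m1 = m2"
  shows "field_adjoin (inv_polys_le G \<rho> d) = inv_rats G \<rho>"
proof (rule antisym[OF field_adjoin_le_inv_rats], rule subsetI)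
  fix q assume "q \<in> inv_rats G \<rho>"
  then obtain f h where fh: "f \<in> inv_polys G \<rho>" "h \<in> inv_polys G \<rho>" "h \<noteq> 0" "q = Fract f h"
    by (rule inv_rat_quotient)
  obtain a b where a: "a \<in> low_alg d" "b \<in> low_alg d" "b \<noteq> 0" "f * b = a"
    using inv_poly_fraction[OF gen fh(1)] by blast
  obtain a' b' where a': "a' \<in> low_alg d" "b' \<in> low_alg d" "b' \<noteq> 0" "h * b' = a'"
    using inv_poly_fraction[OF gen fh(2)] by blast
  have nz: "a' \<noteq> 0" using a' fh(3) by auto
  have "q = Fract (a * b') (b * a')"
    using a a' fh nz by (simp add: eq_fract mult_ac)
  moreover have "Fract (a * b') (b * a') \<in> field_adjoin (inv_polys_le G \<rho> d)"
    using a a' nz by (intro field_adjoin_Fract alg_adjoin.mult) auto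
  ultimately show "q \<in> field_adjoin (inv_polys_le G \<rho> d)" by simp
qed

text \<open>A weight vanishing on the exponents of the low invariants gives a torus fixing them; since the
  orbit of a suitable invariant under the powers of \<open>T\<close> is infinite, it is not algebraic.\<close>

theorem infinite_dimension_inv_rats:
  fixes T :: 'K
  assumes T: "T \<noteq> 0" "\<And>z. T powi z = 1 \<Longrightarrow> z = 0"
    and \<alpha>: "\<alpha> i0 \<noteq> 0" "\<And>m. p dvd wdeg w m \<Longrightarrow> mdeg m \<le> d \<Longrightarrow>
      (\<Sum>i\<in>UNIV. \<alpha> i * int (Poly_Mapping.lookup m i)) = 0"
  shows "\<not> ring.finite_dimension ring_of_type_algebra (field_adjoin (inv_polys_le G \<rho> d)) (inv_rats G \<rho>)"
proof
  assume fin: "ring.finite_dimension ring_of_type_algebra (field_adjoin (inv_polys_le G \<rho> d)) (inv_rats G \<rho>)"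
  \<comment> \<open>\<open>\<sigma> j\<close> is the action of T^j through the one-parameter torus
    with weights \<open>\<alpha>\<close>.\<close>
  define \<sigma> where "\<sigma> = (\<lambda>(j::nat) (F :: ('n, 'K) polys).
    poly_subst (\<lambda>i. poly_const (T powi (int j * \<alpha> i)) * poly_coord i) F)"
  define wt where "wt = (\<lambda>m. \<Sum>i\<in>UNIV. \<alpha> i * int (Poly_Mapping.lookup m i))"
  have powi_sum: "(\<Prod>i\<in>I. T powi h i) = T powi (\<Sum>i\<in>I. h i)" for h and I :: "'n set"
    by (induction I rule: infinite_finite_induct) (use T(1) in \<open>auto simp: power_int_add\<close>)
  have lookup_\<sigma>: "Poly_Mapping.lookup (\<sigma> j F) m = Poly_Mapping.lookup F m * T powi (int j * wt m)" for j F m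
  proof -
    have "(\<Prod>i\<in>UNIV. (T powi (int j * \<alpha> i)) ^ Poly_Mapping.lookup m i) =
        (\<Prod>i\<in>UNIV. T powi (int j * (\<alpha> i * int (Poly_Mapping.lookup m i))))"
      by (intro prod.cong) (simp_all add: power_int_mult flip: mult.assoc)
    then show ?thesis
      by (simp add: \<sigma>_def lookup_poly_subst_scale powi_sum wt_def sum_distrib_left)
  qed
  have \<sigma>_add: "\<sigma> j (F + H) = \<sigma> j F + \<sigma> j H" and \<sigma>_mult: "\<sigma> j (F * H) = \<sigma> j F * \<sigma> j H"
    and \<sigma>_const: "\<sigma> j (poly_const c) = poly_const c" and \<sigma>_0: "\<sigma> j 0 = 0" for j F H c
    by (simp_all add: \<sigma>_def poly_subst_add poly_subst_mult)
  have \<sigma>_power: "\<sigma> j (F ^ n) = \<sigma> j F ^ n" for j F n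
    by (simp add: \<sigma>_def poly_subst_power)
  have \<sigma>_sum: "\<sigma> j (\<Sum>i\<in>I. F i) = (\<Sum>i\<in>I. \<sigma> j (F i))" for j F and I :: "nat set"
    by (simp add: \<sigma>_def poly_subst_sum)
  have \<sigma>_low: "\<sigma> j (\<Phi> f) = \<Phi> f" if "f \<in> low_alg d" for j f
    using that
  proof induction
    case (incl f)
    show ?case
    proof (rule poly_mapping_eqI)
      fix m
      have "wt m = 0" if "m \<in> Poly_Mapping.keys (\<Phi> f)"
        using that incl \<alpha>(2)[of m] keys_\<Phi>_inv_polys[of f m] total_degree_\<Phi>[of d f]
        by (auto simp: inv_polys_le_def wt_def total_degree_le_iff_mdeg)
      then show "Poly_Mapping.lookup (\<sigma> j (\<Phi> f)) m = Poly_Mapping.lookup (\<Phi> f) m"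
        by (cases "m \<in> Poly_Mapping.keys (\<Phi> f)") (auto simp: lookup_\<sigma> in_keys_iff)
    qed
  qed (simp_all add: \<Phi>_const \<Phi>_add \<Phi>_mult \<sigma>_const \<sigma>_add \<sigma>_mult)
  \<comment> \<open>The p-th power of an eigencoordinate is always invariant, and its weight, p
    times \<open>\<alpha> i0\<close>, is nonzero.\<close>
  define m0 where "m0 = Poly_Mapping.single i0 p"
  have wt0: "wt m0 \<noteq> 0"
  proof -
    have "wt m0 = (\<Sum>i\<in>UNIV. if i = i0 then \<alpha> i * int p else 0)"
      unfolding wt_def m0_def by (intro sum.cong) (auto simp: lookup_single when_def)
    then show ?thesis using \<alpha>(1) p_gt_1 by simp
  qed
  \<comment> \<open>The monomial \<open>m0\<close> itself lives over \<open>K\<close>. It lies in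
    the span of the images of invariants over \<open>k\<close>, so one of these must involve
    it.\<close>
  have "\<exists>g\<in>inv_polys G \<rho>. Poly_Mapping.lookup (\<Phi> g) m0 \<noteq> 0"
  proof (rule ccontr)
    assume neg: "\<not> ?thesis"
    have "Poly_Mapping.lookup F m0 = 0" if "F \<in> kspan (inv_polys_le G \<rho> p)" for F
      using that
    proof (induction rule: kspan.induct)
      case (step f F c)
      have "Poly_Mapping.lookup (poly_const c * \<Phi> f) m0 = c * Poly_Mapping.lookup (\<Phi> f) m0"
        by (rule poly_mapping_additive_eqI[where f = "\<Phi> f"
            and F = "\<lambda>f. Poly_Mapping.lookup (poly_const c * f) m0" and G = "\<lambda>f. c * Poly_Mapping.lookup f m0"])
           (simp_all add: poly_const_def mult_single lookup_single when_def distrib_left lookup_add)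
      then show ?case using step neg by (auto simp: lookup_add inv_polys_le_def)
    qed simp
    moreover have "Poly_Mapping.single m0 1 \<in> kspan (inv_polys_le G \<rho> p)"
      by (rule kspan_inv_polys_le) (auto simp: total_degree_le_iff_mdeg m0_def)
    ultimately show False by (metis lookup_single_eq one_neq_zero)
  qed
  then obtain g where g: "g \<in> inv_polys G \<rho>" "Poly_Mapping.lookup (\<Phi> g) m0 \<noteq> 0" by blast
  \<comment> \<open>The coefficient at \<open>m0\<close> is scaled by T^(j * wt m0), which takes
    distinct values for distinct j.\<close>
  have inj: "inj (\<lambda>j. \<sigma> j (\<Phi> g))"
  proof (rule injI)
    fix j j' assume "\<sigma> j (\<Phi> g) = \<sigma> j' (\<Phi> g)"
    then have "T powi (int j * wt m0) = T powi (int j' * wt m0)"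
      using lookup_\<sigma>[of j "\<Phi> g" m0] lookup_\<sigma>[of j' "\<Phi> g" m0] g(2) by simp
    then have "T powi (int j * wt m0 - int j' * wt m0) = 1"
      using T(1) by (simp add: power_int_diff)
    then have "(int j - int j') * wt m0 = 0"
      using T(2) by (metis left_diff_distrib)
    then show "j = j'" using wt0 by simp
  qed
  have gpow: "Fract (g ^ i) 1 \<in> inv_rats G \<rho>" for i
  proof -
    have "poly_precomp A (g ^ i) = poly_precomp A g ^ i" for A
      by (simp add: poly_precomp_def poly_subst_power)
    moreover have "poly_precomp (\<rho> a) 1 = 1" for a
      using poly_precomp_const[of "\<rho> a" 1] by simp
    ultimately show ?thesis using g(1)
      by (simp add: inv_rats_iff inv_polys_iff rat_precomp_Fract rep_invertible)
  qed
  obtain N a where a: "\<And>i. i < N \<Longrightarrow> a i \<in> low_alg d" "\<exists>i<N. a i \<noteq> 0" "(\<Sum>i<N. a i * g ^ i) = 0"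
    by (rule finite_dimension_imp_algebraic[OF fin gpow]) blast
  \<comment> \<open>The coefficients \<open>\<Phi> (a i)\<close> are fixed by the torus, so every
    translate of the root \<open>\<Phi> g\<close> is again a root of \<open>q\<close>.\<close>
  define q where "q = (\<Sum>i<N. monom (\<Phi> (a i)) i)"
  have "poly q (\<sigma> j (\<Phi> g)) = 0" for j
  proof -
    have "poly q (\<sigma> j (\<Phi> g)) = (\<Sum>i<N. \<sigma> j (\<Phi> (a i)) * \<sigma> j (\<Phi> g) ^ i)"
      unfolding q_def poly_sum poly_monom using \<sigma>_low a(1) by (intro sum.cong) auto
    also have "\<dots> = \<sigma> j (\<Phi> (\<Sum>i<N. a i * g ^ i))"
      by (simp add: \<Phi>_sum \<Phi>_mult \<Phi>_power \<sigma>_sum \<sigma>_mult \<sigma>_power)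
    finally show ?thesis by (simp add: a(3) \<sigma>_0)
  qed
  then have "range (\<lambda>j. \<sigma> j (\<Phi> g)) \<subseteq> {x. poly q x = 0}" by auto
  moreover have "infinite (range (\<lambda>j. \<sigma> j (\<Phi> g)))"
    using inj by (simp add: finite_image_iff)
  moreover have "q \<noteq> 0"
  proof -
    obtain i where i: "i < N" "a i \<noteq> 0" using a(2) by blast
    then have "coeff q i = \<Phi> (a i)"
      by (simp add: q_def coeff_sum)
    then show ?thesis using i(2) \<Phi>_eq_0 by force
  qed
  ultimately show False using poly_roots_finite[of q] finite_subset by blast
qed

end

section \<open>Diagonalization and characters\<close>

lemma primitive_root_nonzero: "is_primitive_root p \<zeta> \<Longrightarrow> \<zeta> \<noteq> 0"
  by (auto simp: is_primitive_root_def power_0_left split: if_splits)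

lemma primitive_root_powi_eq_1_iff:
  assumes "is_primitive_root p (\<zeta>::'K::field)"
  shows "\<zeta> powi x = 1 \<longleftrightarrow> int p dvd x"
  using primitive_root_power_eq_1_iff[OF assms]
  by (cases x rule: int_cases2) (auto simp: power_int_minus)

lemma primitive_root_powi_eq_iff:
  assumes "is_primitive_root p (\<zeta>::'K::field)"
  shows "\<zeta> powi x = \<zeta> powi y \<longleftrightarrow> int p dvd x - y"
  using primitive_root_powi_eq_1_iff[OF assms, of "x - y"] primitive_root_nonzero[OF assms]
  by (simp add: power_int_diff)

lemma sum_primitive_root_powi:
  assumes "is_primitive_root p (\<zeta>::'K::field)"
  shows "(\<Sum>j<p. \<zeta> powi (int j * x)) = (if int p dvd x then of_nat p else 0)"
proof -
  have "(\<Sum>j<p. \<zeta> powi (int j * x)) = (\<Sum>j<p. (\<zeta> powi x) ^ j)"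
    by (intro sum.cong) (simp_all add: power_int_mult mult.commute)
  also have "\<dots> = (if int p dvd x then of_nat p else 0)"
  proof (cases "int p dvd x")
    case False
    then have "\<zeta> powi x \<noteq> 1" using primitive_root_powi_eq_1_iff[OF assms] by simp
    moreover have "(\<zeta> powi x) ^ p = 1"
      using primitive_root_powi_eq_1_iff[OF assms, of "x * int p"] by (simp add: power_int_mult)
    ultimately show ?thesis using False by (simp add: sum_gp_strict)
  next
    case True
    then have "\<zeta> powi x = 1" using primitive_root_powi_eq_1_iff[OF assms] by simp
    then show ?thesis using True by simp
  qed
  finally show ?thesis .
qed

text \<open>The vectors \<open>e j v\<close> are p times the projections of \<open>v\<close> to the
  eigenspaces. They sum to p times \<open>v\<close>, and p is invertible in \<open>K\<close>, so
  eigenvectors span the space.\<close>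

lemma cyclic_rep_diagonalizable:
  fixes \<sigma> :: "int \<Rightarrow> 'K::field^'n^'n"
  assumes prim: "is_primitive_root p \<zeta>" and p: "of_nat p \<noteq> (0::'K)"
    and mult: "\<And>a b. a \<in> {0..<int p} \<Longrightarrow> b \<in> {0..<int p} \<Longrightarrow> \<sigma> a ** \<sigma> b = \<sigma> ((a + b) mod int p)"
    and one: "\<sigma> 0 = mat 1"
  shows "\<exists>P Q :: 'K^'n^'n. \<exists>w. P ** Q = mat 1 \<and> Q ** P = mat 1 \<and> (\<forall>i. w i < p) \<and>
    (\<forall>a\<in>{0..<int p}. \<sigma> a ** P = P ** diag_mat (\<lambda>i. \<zeta> ^ (w i * nat a)))"
proof -
  have p0: "p > 0" using prim by (simp add: is_primitive_root_def)
  note nz = primitive_root_nonzero[OF prim]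
  define E where "E = {v. \<exists>j<p. \<forall>a\<in>{0..<int p}. \<sigma> a *v v = \<zeta> ^ (j * nat a) *s v}"
  define e where "e = (\<lambda>j v. \<Sum>a\<in>{0..<int p}. \<zeta> powi (- (int j * a)) *s (\<sigma> a *v v))"
  have e_E: "e j v \<in> E" if j: "j < p" for j v
  proof -
    have "\<sigma> b *v e j v = \<zeta> ^ (j * nat b) *s e j v" if b: "b \<in> {0..<int p}" for b
    proof -
      have "\<sigma> b *v e j v = (\<Sum>a\<in>{0..<int p}. \<zeta> powi (- (int j * a)) *s (\<sigma> ((a + b) mod int p) *v v))"
        unfolding e_def vec.linear_sum[OF matrix_vector_mul_linear_gen] using b
        by (intro sum.cong) (simp_all add: vec.scale matrix_vector_mul_assoc mult add.commute)
      also have "\<dots> = (\<Sum>c\<in>{0..<int p}. \<zeta> powi (int j * b) *s (\<zeta> powi (- (int j * c)) *s (\<sigma> c *v v)))"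
      proof (rule sum.reindex_bij_witness[of _ "\<lambda>a. (a - b) mod int p" "\<lambda>a. (a + b) mod int p"])
        fix a assume a: "a \<in> {0..<int p}"
        show "((a + b) mod int p - b) mod int p = a" "((a - b) mod int p + b) mod int p = a"
          using a by (simp_all add: mod_diff_left_eq mod_add_left_eq)
        define r where "r = (a + b) mod int p"
        have "int p dvd (a + b) - r" by (simp add: r_def)
        then have "int p dvd int j * ((a + b) - r)" by simp
        also have "int j * ((a + b) - r) = (int j * b - int j * r) - (- (int j * a))"
          by (simp add: algebra_simps)
        finally have "\<zeta> powi (int j * b - int j * r) = \<zeta> powi (- (int j * a))"
          using primitive_root_powi_eq_iff[OF prim] by blast
        moreover have "\<zeta> powi (int j * b - int j * r) = \<zeta> powi (int j * b) * \<zeta> powi (- (int j * r))"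
          using nz by (simp flip: power_int_add)
        ultimately show "\<zeta> powi (int j * b) *s (\<zeta> powi (- (int j * r)) *s (\<sigma> r *v v)) =
            \<zeta> powi (- (int j * a)) *s (\<sigma> r *v v)"
          by simp
      qed (use p0 in auto)
      also have "\<dots> = \<zeta> powi (int j * b) *s e j v"
        by (simp add: e_def vec.scale_sum_right)
      also have "\<zeta> powi (int j * b) = \<zeta> ^ (j * nat b)"
        using b by (simp add: power_int_def nat_mult_distrib)
      finally show ?thesis .
    qed
    then show ?thesis using j by (auto simp: E_def)
  qed
  have "v \<in> vec.span E" for v
  proof -
    \<comment> \<open>By orthogonality of the characters only the term a = 0 survives.\<close>
    have "(\<Sum>j<p. e j v) = (\<Sum>a\<in>{0..<int p}. (\<Sum>j<p. \<zeta> powi (int j * (- a))) *s (\<sigma> a *v v))"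
      unfolding e_def by (subst sum.swap) (simp add: vec.scale_sum_left)
    also have "\<dots> = (\<Sum>a\<in>{0..<int p}. if a = 0 then of_nat p *s v else 0)"
    proof (intro sum.cong refl)
      fix a assume a: "a \<in> {0..<int p}"
      then have "int p dvd - a \<longleftrightarrow> a = 0" using zdvd_imp_le[of "int p" a] by (cases "a = 0") force+
      then show "(\<Sum>j<p. \<zeta> powi (int j * (- a))) *s (\<sigma> a *v v) = (if a = 0 then of_nat p *s v else 0)"
        unfolding sum_primitive_root_powi[OF prim] by (simp add: one)
    qed
    also have "\<dots> = of_nat p *s v" using p0 by simp
    finally have "v = inverse (of_nat p) *s (\<Sum>j<p. e j v)" using p by simp
    also have "\<dots> \<in> vec.span E"
      by (intro vec.span_scale vec.span_sum vec.span_base e_E) auto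
    finally show ?thesis .
  qed
  then have spanE: "vec.span E = UNIV" by auto
  \<comment> \<open>A basis chosen among the eigenvectors; its members become the columns of
    \<open>P\<close>.\<close>
  obtain B where B: "B \<subseteq> E" "vec.independent B" "E \<subseteq> vec.span B"
    using vec.maximal_independent_subset[of E] by blast
  have spanB: "vec.span B = UNIV" using vec.span_mono[OF B(3)] spanE by (auto simp: vec.span_span)
  have "card B = CARD('n)"
    using vec.basis_card_eq_dim[of B UNIV] B(2) spanB by (simp add: vec.dim_UNIV vec.dimension_def card_cart_basis)
  moreover have "finite B" using vec.finiteI_independent[OF B(2)] .
  ultimately obtain h where h: "bij_betw h (UNIV :: 'n set) B"
    using finite_same_card_bij[of "UNIV :: 'n set" B] by auto
  define P :: "'K^'n^'n" where "P = (\<chi> i j. h j $ i)"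
  have "column j P = h j" for j by (simp add: column_def P_def)
  then have "columns P = B" using h by (auto simp: columns_def bij_betw_def)
  then obtain Q where Q: "P ** Q = mat 1"
    using matrix_right_invertible_span_columns[of P] spanB by auto
  then have Q': "Q ** P = mat 1" using matrix_left_right_inverse by blast
  have "\<forall>i. \<exists>j<p. \<forall>a\<in>{0..<int p}. \<sigma> a *v h i = \<zeta> ^ (j * nat a) *s h i"
    using h B(1) by (auto simp: bij_betw_def E_def)
  then obtain w where w: "\<And>i. w i < p" "\<And>i a. a \<in> {0..<int p} \<Longrightarrow> \<sigma> a *v h i = \<zeta> ^ (w i * nat a) *s h i"
    by metis
  have "\<sigma> a ** P = P ** diag_mat (\<lambda>i. \<zeta> ^ (w i * nat a))" if a: "a \<in> {0..<int p}" for a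
  proof -
    have "(\<sigma> a ** P) $ i $ j = (P ** diag_mat (\<lambda>i. \<zeta> ^ (w i * nat a))) $ i $ j" for i j
    proof -
      have "(\<sigma> a ** P) $ i $ j = (\<sigma> a *v h j) $ i"
        by (simp add: matrix_matrix_mult_def matrix_vector_mult_def P_def)
      also have "\<dots> = P $ i $ j * \<zeta> ^ (w j * nat a)" by (simp add: w(2)[OF a] P_def)
      also have "\<dots> = (P ** diag_mat (\<lambda>i. \<zeta> ^ (w i * nat a))) $ i $ j"
        by (simp add: matrix_matrix_mult_def diag_mat_def if_distrib cong: if_cong)
      finally show ?thesis .
    qed
    then show ?thesis by (simp add: vec_eq_iff)
  qed
  then show ?thesis using Q Q' w(1) by blast
qed

lemma int_char_eq_iff:
  assumes prim: "is_primitive_root p (\<zeta>::'K::field)" and p: "p > 1"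
  shows "int_char p \<zeta> A = int_char p \<zeta> B \<longleftrightarrow> int p dvd A - B"
proof
  assume "int_char p \<zeta> A = int_char p \<zeta> B"
  then have "int_char p \<zeta> A 1 = int_char p \<zeta> B 1" by simp
  then show "int p dvd A - B"
    using p primitive_root_powi_eq_iff[OF prim, of A B] by (simp add: int_char_def)
next
  assume "int p dvd A - B"
  then have "int p dvd A * a - B * a" for a by (simp flip: left_diff_distrib)
  then show "int_char p \<zeta> A = int_char p \<zeta> B"
    using primitive_root_powi_eq_iff[OF prim] by (auto simp: int_char_def fun_eq_iff)
qed

lemma int_char_0: "int_char p \<zeta> 0 = (\<lambda>g\<in>carrier (integer_mod_group p). 1)"
  by (simp add: int_char_def)

lemma int_char_in_characters:
  assumes prim: "is_primitive_root p (\<zeta>::'K::field)"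
  shows "int_char p \<zeta> A \<in> characters (integer_mod_group p)"
proof -
  interpret field "ring_of_type_algebra :: 'K ring" by (rule field_from_type_algebra)
  note nz = primitive_root_nonzero[OF prim]
  have U: "x \<in> Units (ring_of_type_algebra :: 'K ring)" if "x \<noteq> 0" for x
    using field_Units that by simp
  have "\<zeta> powi (A * ((x + y) mod int p)) = \<zeta> powi (A * x) * \<zeta> powi (A * y)" for x y
  proof -
    have "int p dvd A * ((x + y) mod int p - (x + y))"
      by (metis dvd_minus_mod dvd_mult dvd_diff_commute)
    then have "int p dvd A * ((x + y) mod int p) - (A * x + A * y)" by (simp add: algebra_simps)
    then show ?thesis using primitive_root_powi_eq_iff[OF prim] nz by (simp flip: power_int_add)
  qed
  moreover have "(x + y) mod int p \<in> carrier (integer_mod_group p)"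
    if "x \<in> carrier (integer_mod_group p)" "y \<in> carrier (integer_mod_group p)" for x y
    using group.subgroup_self[of "integer_mod_group p"] monoid.m_closed[OF group.is_monoid[OF group_integer_mod_group] that]
    by simp
  ultimately show ?thesis
    using nz by (auto simp: characters_def hom_def int_char_def units_of_def intro!: U)
qed

text \<open>A nonzero coordinate of an eigenvector with respect to the columns of \<open>P\<close>
  determines its character; conversely each column is itself an eigenvector.\<close>

lemma char_occurs_diagonal:
  fixes \<sigma> :: "int \<Rightarrow> 'K::field^'n^'n" and P Q :: "'K^'n^'n"
  assumes prim: "is_primitive_root p \<zeta>" and PQ: "P ** Q = mat 1" "Q ** P = mat 1"
    and diag: "\<And>a. a \<in> {0..<int p} \<Longrightarrow> \<sigma> a ** P = P ** diag_mat (\<lambda>i. \<zeta> ^ (w i * nat a))"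
  shows "char_occurs (integer_mod_group p) \<sigma> \<psi> \<longleftrightarrow> (\<exists>i. \<psi> = int_char p \<zeta> (int (w i)))"
proof -
  have p0: "p > 0" using prim by (simp add: is_primitive_root_def)
  have car: "carrier (integer_mod_group p) = {0..<int p}"
    using p0 by (simp add: carrier_integer_mod_group)
  have pw: "\<zeta> powi (int n * a) = \<zeta> ^ (n * nat a)" if "a \<in> {0..<int p}" for n a
    using that by (simp add: power_int_def nat_mult_distrib)
  have diag_v: "(diag_mat c *v u) $ i = (c i) * (u $ i)" for c :: "'n \<Rightarrow> 'K" and u i
    by (simp add: matrix_vector_mult_def diag_mat_def if_distrib[of "\<lambda>x. x * _"] cong: if_cong)
  show ?thesis
  proof
    assume "char_occurs (integer_mod_group p) \<sigma> \<psi>"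
    then obtain v where \<psi>: "\<psi> \<in> characters (integer_mod_group p)" and v: "v \<noteq> 0"
      "\<And>a. a \<in> {0..<int p} \<Longrightarrow> \<sigma> a *v v = \<psi> a *s v"
      by (auto simp: char_occurs_def car)
    define u where "u = Q *v v"
    have Pu: "P *v u = v" by (simp add: u_def matrix_vector_mul_assoc PQ)
    then have "u \<noteq> 0" using v(1) by (metis matrix_vector_mult_0_right)
    then obtain i where i: "u $ i \<noteq> 0" by (metis vec_eq_iff zero_index)
    have "\<psi> a = \<zeta> ^ (w i * nat a)" if a: "a \<in> {0..<int p}" for a
    proof -
      have "P *v (diag_mat (\<lambda>i. \<zeta> ^ (w i * nat a)) *v u) = \<psi> a *s (P *v u)"
        using v(2)[OF a] by (simp add: Pu[symmetric] matrix_vector_mul_assoc diag[OF a])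
      also have "\<dots> = P *v (\<psi> a *s u)" by (simp add: vec.scale)
      finally have "Q *v (P *v (diag_mat (\<lambda>i. \<zeta> ^ (w i * nat a)) *v u)) = Q *v (P *v (\<psi> a *s u))"
        by (rule arg_cong)
      then have "diag_mat (\<lambda>i. \<zeta> ^ (w i * nat a)) *v u = \<psi> a *s u"
        by (simp add: matrix_vector_mul_assoc matrix_mul_assoc PQ matrix_mul_lid)
      then have "(diag_mat (\<lambda>i. \<zeta> ^ (w i * nat a)) *v u) $ i = (\<psi> a *s u) $ i"
        by simp
      then have "(\<zeta> ^ (w i * nat a)) * (u $ i) = (\<psi> a) * (u $ i)"
        by (simp only: diag_v vector_smult_component)
      then show ?thesis using i by simp
    qed
    moreover have "\<psi> a = undefined" if "a \<notin> {0..<int p}" for a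
      using \<psi> that by (auto simp: characters_def car extensional_def)
    ultimately have "\<psi> = int_char p \<zeta> (int (w i))"
      by (intro ext) (auto simp: int_char_def car pw)
    then show "\<exists>i. \<psi> = int_char p \<zeta> (int (w i))" by blast
  next
    assume "\<exists>i. \<psi> = int_char p \<zeta> (int (w i))"
    then obtain i where \<psi>: "\<psi> = int_char p \<zeta> (int (w i))" by blast
    define u :: "'K^'n" where "u = axis i 1"
    have "\<sigma> a *v (P *v u) = \<psi> a *s (P *v u)" if a: "a \<in> {0..<int p}" for a
    proof -
      have "diag_mat (\<lambda>i. \<zeta> ^ (w i * nat a)) *v u = \<psi> a *s u"
        using a by (auto simp: vec_eq_iff diag_v u_def axis_def \<psi> int_char_def car pw)
      moreover have "\<sigma> a *v (P *v u) = P *v (diag_mat (\<lambda>i. \<zeta> ^ (w i * nat a)) *v u)"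
        by (simp add: matrix_vector_mul_assoc diag[OF a])
      ultimately show ?thesis by (simp add: vec.scale)
    qed
    moreover have "P *v u \<noteq> 0"
    proof
      assume "P *v u = 0"
      then have "Q *v (P *v u) = 0" by simp
      then have "u = 0" by (simp add: matrix_vector_mul_assoc PQ)
      then show False by (simp add: u_def axis_eq_0_iff)
    qed
    ultimately show "char_occurs (integer_mod_group p) \<sigma> \<psi>"
      unfolding char_occurs_def car using int_char_in_characters[OF prim] \<psi> by blast
  qed
qed

section \<open>Orbits of pairs of characters\<close>

text \<open>An endomorphism of a cyclic group is multiplication by the image of 1, and injectivity
  excludes the image 0.\<close>

lemma automorphism_integer_mod_group:
  assumes p: "p > 1" and \<alpha>: "\<alpha> \<in> auto (integer_mod_group p)"
  shows "\<And>x. x \<in> carrier (integer_mod_group p) \<Longrightarrow> \<alpha> x = (x * \<alpha> 1) mod int p"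
    and "\<not> int p dvd \<alpha> 1"
proof -
  let ?G = "integer_mod_group p"
  have car: "carrier ?G = {0..<int p}" using p by (simp add: carrier_integer_mod_group)
  have hom: "\<alpha> \<in> hom ?G ?G" and inj: "inj_on \<alpha> (carrier ?G)"
    using \<alpha> by (auto simp: auto_def Bij_def bij_betw_def)
  have in_car: "\<alpha> x \<in> {0..<int p}" if "x \<in> {0..<int p}" for x
    using hom that by (auto simp: hom_def car)
  have add: "\<alpha> ((x + y) mod int p) = (\<alpha> x + \<alpha> y) mod int p" if "x \<in> {0..<int p}" "y \<in> {0..<int p}" for x y
    using hom_mult[OF hom, of x y] that by (simp add: car)
  have 0: "\<alpha> 0 = 0" using hom_one[OF hom] by simp
  have *: "\<alpha> (int n) = (int n * \<alpha> 1) mod int p" if "int n < int p" for n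
    using that
  proof (induction n)
    case (Suc n)
    have "\<alpha> ((int n + 1) mod int p) = (\<alpha> (int n) + \<alpha> 1) mod int p"
      using Suc.prems p by (intro add) auto
    also have "\<dots> = (int (Suc n) * \<alpha> 1) mod int p"
      using Suc by (simp add: mod_add_left_eq mod_add_right_eq algebra_simps)
    finally show ?case using Suc.prems by (simp add: add.commute)
  qed (simp add: 0)
  show "\<alpha> x = (x * \<alpha> 1) mod int p" if "x \<in> carrier ?G" for x
    using *[of "nat x"] that by (simp add: car)
  show "\<not> int p dvd \<alpha> 1"
  proof
    assume "int p dvd \<alpha> 1"
    then have "\<alpha> 1 = 0" using in_car[of 1] p zdvd_imp_le[of "int p" "\<alpha> 1"] by (cases "\<alpha> 1 = 0") force+
    then have "\<alpha> 1 = \<alpha> 0" using 0 by simp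
    then show False using inj_onD[OF inj, of 1 0] p by (simp add: car)
  qed
qed

lemma automorphism_of_multiplier:
  assumes p: "Factorial_Ring.prime p" and k: "\<not> int p dvd k"
  shows "(\<lambda>x\<in>carrier (integer_mod_group p). (k * x) mod int p) \<in> auto (integer_mod_group p)"
proof -
  let ?G = "integer_mod_group p" and ?f = "\<lambda>x\<in>carrier (integer_mod_group p). (k * x) mod int p"
  have p1: "p > 1" using p by (rule prime_gt_1_nat)
  have car: "carrier ?G = {0..<int p}" using p1 by (simp add: carrier_integer_mod_group)
  have "?f \<in> hom ?G ?G"
    using p1 by (auto simp: hom_def car distrib_left mod_mult_right_eq mod_add_eq)
  moreover have inj: "inj_on ?f (carrier ?G)"
  proof (rule inj_onI)
    fix x y assume xy: "x \<in> carrier ?G" "y \<in> carrier ?G" "?f x = ?f y"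
    then have "(k * x) mod int p = (k * y) mod int p" by simp
    then have "int p dvd k * x - k * y" by (rule mod_eq_dvd_iff[THEN iffD1])
    then have "int p dvd k * (x - y)" by (simp add: algebra_simps)
    then have "int p dvd x - y" using p k by (simp add: prime_dvd_mult_iff)
    then have "x mod int p = y mod int p" by (rule mod_eq_dvd_iff[THEN iffD2])
    then show "x = y" using xy by (simp add: car)
  qed
  moreover have "?f ` carrier ?G = carrier ?G"
    using p1 by (intro endo_inj_surj inj) (auto simp: car)
  ultimately show ?thesis by (auto simp: auto_def Bij_def bij_betw_def)
qed

lemma compose_int_char:
  assumes prim: "is_primitive_root p (\<zeta>::'K::field)" and p: "p > 1"
    and \<alpha>: "\<alpha> \<in> auto (integer_mod_group p)"
  shows "compose (carrier (integer_mod_group p)) (int_char p \<zeta> A) \<alpha> = int_char p \<zeta> (A * \<alpha> 1)"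
proof
  fix x
  show "compose (carrier (integer_mod_group p)) (int_char p \<zeta> A) \<alpha> x = int_char p \<zeta> (A * \<alpha> 1) x"
  proof (cases "x \<in> carrier (integer_mod_group p)")
    case True
    note \<alpha>x = automorphism_integer_mod_group(1)[OF p \<alpha> True]
    have "\<alpha> x \<in> carrier (integer_mod_group p)"
      using \<alpha> True by (auto simp: auto_def hom_def)
    moreover have "int p dvd A * (\<alpha> x - x * \<alpha> 1)"
      unfolding \<alpha>x by (intro dvd_mult) (metis dvd_minus_mod dvd_diff_commute)
    then have "int p dvd A * \<alpha> x - A * \<alpha> 1 * x" by (simp add: algebra_simps)
    ultimately show ?thesis
      using True primitive_root_powi_eq_iff[OF prim] by (simp add: compose_def int_char_def)
  qed (simp add: compose_def int_char_def)
qed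

text \<open>Automorphisms are multiplications by units mod p, and characters depend only on their
  exponent mod p, so k may run over integers.\<close>

lemma char_orbit_pair:
  assumes prim: "is_primitive_root p (\<zeta>::'K::field)" and p: "Factorial_Ring.prime p"
  shows "char_orbit (integer_mod_group p) {int_char p \<zeta> A, int_char p \<zeta> B} =
    {{int_char p \<zeta> (k * A), int_char p \<zeta> (k * B)} | k. \<not> int p dvd k}"
proof -
  let ?G = "integer_mod_group p"
  have p1: "p > 1" using p by (rule prime_gt_1_nat)
  have img: "(\<lambda>\<psi>. compose (carrier ?G) \<psi> \<alpha>) ` {int_char p \<zeta> A, int_char p \<zeta> B} =
      {int_char p \<zeta> (\<alpha> 1 * A), int_char p \<zeta> (\<alpha> 1 * B)}" if "\<alpha> \<in> auto ?G" for \<alpha>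
    using compose_int_char[OF prim p1 that] by (simp add: mult.commute)
  show ?thesis
  proof (intro subset_antisym subsetI)
    fix S assume "S \<in> char_orbit ?G {int_char p \<zeta> A, int_char p \<zeta> B}"
    then show "S \<in> {{int_char p \<zeta> (k * A), int_char p \<zeta> (k * B)} | k. \<not> int p dvd k}"
      using img automorphism_integer_mod_group(2)[OF p1] unfolding char_orbit_def by blast
  next
    fix S assume "S \<in> {{int_char p \<zeta> (k * A), int_char p \<zeta> (k * B)} | k. \<not> int p dvd k}"
    then obtain k where k: "\<not> int p dvd k" "S = {int_char p \<zeta> (k * A), int_char p \<zeta> (k * B)}" by blast
    let ?\<alpha> = "\<lambda>x\<in>carrier ?G. (k * x) mod int p"
    have \<alpha>: "?\<alpha> \<in> auto ?G" by (rule automorphism_of_multiplier[OF p k(1)])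
    have "int p dvd ?\<alpha> 1 * C - k * C" for C
    proof -
      have "int p dvd (k mod int p - k) * C"
        by (intro dvd_mult2) (metis dvd_minus_mod dvd_diff_commute)
      then show ?thesis using p1 by (simp add: left_diff_distrib)
    qed
    then have "int_char p \<zeta> (?\<alpha> 1 * C) = int_char p \<zeta> (k * C)" for C
      using int_char_eq_iff[OF prim p1] by blast
    then have "S = (\<lambda>\<psi>. compose (carrier ?G) \<psi> ?\<alpha>) ` {int_char p \<zeta> A, int_char p \<zeta> B}"
      using img[OF \<alpha>] k(2) by simp
    then show "S \<in> char_orbit ?G {int_char p \<zeta> A, int_char p \<zeta> B}"
      unfolding char_orbit_def using \<alpha> by blast
  qed
qed

text \<open>The orbits agree iff the pair can be scaled to {1, c}; the scaling must send either
  \<open>A\<close> or \<open>B\<close> to 1, which gives the two alternatives.\<close>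

lemma char_orbit_pair_eq_iff:
  fixes A B c :: int
  assumes prim: "is_primitive_root p (\<zeta>::'K::field)" and p: "Factorial_Ring.prime p"
    and A: "\<not> int p dvd A" and B: "\<not> int p dvd B"
  shows "char_orbit (integer_mod_group p) {int_char p \<zeta> A, int_char p \<zeta> B} =
      char_orbit (integer_mod_group p) {int_char p \<zeta> 1, int_char p \<zeta> c} \<longleftrightarrow>
    int p dvd B - c * A \<or> int p dvd A - c * B"
proof
  have p1: "p > 1" using p by (rule prime_gt_1_nat)
  let ?\<chi> = "int_char p \<zeta>" and ?O = "char_orbit (integer_mod_group p)"
  note eq_iff = int_char_eq_iff[OF prim p1]
  have not1: "\<not> int p dvd 1" using p1 by simp
  have self: "{?\<chi> u, ?\<chi> v} \<in> ?O {?\<chi> u, ?\<chi> v}" for u v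
    unfolding char_orbit_pair[OF prim p] using not1
    by (intro CollectI exI[of _ 1]) simp
  {
    assume "?O {?\<chi> A, ?\<chi> B} = ?O {?\<chi> 1, ?\<chi> c}"
    then have "{?\<chi> A, ?\<chi> B} \<in> ?O {?\<chi> 1, ?\<chi> c}" using self by blast
    then obtain k where "{?\<chi> A, ?\<chi> B} = {?\<chi> (k * 1), ?\<chi> (k * c)}"
      unfolding char_orbit_pair[OF prim p] by blast
    then have "(?\<chi> A = ?\<chi> k \<and> ?\<chi> B = ?\<chi> (k * c)) \<or> (?\<chi> A = ?\<chi> (k * c) \<and> ?\<chi> B = ?\<chi> k)"
      by (auto simp: doubleton_eq_iff)
    then consider "int p dvd A - k" "int p dvd B - k * c" | "int p dvd A - k * c" "int p dvd B - k"
      unfolding eq_iff by blast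
    then show "int p dvd B - c * A \<or> int p dvd A - c * B"
    proof cases
      case 1
      have "int p dvd (B - k * c) - c * (A - k)" by (rule dvd_diff[OF 1(2) dvd_mult[OF 1(1)]])
      also have "(B - k * c) - c * (A - k) = B - c * A" by (simp add: algebra_simps)
      finally show ?thesis by simp
    next
      case 2
      have "int p dvd (A - k * c) - c * (B - k)" by (rule dvd_diff[OF 2(1) dvd_mult[OF 2(2)]])
      also have "(A - k * c) - c * (B - k) = A - c * B" by (simp add: algebra_simps)
      finally show ?thesis by simp
    qed
  }
  have orbit: "?O {?\<chi> u, ?\<chi> v} = ?O {?\<chi> 1, ?\<chi> c}" if u: "\<not> int p dvd u" and v: "int p dvd v - c * u" for u v
  proof -
    have vk: "?\<chi> (k * v) = ?\<chi> (k * u * c)" for k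
      unfolding eq_iff using dvd_mult[OF v, of k] by (simp add: algebra_simps)
    \<comment> \<open>The Bezout coefficient \<open>u'\<close> inverts \<open>u\<close> mod p and is
      the multiplier that undoes the scaling by \<open>u\<close>.\<close>
    have "coprime (int p) u" using p u by (simp add: prime_imp_coprime)
    then obtain u' r where "u' * u + r * int p = 1"
      using bezout_int[of u "int p"] by (auto simp: coprime_iff_gcd_eq_1 gcd.commute)
    then have "u * u' - 1 = int p * (- r)" by (simp add: algebra_simps)
    then have u': "int p dvd u * u' - 1" by simp
    have nu': "\<not> int p dvd u'"
    proof
      assume "int p dvd u'"
      then have "int p dvd u * u' - (u * u' - 1)" using dvd_diff[OF dvd_mult u'] by blast
      then show False using not1 by simp
    qed
    have inv: "?\<chi> (l * u' * u * z) = ?\<chi> (l * z)" for l z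
      unfolding eq_iff using dvd_mult[OF u', of "l * z"] by (simp add: algebra_simps)
    show ?thesis
      unfolding char_orbit_pair[OF prim p]
    proof (intro subset_antisym subsetI)
      fix S assume "S \<in> {{?\<chi> (k * u), ?\<chi> (k * v)} | k. \<not> int p dvd k}"
      then obtain k where k: "\<not> int p dvd k" "S = {?\<chi> (k * u), ?\<chi> (k * v)}" by blast
      then show "S \<in> {{?\<chi> (k * 1), ?\<chi> (k * c)} | k. \<not> int p dvd k}"
        using u p vk[of k] by (intro CollectI exI[of _ "k * u"]) (auto simp: prime_dvd_mult_iff)
    next
      fix S assume "S \<in> {{?\<chi> (k * 1), ?\<chi> (k * c)} | k. \<not> int p dvd k}"
      then obtain l where l: "\<not> int p dvd l" "S = {?\<chi> (l * 1), ?\<chi> (l * c)}" by blast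
      then show "S \<in> {{?\<chi> (k * u), ?\<chi> (k * v)} | k. \<not> int p dvd k}"
        using nu' p vk[of "l * u'"] inv[of l 1] inv[of l c]
        by (intro CollectI exI[of _ "l * u'"]) (auto simp: prime_dvd_mult_iff)
    qed
  qed
  show "?O {?\<chi> A, ?\<chi> B} = ?O {?\<chi> 1, ?\<chi> c}" if "int p dvd B - c * A \<or> int p dvd A - c * B"
    using that orbit[OF A, of B] orbit[OF B, of A] by (auto simp: insert_commute)
qed

section \<open>Numerical bounds\<close>

lemma rank2_p: "spans_rank2 p A B p" if "p > 0"
  unfolding spans_rank2_def using that by (intro exI[of _ p] exI[of _ 0] exI[of _ 0] exI[of _ p]) auto

text \<open>Since d^2 - 4d + 2 = p - (d - 1), the hypothesis says B = -(d - 1) A mod p. Then (d - 1,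
  1) lies in the lattice, and so does (1, d - 2), because (d - 1)(d - 2) = p + 1. Both orders of the
  characters are stated because the support is an unordered pair.\<close>

lemma rank2_witness:
  fixes p A B d :: nat
  assumes d: "d \<ge> 4" "int p = int d ^ 2 - 3 * int d + 1"
    and AB: "int p dvd int B - (int d ^ 2 - 4 * int d + 2) * int A"
  shows "spans_rank2 p A B d" "spans_rank2 p B A d"
proof -
  obtain k where k: "int B = (int d ^ 2 - 4 * int d + 2) * int A + int p * k"
    using AB by (metis dvdE diff_add_cancel add.commute)
  \<comment> \<open>The cofactors come from (d - 1) + (d^2 - 4d + 2) = p here and from 1 + (d -
    2)(d^2 - 4d + 2) = (d - 3) p below.\<close>
  have "int p * (A + k) = int ((d - 1) * A + 1 * B)"
    using d(1) unfolding of_nat_add of_nat_mult k d(2)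
    by (simp add: of_nat_diff power2_eq_square algebra_simps)
  then have 1: "p dvd (d - 1) * A + 1 * B"
    by (metis dvd_triv_left of_nat_dvd_iff)
  have "int p * ((int d - 3) * A + (int d - 2) * k) = int (1 * A + (d - 2) * B)"
    using d(1) unfolding of_nat_add of_nat_mult k d(2)
    by (simp add: of_nat_diff power2_eq_square algebra_simps)
  then have 2: "p dvd 1 * A + (d - 2) * B"
    by (metis dvd_triv_left of_nat_dvd_iff)
  obtain n where n: "d = n + 4" using d(1) by (metis add.commute le_iff_add)
  have det: "(d - 1) * (d - 2) \<noteq> 1 * 1" by (simp add: n)
  show "spans_rank2 p A B d"
    unfolding spans_rank2_def
    by (rule exI[of _ "d - 1"], rule exI[of _ 1], rule exI[of _ 1], rule exI[of _ "d - 2"])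
       (use 1 2 d(1) det in auto)
  show "spans_rank2 p B A d"
    unfolding spans_rank2_def
    by (rule exI[of _ 1], rule exI[of _ "d - 1"], rule exI[of _ "d - 2"], rule exI[of _ 1])
       (use 1 2 d(1) det in \<open>auto simp: add.commute\<close>)
qed

text \<open>If \<Gamma> < p, the extremal bound gives p <= (\<Gamma> - 1)^2 - \<Gamma>; the value
  \<Gamma> = p is treated separately. Given the lower bound, equality with the ceiling means
  (\<Gamma> - 2)^2 < p, the hypothesis of the second part of \<open>rank2_extremal\<close>.\<close>

lemma least_rank2_bounds:
  fixes p A B :: nat
  assumes p: "Factorial_Ring.prime p" "odd p"
    and AB: "\<not> p dvd A" "\<not> p dvd B" "\<not> int p dvd int A - int B"
  defines "\<Gamma> \<equiv> LEAST d. spans_rank2 p A B d"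
  shows "int \<Gamma> \<ge> \<lceil>sqrt (real p) + 1\<rceil>"
    and "int \<Gamma> = \<lceil>sqrt (real p) + 1\<rceil> \<longleftrightarrow> p = 3 \<or>
      (\<exists>d::nat. d \<ge> 4 \<and> int p = int d ^ 2 - 3 * int d + 1 \<and>
        (int p dvd int B - (int d ^ 2 - 4 * int d + 2) * int A \<or>
         int p dvd int A - (int d ^ 2 - 4 * int d + 2) * int B))"
proof -
  have p3: "p \<ge> 3" using p prime_ge_2_nat[of p] by (cases "p = 2") auto
  have rank: "spans_rank2 p A B \<Gamma>"
    unfolding \<Gamma>_def by (rule LeastI[of "spans_rank2 p A B" p]) (use rank2_p p3 in simp)
  have least: "\<Gamma> \<le> d" if "spans_rank2 p A B d" for d
    unfolding \<Gamma>_def using that by (rule Least_le)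
  have \<Gamma>p: "\<Gamma> \<le> p" using least rank2_p[of p A B] p3 by simp
  note ext = rank2_extremal[OF p(1) AB rank]
  have ge2: "\<Gamma> \<ge> 2" and sq: "int p \<le> (int \<Gamma> - 1) ^ 2"
  proof -
    have "\<Gamma> \<ge> 2 \<and> int p \<le> (int \<Gamma> - 1) ^ 2"
    proof (cases "\<Gamma> < p")
      case True
      then have 1: "int p \<le> int \<Gamma> ^ 2 - 3 * int \<Gamma> + 1" by (rule ext(1))
      have "\<Gamma> \<ge> 2"
      proof (rule ccontr)
        assume "\<not> \<Gamma> \<ge> 2"
        then have "\<Gamma> = 0 \<or> \<Gamma> = 1" by auto
        then show False using 1 p3 by (auto simp: power2_eq_square)
      qed
      then show ?thesis using 1 by (simp add: power2_eq_square algebra_simps)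
    next
      case False
      then have e: "\<Gamma> = p" using \<Gamma>p by simp
      have "2 * (int p - 1) \<le> (int p - 1) * (int p - 1)" using p3 by (intro mult_right_mono) auto
      moreover have "int p \<le> 2 * (int p - 1)" using p3 by simp
      ultimately have "int p \<le> (int \<Gamma> - 1) ^ 2" unfolding e power2_eq_square by (rule order_trans[rotated])
      then show ?thesis using e p3 by auto
    qed
    then show "\<Gamma> \<ge> 2" "int p \<le> (int \<Gamma> - 1) ^ 2" by auto
  qed
  have "real p \<le> (real \<Gamma> - 1) ^ 2"
    using sq by (metis (mono_tags, lifting) of_int_1 of_int_diff of_int_le_iff of_int_of_nat_eq of_int_power)
  then have "sqrt (real p) \<le> real \<Gamma> - 1" using ge2 by (intro real_le_lsqrt) auto
  then show lower: "int \<Gamma> \<ge> \<lceil>sqrt (real p) + 1\<rceil>" by (intro ceiling_le) simp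
  have eq_iff: "int \<Gamma> = \<lceil>sqrt (real p) + 1\<rceil> \<longleftrightarrow> (int \<Gamma> - 2) ^ 2 < int p"
  proof -
    have "int \<Gamma> = \<lceil>sqrt (real p) + 1\<rceil> \<longleftrightarrow> int \<Gamma> - 1 < \<lceil>sqrt (real p) + 1\<rceil>"
      using lower by auto
    also have "\<dots> \<longleftrightarrow> real \<Gamma> - 2 < sqrt (real p)"
      unfolding less_ceiling_iff by auto
    also have "\<dots> \<longleftrightarrow> (real \<Gamma> - 2) ^ 2 < real p"
      using ge2 by (metis abs_of_nonneg diff_ge_0_iff_ge of_nat_mono of_nat_numeral real_sqrt_abs real_sqrt_less_iff)
    also have "\<dots> \<longleftrightarrow> real_of_int ((int \<Gamma> - 2) ^ 2) < real_of_int (int p)" by simp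
    also have "\<dots> \<longleftrightarrow> (int \<Gamma> - 2) ^ 2 < int p" by (rule of_int_less_iff)
    finally show ?thesis .
  qed
  show "int \<Gamma> = \<lceil>sqrt (real p) + 1\<rceil> \<longleftrightarrow> p = 3 \<or>
      (\<exists>d::nat. d \<ge> 4 \<and> int p = int d ^ 2 - 3 * int d + 1 \<and>
        (int p dvd int B - (int d ^ 2 - 4 * int d + 2) * int A \<or>
         int p dvd int A - (int d ^ 2 - 4 * int d + 2) * int B))"
    unfolding eq_iff
  proof
    assume sm: "(int \<Gamma> - 2) ^ 2 < int p"
    show "p = 3 \<or> (\<exists>d::nat. d \<ge> 4 \<and> int p = int d ^ 2 - 3 * int d + 1 \<and>
        (int p dvd int B - (int d ^ 2 - 4 * int d + 2) * int A \<or>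
         int p dvd int A - (int d ^ 2 - 4 * int d + 2) * int B))"
    proof (cases "\<Gamma> < p")
      case True
      have e: "int p = int \<Gamma> ^ 2 - 3 * int \<Gamma> + 1"
        and d: "p dvd (\<Gamma> - 1) * A + B \<or> p dvd (\<Gamma> - 1) * B + A"
        using ext(2)[OF True sm] by auto
      \<comment> \<open>For \<Gamma> <= 3 the polynomial takes only the values 1 and -1.\<close>
      have "\<Gamma> \<ge> 4"
      proof (rule ccontr)
        assume "\<not> \<Gamma> \<ge> 4"
        then have "\<Gamma> = 0 \<or> \<Gamma> = 1 \<or> \<Gamma> = 2 \<or> \<Gamma> = 3" by auto
        then show False using e p3 by (auto simp: power2_eq_square)
      qed
      \<comment> \<open>Subtracting p u changes the coefficient \<Gamma> - 1 into \<Gamma> - 1 - p =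
        -(\<Gamma>^2 - 4 \<Gamma> + 2).\<close>
      moreover have "int p dvd int v - (int \<Gamma> ^ 2 - 4 * int \<Gamma> + 2) * int u" if "p dvd (\<Gamma> - 1) * u + v" for u v
      proof -
        have \<Gamma>1: "int (\<Gamma> - 1) = int \<Gamma> - 1" using ge2 by simp
        have "int p dvd int ((\<Gamma> - 1) * u + v) - int p * int u"
          by (intro dvd_diff iffD2[OF of_nat_dvd_iff that] dvd_triv_left)
        also have "int ((\<Gamma> - 1) * u + v) - int p * int u = int v - (int \<Gamma> ^ 2 - 4 * int \<Gamma> + 2) * int u"
          unfolding e of_nat_add of_nat_mult \<Gamma>1 by (simp add: power2_eq_square algebra_simps)
        finally show ?thesis .
      qed
      ultimately show ?thesis using e d by blast
    next
      case False
      then have e: "\<Gamma> = p" using \<Gamma>p by simp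
      \<comment> \<open>For p >= 4 one has (p - 2)^2 >= 2(p - 2) >= p.\<close>
      have "p = 3"
      proof (rule ccontr)
        assume "p \<noteq> 3"
        then have "p \<ge> 4" using p3 by simp
        then have "2 * (int p - 2) \<le> (int p - 2) * (int p - 2)" by (intro mult_right_mono) auto
        moreover have "int p \<le> 2 * (int p - 2)" using \<open>p \<ge> 4\<close> by simp
        ultimately have "int p \<le> (int p - 2) * (int p - 2)" by (rule order_trans[rotated])
        then show False using sm unfolding e power2_eq_square by simp
      qed
      then show ?thesis by simp
    qed
  next
    assume "p = 3 \<or> (\<exists>d::nat. d \<ge> 4 \<and> int p = int d ^ 2 - 3 * int d + 1 \<and>
        (int p dvd int B - (int d ^ 2 - 4 * int d + 2) * int A \<or>
         int p dvd int A - (int d ^ 2 - 4 * int d + 2) * int B))"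
    then consider "p = 3" | d :: nat where "d \<ge> 4" "int p = int d ^ 2 - 3 * int d + 1" "spans_rank2 p A B d"
      using rank2_witness by blast
    then show "(int \<Gamma> - 2) ^ 2 < int p"
    proof cases
      case 1
      \<comment> \<open>For both values (\<Gamma> - 2)^2 is at most 1.\<close>
      then have "\<Gamma> = 2 \<or> \<Gamma> = 3" using ge2 \<Gamma>p by auto
      then show ?thesis using 1 by auto
    next
      case 2
      have "(int \<Gamma> - 2) ^ 2 \<le> (int d - 2) ^ 2"
        using least[OF 2(3)] ge2 by (intro power_mono) auto
      \<comment> \<open>Here p - (d - 2)^2 = d - 3, which is positive since d >= 4.\<close>
      also have "\<dots> < int p" using 2 by (simp add: power2_eq_square algebra_simps)
      finally show ?thesis .
    qed
  qed
qed

section \<open>Field maps on matrices, the dual representation, and the final assembly\<close>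

lemma map_matrix_mult:
  fixes f :: "'a::semiring_1 \<Rightarrow> 'b::semiring_1"
  assumes "f 0 = 0" "\<And>x y. f (x + y) = f x + f y" "\<And>x y. f (x * y) = f x * f y"
  shows "map_matrix f (A ** B) = map_matrix f A ** map_matrix f B"
proof -
  have sum: "f (\<Sum>i\<in>I. h i) = (\<Sum>i\<in>I. f (h i))" for h :: "'i \<Rightarrow> 'a" and I
    by (induction I rule: infinite_finite_induct) (simp_all add: assms)
  show ?thesis by (simp add: vec_eq_iff matrix_matrix_mult_def sum assms)
qed

lemma map_matrix_diag_mat: "f 0 = 0 \<Longrightarrow> map_matrix f (diag_mat c) = diag_mat (\<lambda>i. f (c i))"
  by (simp add: vec_eq_iff diag_mat_def)

lemma map_matrix_mat_1: "f 0 = 0 \<Longrightarrow> f 1 = 1 \<Longrightarrow> map_matrix f (mat 1) = mat 1"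
  by (simp add: vec_eq_iff mat_def)

text \<open>The indeterminate of \<open>K(T)\<close> provides the element of infinite order.\<close>

lemma (in diagonalized_rep) weight_functional_infinite_dimension:
  assumes \<alpha>: "\<alpha> i0 \<noteq> 0" "\<And>m. p dvd wdeg w m \<Longrightarrow> mdeg m \<le> d \<Longrightarrow>
      (\<Sum>i\<in>UNIV. \<alpha> i * int (Poly_Mapping.lookup m i)) = 0"
  shows "\<not> ring.finite_dimension ring_of_type_algebra (field_adjoin (inv_polys_le G \<rho> d)) (inv_rats G \<rho>)"
proof -
  define \<kappa> where "\<kappa> = (\<lambda>c::'K. Fract [:c:] 1)"
  define T where "T = (Fract (monom 1 1) 1 :: 'K poly fract)"
  have \<kappa>: "\<kappa> 0 = 0" "\<kappa> 1 = 1" "\<kappa> (a + b) = \<kappa> a + \<kappa> b" "\<kappa> (a * b) = \<kappa> a * \<kappa> b" for a b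
    by (simp_all add: \<kappa>_def Zero_fract_def One_fract_def eq_fract)
  have \<kappa>_pow: "\<kappa> (a ^ n) = \<kappa> a ^ n" for a n
    by (induction n) (simp_all add: \<kappa>)
  have \<kappa>_inj: "\<kappa> a = \<kappa> b \<longleftrightarrow> a = b" for a b
    by (simp add: \<kappa>_def eq_fract)
  have Tpow: "T ^ n = Fract (monom 1 n) 1" for n
    by (induction n) (simp_all add: T_def One_fract_def mult_monom)
  have Tpow1: "n = 0" if "T ^ n = 1" for n
  proof -
    have "monom (1::'K) n = monom 1 0" using that by (simp add: Tpow One_fract_def eq_fract)
    then show ?thesis by (metis degree_monom_eq one_neq_zero)
  qed
  have T0: "T \<noteq> 0" using Tpow[of 1] by (simp add: Zero_fract_def eq_fract)
  have T1: "z = 0" if "T powi z = 1" for z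
    using that Tpow1 by (cases z rule: int_cases2) (auto simp: power_int_minus)
  have prim': "is_primitive_root p (\<kappa> \<zeta>)"
    using prim \<kappa>_inj \<kappa>(2) unfolding is_primitive_root_def \<kappa>_pow[symmetric] by metis
  interpret E: diagonalized_rep p \<rho> "\<lambda>c. \<kappa> (\<iota> c)" "\<kappa> \<zeta>" "map_matrix \<kappa> P" "map_matrix \<kappa> Q" w
  proof
    show "map_matrix \<kappa> P ** map_matrix \<kappa> Q = mat 1" "map_matrix \<kappa> Q ** map_matrix \<kappa> P = mat 1"
      by (simp_all add: PQ \<kappa> map_matrix_mat_1 flip: map_matrix_mult)
    fix a assume a: "a \<in> {0..<int p}"
    have "map_matrix (\<lambda>c. \<kappa> (\<iota> c)) (\<rho> a) ** map_matrix \<kappa> P = map_matrix \<kappa> (map_matrix \<iota> (\<rho> a) ** P)"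
      by (simp add: map_matrix_mult \<kappa>) (simp add: map_matrix_def)
    also have "\<dots> = map_matrix \<kappa> P ** diag_mat (\<lambda>i. \<kappa> \<zeta> ^ (w i * nat a))"
      by (simp add: diag[OF a] map_matrix_mult map_matrix_diag_mat \<kappa> \<kappa>_pow)
    finally show "map_matrix (\<lambda>c. \<kappa> (\<iota> c)) (\<rho> a) ** map_matrix \<kappa> P =
        map_matrix \<kappa> P ** diag_mat (\<lambda>i. \<kappa> \<zeta> ^ (w i * nat a))" .
  qed (simp_all add: prime char rep \<kappa> prim')
  \<comment> \<open>The conclusion speaks only of objects over \<open>k\<close>, so it may be
    obtained from the extension \<open>K(T)\<close> in place of \<open>K\<close>.\<close>
  show ?thesis by (rule E.infinite_dimension_inv_rats[OF T0 T1 \<alpha>])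
qed

lemma (in diagonalized_rep) nontrivial_chars_diagonalized:
  "nontrivial_chars G \<iota> \<rho> = (\<lambda>i. int_char p \<zeta> (int (w i))) ` {i. \<not> p dvd w i}"
proof -
  have diag': "base_change \<iota> \<rho> a ** P = P ** diag_mat (\<lambda>i. \<zeta> ^ (w i * nat a))" if "a \<in> {0..<int p}" for a
    using diag[OF that] by (simp add: base_change_def)
  have occurs: "char_occurs G (base_change \<iota> \<rho>) \<psi> \<longleftrightarrow> (\<exists>i. \<psi> = int_char p \<zeta> (int (w i)))" for \<psi>
    by (rule char_occurs_diagonal[OF prim PQ diag'])
  have "int_char p \<zeta> (int (w i)) = (\<lambda>g\<in>carrier G. 1) \<longleftrightarrow> p dvd w i" for i
    unfolding int_char_0[of p \<zeta>, symmetric] int_char_eq_iff[OF prim p_gt_1] by simp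
  then show ?thesis
    unfolding nontrivial_chars_def occurs by auto
qed

text \<open>The columns of \<open>transpose Q\<close> form the dual eigenbasis, with inverse
  eigenvalues.\<close>

lemma (in diagonalized_rep) Supp'_diagonalized:
  assumes w: "\<And>i. w i < p"
  shows "Supp' G \<iota> \<rho> = (\<lambda>i. int_char p \<zeta> (- int (w i))) ` {i. \<not> p dvd w i}"
proof -
  \<comment> \<open>A natural number representing the negative of \<open>w i\<close>; it is p rather
    than 0 when \<open>w i = 0\<close>.\<close>
  let ?w = "\<lambda>i. p - w i"
  have PQ': "transpose Q ** transpose P = mat 1" "transpose P ** transpose Q = mat 1"
    by (simp_all add: PQ flip: matrix_transpose_mul)
  have diag': "base_change \<iota> (dual_rep G \<rho>) a ** transpose Q = transpose Q ** diag_mat (\<lambda>i. \<zeta> ^ (?w i * nat a))"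
    if a: "a \<in> {0..<int p}" for a
  proof -
    define b where "b = (- a) mod int p"
    have b: "b \<in> {0..<int p}" using p_gt_1 by (simp add: b_def)
    let ?D = "diag_mat (\<lambda>i. \<zeta> ^ (w i * nat b))"
    have "\<zeta> ^ (w i * nat b) = \<zeta> ^ (?w i * nat a)" for i
    proof -
      have ub: "int (nat b) = b" "int (nat a) = a" "int (?w i) = int p - int (w i)"
        using a b w[of i] by auto
      have "int p dvd - a - b" unfolding b_def by (rule dvd_minus_mod)
      then have "int p dvd - (int (w i) * (- a - b)) - int p * a" by (intro dvd_diff) auto
      also have "- (int (w i) * (- a - b)) - int p * a = int (w i * nat b) - int (?w i * nat a)"
        unfolding of_nat_mult ub by (simp add: algebra_simps)
      finally have "\<zeta> powi int (w i * nat b) = \<zeta> powi int (?w i * nat a)"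
        using primitive_root_powi_eq_iff[OF prim] by blast
      then show ?thesis by (simp only: power_int_of_nat)
    qed
    then have D: "transpose ?D = diag_mat (\<lambda>i. \<zeta> ^ (?w i * nat a))"
      by (auto simp: vec_eq_iff transpose_def diag_mat_def)
    have "Q ** map_matrix \<iota> (\<rho> b) = Q ** (map_matrix \<iota> (\<rho> b) ** P) ** Q"
      by (simp add: matrix_mul_assoc[symmetric] PQ matrix_mul_rid)
    also have "\<dots> = ?D ** Q"
      by (simp add: diag[OF b] matrix_mul_assoc PQ matrix_mul_lid)
    finally have "transpose (Q ** map_matrix \<iota> (\<rho> b)) = transpose (?D ** Q)" by simp
    then have "transpose (map_matrix \<iota> (\<rho> b)) ** transpose Q = transpose Q ** transpose ?D"
      by (simp only: matrix_transpose_mul)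
    moreover have "base_change \<iota> (dual_rep G \<rho>) a = transpose (map_matrix \<iota> (\<rho> b))"
      using a by (simp add: base_change_def dual_rep_def carrier_G b_def vec_eq_iff transpose_def)
    ultimately show ?thesis by (simp add: D)
  qed
  have eq: "int_char p \<zeta> (int (?w i)) = int_char p \<zeta> (- int (w i))" for i
    unfolding int_char_eq_iff[OF prim p_gt_1] using w[of i] by (simp add: of_nat_diff)
  have occurs: "char_occurs G (base_change \<iota> (dual_rep G \<rho>)) \<psi> \<longleftrightarrow>
      (\<exists>i. \<psi> = int_char p \<zeta> (int (?w i)))" for \<psi>
    by (rule char_occurs_diagonal[OF prim PQ' diag'])
  have "int_char p \<zeta> (- int (w i)) = (\<lambda>g\<in>carrier G. 1) \<longleftrightarrow> p dvd w i" for i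
    unfolding int_char_0[of p \<zeta>, symmetric] int_char_eq_iff[OF prim p_gt_1] by simp
  then show ?thesis
    unfolding Supp'_def nontrivial_chars_def occurs eq by auto
qed

lemma diagonalized_rep_exists:
  fixes \<rho> :: "int \<Rightarrow> 'k::field^'n::{finite,linorder}^'n::{finite,linorder}" and \<iota> :: "'k \<Rightarrow> 'K::field"
  assumes p: "Factorial_Ring.prime p" "CHAR('k) \<noteq> p" and rep: "is_rep (integer_mod_group p) \<rho>"
    and \<iota>: "field_embedding \<iota>" and prim: "is_primitive_root p \<zeta>"
  shows "\<exists>P Q w. diagonalized_rep p \<rho> \<iota> \<zeta> P Q w \<and> (\<forall>i. w i < p)"
proof -
  have p0: "p > 0" using p(1) by (rule prime_gt_0_nat)
  have \<iota>': "\<iota> 1 = 1" "\<iota> (a + b) = \<iota> a + \<iota> b" "\<iota> (a * b) = \<iota> a * \<iota> b" for a b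
    using \<iota> by (auto simp: field_embedding_def ring_hom_def)
  have "\<iota> 0 = \<iota> 0 + \<iota> 0" using \<iota>'(2)[of 0 0] by (simp only: add_0)
  then have \<iota>0: "\<iota> 0 = 0" by (rule iffD1[OF add_cancel_right_right])
  note \<iota>s = \<iota>0 \<iota>'
  let ?\<sigma> = "\<lambda>a. map_matrix \<iota> (\<rho> a)"
  have mult: "?\<sigma> a ** ?\<sigma> b = ?\<sigma> ((a + b) mod int p)" if "a \<in> {0..<int p}" "b \<in> {0..<int p}" for a b
    using is_rep_mult[OF rep p0 that] by (simp add: \<iota>s flip: map_matrix_mult)
  have one: "?\<sigma> 0 = mat 1" by (simp add: is_rep_0[OF rep p0] map_matrix_mat_1 \<iota>s)
  have "\<exists>P Q :: 'K^'n::{finite,linorder}^'n::{finite,linorder}. \<exists>w. P ** Q = mat 1 \<and> Q ** P = mat 1 \<and> (\<forall>i. w i < p) \<and>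
      (\<forall>a\<in>{0..<int p}. ?\<sigma> a ** P = P ** diag_mat (\<lambda>i. \<zeta> ^ (w i * nat a)))"
    by (rule cyclic_rep_diagonalizable[OF prim of_nat_prime_nonzero_extension[OF \<iota>s p] mult one])
  then obtain P Q :: "'K^'n::{finite,linorder}^'n::{finite,linorder}" and w where "P ** Q = mat 1" "Q ** P = mat 1" "\<forall>i. w i < p"
    "\<forall>a\<in>{0..<int p}. ?\<sigma> a ** P = P ** diag_mat (\<lambda>i. \<zeta> ^ (w i * nat a))" by blast
  then have "diagonalized_rep p \<rho> \<iota> \<zeta> P Q w"
    by unfold_locales (use p rep prim \<iota>s in auto)
  with \<open>\<forall>i. w i < p\<close> show ?thesis by blast
qed

theorem proposition4p7:
  fixes p :: nat
    and \<rho> :: "int \<Rightarrow> 'k::field^'n::{finite,linorder}^'n::{finite,linorder}"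
    and \<iota> :: "'k \<Rightarrow> 'K::field"
    and \<zeta> :: 'K
  defines "G \<equiv> integer_mod_group p"
  assumes "Factorial_Ring.prime p" and "odd p"
    and "CHAR('k) \<noteq> p"
    and "is_rep G \<rho>" and "faithful G \<rho>"
    and "field_embedding \<iota>" and "is_primitive_root p \<zeta>"
    and "card (nontrivial_chars G \<iota> \<rho>) = 2"
  shows "beta_field G \<rho> = gamma_field G \<rho> \<and>
    int (gamma_field G \<rho>) \<ge> \<lceil>sqrt (real p) + 1\<rceil> \<and>
    (int (gamma_field G \<rho>) = \<lceil>sqrt (real p) + 1\<rceil> \<longleftrightarrow>
      p = 3 \<or>
      (\<exists>d::nat. d \<ge> 4 \<and> int p = int d ^ 2 - 3 * int d + 1 \<and>
        char_orbit G (Supp' G \<iota> \<rho>) =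
        char_orbit G {int_char p \<zeta> 1, int_char p \<zeta> (int d ^ 2 - 4 * int d + 2)}))"
proof -
  note p = \<open>Factorial_Ring.prime p\<close> and prim = \<open>is_primitive_root p \<zeta>\<close>
  obtain P Q w where D: "diagonalized_rep p \<rho> \<iota> \<zeta> P Q w" and w: "\<And>i. w i < p"
    using diagonalized_rep_exists[of p \<rho> \<iota> \<zeta>] assms unfolding G_def by blast
  interpret D: diagonalized_rep p \<rho> \<iota> \<zeta> P Q w by (rule D)
  note p1 = D.p_gt_1
  have dvd_w: "p dvd w i \<longleftrightarrow> w i = 0" for i using w[of i] by (auto dest: dvd_imp_le)
  have inj: "inj_on (\<lambda>a. int_char p \<zeta> (int a)) {..<p}"
  proof (rule inj_onI)
    fix a b assume ab: "a \<in> {..<p}" "b \<in> {..<p}" "int_char p \<zeta> (int a) = int_char p \<zeta> (int b)"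
    then have "int a mod int p = int b mod int p"
      using int_char_eq_iff[OF prim p1] mod_eq_dvd_iff by blast
    then show "a = b" using ab by simp
  qed
  have "nontrivial_chars G \<iota> \<rho> = (\<lambda>a. int_char p \<zeta> (int a)) ` w ` {i. w i \<noteq> 0}"
    unfolding G_def D.nontrivial_chars_diagonalized dvd_w by (simp add: image_image)
  moreover have "inj_on (\<lambda>a. int_char p \<zeta> (int a)) (w ` {i. w i \<noteq> 0})"
    using w by (intro inj_on_subset[OF inj]) auto
  ultimately have "card (w ` {i. w i \<noteq> 0}) = 2"
    using assms(9) by (simp add: card_image)
  then obtain A B where AB: "w ` {i. w i \<noteq> 0} = {A, B}" "A \<noteq> B"
    unfolding card_2_iff by blast
  have "A \<in> w ` {i. w i \<noteq> 0}" "B \<in> w ` {i. w i \<noteq> 0}" unfolding AB(1) by simp_all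
  then obtain iA iB where iA: "w iA = A" "A \<noteq> 0" and iB: "w iB = B" "B \<noteq> 0" by blast
  have w_cases: "w i \<in> {0, A, B}" for i
  proof (cases "w i = 0")
    case False
    then have "w i \<in> w ` {i. w i \<noteq> 0}" by blast
    then show ?thesis unfolding AB(1) by simp
  qed simp
  have ndvd: "\<not> p dvd A" "\<not> p dvd B" using dvd_w[of iA] dvd_w[of iB] iA iB by auto
  have ndvd_diff: "\<not> int p dvd int A - int B"
  proof
    assume "int p dvd int A - int B"
    then have "int A mod int p = int B mod int p" by (simp add: mod_eq_dvd_iff)
    then show False using w[of iA] w[of iB] iA iB AB(2) by simp
  qed
  note two = AB(2) iA(2) iB(2) w_cases iA(1) iB(1)
  \<comment> \<open>This and the next two facts close a cycle: rank two gives generation, generation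
    gives finiteness, finiteness gives rank two. So both least degrees are taken over the same
    set.\<close>
  have gen: "field_adjoin (inv_polys_le G \<rho> d) = inv_rats G \<rho>" if "spans_rank2 p A B d" for d
    unfolding G_def
    by (rule D.field_adjoin_eq_inv_rats, rule low_monoid_two_weights[OF that two])
  have fin: "ring.finite_dimension ring_of_type_algebra (field_adjoin (inv_polys_le G \<rho> d)) (inv_rats G \<rho>)"
    if "field_adjoin (inv_polys_le G \<rho> d) = inv_rats G \<rho>" for d
  proof -
    interpret R: field "ring_of_type_algebra :: ('n, 'k) rats ring" by (rule field_from_type_algebra)
    show ?thesis
      using R.finite_dimensionI[OF R.dimension_one[OF field_adjoin_subfield[of "inv_polys_le G \<rho> d"]]]
      unfolding that .
  qed
  have rank: "spans_rank2 p A B d"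
    if f: "ring.finite_dimension ring_of_type_algebra (field_adjoin (inv_polys_le G \<rho> d)) (inv_rats G \<rho>)" for d
  proof (rule ccontr)
    assume "\<not> spans_rank2 p A B d"
    then show False
    proof (rule weight_functional_two_weights[OF _ two])
      fix \<alpha> :: "'n \<Rightarrow> int" and i0
      assume \<alpha>: "\<alpha> i0 \<noteq> 0" "\<And>m. p dvd wdeg w m \<Longrightarrow> mdeg m \<le> d \<Longrightarrow>
        (\<Sum>i\<in>UNIV. \<alpha> i * int (Poly_Mapping.lookup m i)) = 0"
      show False using D.weight_functional_infinite_dimension[OF \<alpha>] f unfolding G_def by blast
    qed
  qed
  have beta: "beta_field G \<rho> = (LEAST d. spans_rank2 p A B d)"
    unfolding beta_field_def using gen fin rank by (intro arg_cong[where f = Least] ext) blast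
  have gamma: "gamma_field G \<rho> = (LEAST d. spans_rank2 p A B d)"
    unfolding gamma_field_def using gen fin rank by (intro arg_cong[where f = Least] ext) blast
  have "Supp' G \<iota> \<rho> = (\<lambda>a. int_char p \<zeta> (- int a)) ` w ` {i. w i \<noteq> 0}"
    unfolding G_def D.Supp'_diagonalized[OF w] dvd_w by (simp add: image_image)
  then have supp: "Supp' G \<iota> \<rho> = {int_char p \<zeta> (- int A), int_char p \<zeta> (- int B)}"
    unfolding AB(1) by simp
  have neg: "\<not> int p dvd - int A" "\<not> int p dvd - int B" using ndvd by simp_all
  have orbit: "char_orbit G (Supp' G \<iota> \<rho>) = char_orbit G {int_char p \<zeta> 1, int_char p \<zeta> c} \<longleftrightarrow>
      int p dvd int B - c * int A \<or> int p dvd int A - c * int B" for c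
  proof -
    \<comment> \<open>The signs come from passing to the dual; changing both of them leaves the
      congruences intact.\<close>
    have "int p dvd - int B - c * - int A \<longleftrightarrow> int p dvd int B - c * int A"
         "int p dvd - int A - c * - int B \<longleftrightarrow> int p dvd int A - c * int B"
      by (metis dvd_minus_iff minus_diff_eq minus_diff_minus mult_minus_right)+
    then show ?thesis
      unfolding supp unfolding G_def char_orbit_pair_eq_iff[OF prim p neg] by simp
  qed
  show ?thesis
    unfolding orbit beta gamma
    using least_rank2_bounds[OF p \<open>odd p\<close> ndvd ndvd_diff] by blast
qed

end
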